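(* Let $V$ be a complex-analytic Lie group, $G$ a finite group acting on $V$, $\gimel\subset V$ a $G$-invariant subgroup and $v\in V$. Let $\mathcal A\subset\mathcal S(V)^G$ be a subalgebra which contains $H^0(V,\mathcal O^G)$ and preserves the vector space $\mathfrak O^G|_{(G\ltimes\gimel)\cdot v/G}$. Let $w\in(G\ltimes\gimel)\cdot v$, $\bar w=G\cdot w$, let $\tilde 1_{\bar w}\in\mathbb E^G_{\bar w}$ be the class of the constant function $1$, and let $N_{\bar w}$ be the $\mathcal A$-submodule of $M(G,(G\ltimes\gimel)\cdot v)$ generated by $\tilde 1_{\bar w}$. Assume that $H^0(V,\mathcal O^G)$ separates the $G$-orbits in $(G\ltimes\gimel)\cdot v$ and that the $H^0(V,\mathcal O^G)$-module $\mathbb E^G_{\bar w}$ is generated by $\tilde 1_{\bar w}$. Then $N_{\bar w}$ has a unique maximal submodule.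
   Context: $G$ acts on $V$ by holomorphic group automorphisms, written $g\cdot v=gvg^{-1}$ in $G\ltimes V$; $e$ is the identity of $V$. $\mathcal O$ and $\mathcal M$ are the sheaves of holomorphic and meromorphic functions on $V$, with germs $\mathcal O_x,\mathcal M_x$. For $\xi\in V$, $\phi_\xi$ is left translation $x\mapsto \xi x$; on germs $\phi_\xi(f)(x)=f(\xi^{-1}x)$. Also $(g\cdot f)(x)=f(g^{-1}\cdot x)$. $H^0(V,\mathcal O^G)$ is the algebra of global $G$-invariant holomorphic functions on $V$. $\mathcal S(V)$ is the skew-group ring of finite sums $\sum_i f_i\phi_{\xi_i}$ with $f_i$ meromorphic on $V$ and $\xi_i\in V$, with product $f\phi_\xi\circ f'\phi_{\xi'}=f\,\phi_\xi(f')\,\phi_{\xi\xi'}$; it acts on $\bigoplus_{x\in V}\mathcal M_x$ by $f\phi_\xi:\mathcal M_x\to\mathcal M_{\xi x}$, $F\mapsto f\phi_\xi(F)$. $G$ acts on it by $g\cdot(f\phi_\xi)=(g\cdot f)\phi_{g\cdot\xi}$, with invariants $\mathcal S(V)^G$. For a $G$-orbit $\bar x$ put $\mathcal O^G_{\bar x}=\big(\bigoplus_{x'\in\bar x}\mathcal O_{x'}\big)^G$, and for $G$-invariant $W\subset V$ put $\mathfrak O^G|_{W/G}=\bigoplus_{\bar x\in W/G}\mathcal O^G_{\bar x}$. $(G\ltimes\gimel)\cdot v=\{g\cdot(\xi v): g\in G,\xi\in\gimel\}$. For $\xi\in V$ let $G_\xi$ be its stabilizer and $\mathcal O^G_\xi=\mathcal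 O_\xi^{G_\xi}=\phi_\xi(\mathcal O_e^{G_\xi})$. $\mathcal J_e\subset\mathcal O_e$ is the ideal generated by the $G$-invariant germs at $e$ vanishing at $e$; $\mathbb E_\xi=\mathcal O^G_\xi/\phi_\xi(\mathcal O_e^{G_\xi}\cap\mathcal J_e)$; $\mathbb E^G_{\bar\xi}=\big(\bigoplus_{\xi'\in\bar\xi}\mathbb E_{\xi'}\big)^G$, a quotient of $\mathcal O^G_{\bar\xi}$; $M(G,W)=\bigoplus_{\bar\xi\in W/G}\mathbb E^G_{\bar\xi}$, a quotient of $\mathfrak O^G|_{W/G}$, on which $\mathcal A$ acts by the induced action (this is well defined whenever $\mathcal A$ preserves $\mathfrak O^G|_{W/G}$ with $W=(G\ltimes\gimel)\cdot v$). *)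

theory Defs
  imports "HOL-Analysis.Analysis" "HOL-Algebra.Group_Action" "HOL-Algebra.QuotRing"
    "HOL-Algebra.Module"
begin

section \<open>Complex Lie groups\<close>

text \<open>
  A complex Lie group is a group with a topology and a complex atlas. Charts take values in a
  complex subspace \<open>model\<close> of some \<open>complex ^ 'n\<close>; a proper subspace is allowed so as to
  include the groups of dimension 0.
\<close>

record ('a, 'n) lie_group = "'a monoid" +
  topo :: "'a topology"
  model :: "(complex ^ 'n) set"
  atlas :: "('a set \<times> ('a \<Rightarrow> complex ^ 'n)) set"

text \<open>
  \<open>scl\<close> is the complex scalar multiplication of the ambient space. In all uses \<open>D\<close> is relatively
  open in a complex subspace; since a complex linear form on a subspace extends, the existence of
  a complex linear \<open>L\<close> is complex differentiability in the usual sense.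
\<close>

definition complex_differentiable_on ::
  "(complex \<Rightarrow> 'b \<Rightarrow> 'b) \<Rightarrow> ('b::real_normed_vector \<Rightarrow> complex) \<Rightarrow> 'b set \<Rightarrow> bool" where
  "complex_differentiable_on scl f D \<longleftrightarrow>
     (\<forall>a\<in>D. \<exists>L. (f has_derivative L) (at a within D) \<and> (\<forall>k u. L (scl k u) = k * L u))"

definition complex_manifold :: "('a, 'n::finite) lie_group \<Rightarrow> bool" where
  "complex_manifold V \<longleftrightarrow>
     topspace (topo V) = carrier V \<and> Hausdorff_space (topo V) \<and> vec.subspace (model V) \<and>
     (\<Union>(U, c)\<in>atlas V. U) = carrier V \<and>
     (\<forall>(U, c)\<in>atlas V.
        openin (topo V) U \<and> openin (top_of_set (model V)) (c ` U) \<and>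
        homeomorphic_map (subtopology (topo V) U) (top_of_set (c ` U)) c) \<and>
     (\<forall>(U, c)\<in>atlas V. \<forall>(U', c')\<in>atlas V. \<forall>i.
        complex_differentiable_on (*s) (\<lambda>z. c' (the_inv_into U c z) $ i) (c ` (U \<inter> U')))"

definition holo_on :: "('a, 'n::finite) lie_group \<Rightarrow> ('a \<Rightarrow> complex) \<Rightarrow> 'a set \<Rightarrow> bool" where
  "holo_on V f D \<longleftrightarrow> openin (topo V) D \<and>
     (\<forall>(U, c)\<in>atlas V.
        complex_differentiable_on (*s) (\<lambda>z. f (the_inv_into U c z)) (c ` (U \<inter> D)))"

definition holo2_on ::
  "('a, 'n::finite) lie_group \<Rightarrow> ('a \<times> 'a \<Rightarrow> complex) \<Rightarrow> ('a \<times> 'a) set \<Rightarrow> bool" where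
  "holo2_on V f D \<longleftrightarrow> openin (prod_topology (topo V) (topo V)) D \<and>
     (\<forall>(U, c)\<in>atlas V. \<forall>(U', c')\<in>atlas V.
        complex_differentiable_on (\<lambda>k (u, u'). (k *s u, k *s u'))
          (\<lambda>(z, z'). f (the_inv_into U c z, the_inv_into U' c' z'))
          (map_prod c c' ` (U \<times> U' \<inter> D)))"

text \<open>Holomorphic maps are the continuous maps that pull back holomorphic functions to
  holomorphic functions.\<close>

definition holo_map :: "('a, 'n::finite) lie_group \<Rightarrow> ('a \<Rightarrow> 'a) \<Rightarrow> bool" where
  "holo_map V \<psi> \<longleftrightarrow> continuous_map (topo V) (topo V) \<psi> \<and>
     (\<forall>f D. holo_on V f D \<longrightarrow> holo_on V (\<lambda>x. f (\<psi> x)) {x\<in>carrier V. \<psi> x \<in> D})"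

definition complex_Lie_group :: "('a, 'n::finite) lie_group \<Rightarrow> bool" where
  "complex_Lie_group V \<longleftrightarrow>
     group V \<and> complex_manifold V \<and>
     continuous_map (prod_topology (topo V) (topo V)) (topo V) (\<lambda>(x, y). x \<otimes>\<^bsub>V\<^esub> y) \<and>
     (\<forall>f D. holo_on V f D \<longrightarrow>
        holo2_on V (\<lambda>(x, y). f (x \<otimes>\<^bsub>V\<^esub> y))
          {(x, y). x \<in> carrier V \<and> y \<in> carrier V \<and> x \<otimes>\<^bsub>V\<^esub> y \<in> D}) \<and>
     holo_map V (\<lambda>x. inv\<^bsub>V\<^esub> x)"

definition holomorphic_group_action ::
  "('g, 'h) monoid_scheme \<Rightarrow> ('a, 'n::finite) lie_group \<Rightarrow> ('g \<Rightarrow> 'a \<Rightarrow> 'a) \<Rightarrow> bool" where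
  "holomorphic_group_action G V \<alpha> \<longleftrightarrow>
     group_action G (carrier V) \<alpha> \<and>
     (\<forall>g\<in>carrier G. \<alpha> g \<in> hom V V \<and> holo_map V (\<alpha> g))"


section \<open>Germs of meromorphic and holomorphic functions\<close>

text \<open>
  \<open>\<M>\<^sub>x\<close> is the total ring of fractions of \<open>\<O>\<^sub>x\<close>: a germ at \<open>x\<close> is a class of pairs (numerator,
  denominator) of functions holomorphic near \<open>x\<close>, the germ of the denominator not being a zero
  divisor. As \<open>\<O>\<^sub>x\<close> is an integral domain, that means that the denominator is not the zero germ.
\<close>

type_synonym 'a mgerm = "(('a \<Rightarrow> complex) \<times> ('a \<Rightarrow> complex)) set"

definition holo_at :: "('a, 'n::finite) lie_group \<Rightarrow> 'a \<Rightarrow> ('a \<Rightarrow> complex) \<Rightarrow> bool" where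
  "holo_at V x f \<longleftrightarrow> (\<exists>D. x \<in> D \<and> holo_on V f D)"

definition nonzerodivisor_at :: "('a, 'n::finite) lie_group \<Rightarrow> 'a \<Rightarrow> ('a \<Rightarrow> complex) \<Rightarrow> bool" where
  "nonzerodivisor_at V x q \<longleftrightarrow> (\<forall>h. holo_at V x h \<longrightarrow>
     (\<forall>\<^sub>F y in nhdsin (topo V) x. q y * h y = 0) \<longrightarrow> (\<forall>\<^sub>F y in nhdsin (topo V) x. h y = 0))"

definition fractions :: "('a, 'n::finite) lie_group \<Rightarrow> 'a \<Rightarrow> (('a \<Rightarrow> complex) \<times> ('a \<Rightarrow> complex)) set" where
  "fractions V x = {(p, q). holo_at V x p \<and> holo_at V x q \<and> nonzerodivisor_at V x q}"

definition frac_rel :: "('a, 'n::finite) lie_group \<Rightarrow> 'a \<Rightarrow>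
    ((('a \<Rightarrow> complex) \<times> ('a \<Rightarrow> complex)) \<times> (('a \<Rightarrow> complex) \<times> ('a \<Rightarrow> complex))) set" where
  "frac_rel V x = {((p, q), (p', q')). (p, q) \<in> fractions V x \<and> (p', q') \<in> fractions V x \<and>
     (\<forall>\<^sub>F y in nhdsin (topo V) x. p y * q' y = p' y * q y)}"

definition germ ::
  "('a, 'n::finite) lie_group \<Rightarrow> 'a \<Rightarrow> ('a \<Rightarrow> complex) \<Rightarrow> ('a \<Rightarrow> complex) \<Rightarrow> 'a mgerm" where
  "germ V x p q = frac_rel V x `` {(p, q)}"

definition mero_stalk :: "('a, 'n::finite) lie_group \<Rightarrow> 'a \<Rightarrow> 'a mgerm ring" where
  "mero_stalk V x =
     \<lparr>carrier = fractions V x // frac_rel V x,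
      mult = \<lambda>a b. \<Union>(p, q)\<in>a. \<Union>(p', q')\<in>b. germ V x (\<lambda>y. p y * p' y) (\<lambda>y. q y * q' y),
      one = germ V x (\<lambda>_. 1) (\<lambda>_. 1),
      zero = germ V x (\<lambda>_. 0) (\<lambda>_. 1),
      add = \<lambda>a b. \<Union>(p, q)\<in>a. \<Union>(p', q')\<in>b.
              germ V x (\<lambda>y. p y * q' y + p' y * q y) (\<lambda>y. q y * q' y)\<rparr>"

abbreviation holo_germ :: "('a, 'n::finite) lie_group \<Rightarrow> 'a \<Rightarrow> ('a \<Rightarrow> complex) \<Rightarrow> 'a mgerm" where
  "holo_germ V x f \<equiv> germ V x f (\<lambda>_. 1)"

definition holo_stalk :: "('a, 'n::finite) lie_group \<Rightarrow> 'a \<Rightarrow> 'a mgerm ring" where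
  "holo_stalk V x = (mero_stalk V x)\<lparr>carrier := {holo_germ V x f | f. holo_at V x f}\<rparr>"

text \<open>In \<open>pull V \<psi> y a\<close>, the germ \<open>a\<close> lives at \<open>\<psi> y\<close> and the result at \<open>y\<close>.\<close>

definition pull :: "('a, 'n::finite) lie_group \<Rightarrow> ('a \<Rightarrow> 'a) \<Rightarrow> 'a \<Rightarrow> 'a mgerm \<Rightarrow> 'a mgerm" where
  "pull V \<psi> y a = (\<Union>(p, q)\<in>a. germ V y (\<lambda>z. p (\<psi> z)) (\<lambda>z. q (\<psi> z)))"

text \<open>\<open>transl V \<xi> x : \<M>\<^sub>x \<rightarrow> \<M>\<^sub>\<xi>\<^sub>x\<close> is \<open>\<phi>\<^sub>\<xi>\<close>, and \<open>gact G V \<alpha> g x : \<M>\<^sub>x \<rightarrow> \<M>\<^sub>g\<^sub>x\<close> is the action of \<open>g\<close>.\<close>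

definition transl :: "('a, 'n::finite) lie_group \<Rightarrow> 'a \<Rightarrow> 'a \<Rightarrow> 'a mgerm \<Rightarrow> 'a mgerm" where
  "transl V \<xi> x a = pull V (\<lambda>z. inv\<^bsub>V\<^esub> \<xi> \<otimes>\<^bsub>V\<^esub> z) (\<xi> \<otimes>\<^bsub>V\<^esub> x) a"

definition gact :: "('g, 'h) monoid_scheme \<Rightarrow> ('a, 'n::finite) lie_group \<Rightarrow> ('g \<Rightarrow> 'a \<Rightarrow> 'a) \<Rightarrow>
    'g \<Rightarrow> 'a \<Rightarrow> 'a mgerm \<Rightarrow> 'a mgerm" where
  "gact G V \<alpha> g x a = pull V (\<alpha> (inv\<^bsub>G\<^esub> g)) (\<alpha> g x) a"


section \<open>Meromorphic functions and the skew-group ring\<close>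

text \<open>The product ring of all \<open>\<M>\<^sub>x\<close> contains both the meromorphic functions (as families of germs)
  and the direct sum of the \<open>\<M>\<^sub>x\<close>; translations and \<open>G\<close> act on it.\<close>

type_synonym 'a germ_family = "'a \<Rightarrow> 'a mgerm"

definition family_ring :: "('a, 'n::finite) lie_group \<Rightarrow> 'a germ_family ring" where
  "family_ring V =
     \<lparr>carrier = (\<Pi>\<^sub>E x\<in>carrier V. carrier (mero_stalk V x)),
      mult = \<lambda>f g. \<lambda>x\<in>carrier V. f x \<otimes>\<^bsub>mero_stalk V x\<^esub> g x,
      one = \<lambda>x\<in>carrier V. \<one>\<^bsub>mero_stalk V x\<^esub>,
      zero = \<lambda>x\<in>carrier V. \<zero>\<^bsub>mero_stalk V x\<^esub>,
      add = \<lambda>f g. \<lambda>x\<in>carrier V. f x \<oplus>\<^bsub>mero_stalk V x\<^esub> g x\<rparr>"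

definition transl_family ::
  "('a, 'n::finite) lie_group \<Rightarrow> 'a \<Rightarrow> 'a germ_family \<Rightarrow> 'a germ_family" where
  "transl_family V \<xi> f =
     (\<lambda>x\<in>carrier V. transl V \<xi> (inv\<^bsub>V\<^esub> \<xi> \<otimes>\<^bsub>V\<^esub> x) (f (inv\<^bsub>V\<^esub> \<xi> \<otimes>\<^bsub>V\<^esub> x)))"

definition gact_family :: "('g, 'h) monoid_scheme \<Rightarrow> ('a, 'n::finite) lie_group \<Rightarrow>
    ('g \<Rightarrow> 'a \<Rightarrow> 'a) \<Rightarrow> 'g \<Rightarrow> 'a germ_family \<Rightarrow> 'a germ_family" where
  "gact_family G V \<alpha> g f =
     (\<lambda>x\<in>carrier V. gact G V \<alpha> g (\<alpha> (inv\<^bsub>G\<^esub> g) x) (f (\<alpha> (inv\<^bsub>G\<^esub> g) x)))"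

definition mero_ring :: "('a, 'n::finite) lie_group \<Rightarrow> 'a germ_family ring" where
  "mero_ring V = (family_ring V)\<lparr>carrier :=
     {f \<in> carrier (family_ring V). \<forall>x\<in>carrier V. \<exists>D p q.
        x \<in> D \<and> holo_on V p D \<and> holo_on V q D \<and>
        (\<forall>y\<in>D. nonzerodivisor_at V y q \<and> f y = germ V y p q)}\<rparr>"

definition holo_function :: "('a, 'n::finite) lie_group \<Rightarrow> ('a \<Rightarrow> complex) \<Rightarrow> 'a germ_family" where
  "holo_function V f = (\<lambda>x\<in>carrier V. holo_germ V x f)"

text \<open>\<open>a :: 'a skew\<close> stands for the sum of the \<open>a \<xi> \<phi>\<^sub>\<xi>\<close>.\<close>

type_synonym 'a skew = "'a \<Rightarrow> 'a germ_family"

definition skew_support :: "('a, 'n::finite) lie_group \<Rightarrow> 'a skew \<Rightarrow> 'a set" where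
  "skew_support V a = {\<xi>\<in>carrier V. a \<xi> \<noteq> \<zero>\<^bsub>mero_ring V\<^esub>}"

text \<open>The product collects the terms of \<open>f \<phi>\<^sub>\<xi> \<circ> f' \<phi>\<^sub>\<xi>\<^sub>' = f \<phi>\<^sub>\<xi>(f') \<phi>\<^sub>\<xi>\<^sub>\<xi>\<^sub>'\<close> with \<open>\<xi> \<xi>' = \<zeta>\<close>.\<close>

definition skew_ring :: "('a, 'n::finite) lie_group \<Rightarrow> 'a skew ring" where
  "skew_ring V =
     \<lparr>carrier = {a \<in> carrier V \<rightarrow>\<^sub>E carrier (mero_ring V). finite (skew_support V a)},
      mult = \<lambda>a b. \<lambda>\<zeta>\<in>carrier V. \<Oplus>\<^bsub>mero_ring V\<^esub>\<xi>\<in>skew_support V a.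
               a \<xi> \<otimes>\<^bsub>mero_ring V\<^esub> transl_family V \<xi> (b (inv\<^bsub>V\<^esub> \<xi> \<otimes>\<^bsub>V\<^esub> \<zeta>)),
      one = \<lambda>\<xi>\<in>carrier V. if \<xi> = \<one>\<^bsub>V\<^esub> then \<one>\<^bsub>mero_ring V\<^esub> else \<zero>\<^bsub>mero_ring V\<^esub>,
      zero = \<lambda>\<xi>\<in>carrier V. \<zero>\<^bsub>mero_ring V\<^esub>,
      add = \<lambda>a b. \<lambda>\<xi>\<in>carrier V. a \<xi> \<oplus>\<^bsub>mero_ring V\<^esub> b \<xi>\<rparr>"

definition skew_act ::
  "('a, 'n::finite) lie_group \<Rightarrow> 'a skew \<Rightarrow> 'a germ_family \<Rightarrow> 'a germ_family" where
  "skew_act V a F =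
     (\<Oplus>\<^bsub>family_ring V\<^esub>\<xi>\<in>skew_support V a. a \<xi> \<otimes>\<^bsub>family_ring V\<^esub> transl_family V \<xi> F)"

definition skew_gact :: "('g, 'h) monoid_scheme \<Rightarrow> ('a, 'n::finite) lie_group \<Rightarrow>
    ('g \<Rightarrow> 'a \<Rightarrow> 'a) \<Rightarrow> 'g \<Rightarrow> 'a skew \<Rightarrow> 'a skew" where
  "skew_gact G V \<alpha> g a = (\<lambda>\<xi>\<in>carrier V. gact_family G V \<alpha> g (a (\<alpha> (inv\<^bsub>G\<^esub> g) \<xi>)))"

definition skew_invariants :: "('g, 'h) monoid_scheme \<Rightarrow> ('a, 'n::finite) lie_group \<Rightarrow>
    ('g \<Rightarrow> 'a \<Rightarrow> 'a) \<Rightarrow> 'a skew set" where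
  "skew_invariants G V \<alpha> =
     {a \<in> carrier (skew_ring V). \<forall>g\<in>carrier G. skew_gact G V \<alpha> g a = a}"

definition function_skew :: "('a, 'n::finite) lie_group \<Rightarrow> ('a \<Rightarrow> complex) \<Rightarrow> 'a skew" where
  "function_skew V f =
     (\<lambda>\<xi>\<in>carrier V. if \<xi> = \<one>\<^bsub>V\<^esub> then holo_function V f else \<zero>\<^bsub>mero_ring V\<^esub>)"

definition skew_subalgebra :: "('a, 'n::finite) lie_group \<Rightarrow> 'a skew set \<Rightarrow> bool" where
  "skew_subalgebra V A \<longleftrightarrow>
     subgroup A (add_monoid (skew_ring V)) \<and> submonoid A (skew_ring V) \<and>
     (\<forall>k. \<forall>a\<in>A. function_skew V (\<lambda>_. k) \<otimes>\<^bsub>skew_ring V\<^esub> a \<in> A)"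

text \<open>These are the sections in \<open>H\<^sup>0(V, \<O>\<^sup>G)\<close>; the values of \<open>f\<close> off \<open>carrier V\<close> are irrelevant.\<close>

definition invariant_functions :: "('g, 'h) monoid_scheme \<Rightarrow> ('a, 'n::finite) lie_group \<Rightarrow>
    ('g \<Rightarrow> 'a \<Rightarrow> 'a) \<Rightarrow> ('a \<Rightarrow> complex) set" where
  "invariant_functions G V \<alpha> =
     {f. holo_on V f (carrier V) \<and> (\<forall>g\<in>carrier G. \<forall>x\<in>carrier V. f (\<alpha> (inv\<^bsub>G\<^esub> g) x) = f x)}"


section \<open>The spaces of invariant germs and their quotients\<close>

text \<open>The invariants of the direct sum of the \<open>\<O>\<^sub>x\<close>, \<open>x \<in> W\<close>, for \<open>G\<close>-invariant \<open>W\<close>. This is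
  \<open>\<O>\<^sup>G\<close> at the orbit if \<open>W\<close> is an orbit, and in general the direct sum of these over the orbits
  contained in \<open>W\<close>.\<close>

definition invariant_germs :: "('g, 'h) monoid_scheme \<Rightarrow> ('a, 'n::finite) lie_group \<Rightarrow>
    ('g \<Rightarrow> 'a \<Rightarrow> 'a) \<Rightarrow> 'a set \<Rightarrow> 'a germ_family set" where
  "invariant_germs G V \<alpha> W =
     {F \<in> carrier (family_ring V).
        (\<forall>x\<in>carrier V. F x \<in> carrier (holo_stalk V x)) \<and>
        finite {x\<in>carrier V. F x \<noteq> \<zero>\<^bsub>mero_stalk V x\<^esub>} \<and>
        (\<forall>x\<in>carrier V - W. F x = \<zero>\<^bsub>mero_stalk V x\<^esub>) \<and>
        (\<forall>g\<in>carrier G. gact_family G V \<alpha> g F = F)}"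

text \<open>Only meaningful if all elements of \<open>H\<close> fix \<open>x\<close>.\<close>

definition fixed_germs :: "('g, 'h) monoid_scheme \<Rightarrow> ('a, 'n::finite) lie_group \<Rightarrow>
    ('g \<Rightarrow> 'a \<Rightarrow> 'a) \<Rightarrow> 'g set \<Rightarrow> 'a \<Rightarrow> 'a mgerm set" where
  "fixed_germs G V \<alpha> H x =
     {a \<in> carrier (holo_stalk V x). \<forall>g\<in>H. gact G V \<alpha> g x a = a}"

definition J_e :: "('g, 'h) monoid_scheme \<Rightarrow> ('a, 'n::finite) lie_group \<Rightarrow>
    ('g \<Rightarrow> 'a \<Rightarrow> 'a) \<Rightarrow> 'a mgerm set" where
  "J_e G V \<alpha> = Idl\<^bsub>holo_stalk V \<one>\<^bsub>V\<^esub>\<^esub>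
     {a \<in> fixed_germs G V \<alpha> (carrier G) \<one>\<^bsub>V\<^esub>.
        \<exists>f. holo_at V \<one>\<^bsub>V\<^esub> f \<and> f \<one>\<^bsub>V\<^esub> = 0 \<and> a = holo_germ V \<one>\<^bsub>V\<^esub> f}"

definition invariant_stalk :: "('g, 'h) monoid_scheme \<Rightarrow> ('a, 'n::finite) lie_group \<Rightarrow>
    ('g \<Rightarrow> 'a \<Rightarrow> 'a) \<Rightarrow> 'a \<Rightarrow> 'a mgerm ring" where
  "invariant_stalk G V \<alpha> \<xi> =
     (holo_stalk V \<xi>)\<lparr>carrier := fixed_germs G V \<alpha> (stabilizer G \<alpha> \<xi>) \<xi>\<rparr>"

definition kernel_ideal :: "('g, 'h) monoid_scheme \<Rightarrow> ('a, 'n::finite) lie_group \<Rightarrow>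
    ('g \<Rightarrow> 'a \<Rightarrow> 'a) \<Rightarrow> 'a \<Rightarrow> 'a mgerm set" where
  "kernel_ideal G V \<alpha> \<xi> =
     transl V \<xi> \<one>\<^bsub>V\<^esub> ` (fixed_germs G V \<alpha> (stabilizer G \<alpha> \<xi>) \<one>\<^bsub>V\<^esub> \<inter> J_e G V \<alpha>)"

definition E_stalk :: "('g, 'h) monoid_scheme \<Rightarrow> ('a, 'n::finite) lie_group \<Rightarrow>
    ('g \<Rightarrow> 'a \<Rightarrow> 'a) \<Rightarrow> 'a \<Rightarrow> 'a mgerm set ring" where
  "E_stalk G V \<alpha> \<xi> = invariant_stalk G V \<alpha> \<xi> Quot kernel_ideal G V \<alpha> \<xi>"

type_synonym 'a coset_family = "'a \<Rightarrow> 'a mgerm set"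

definition E_class :: "('g, 'h) monoid_scheme \<Rightarrow> ('a, 'n::finite) lie_group \<Rightarrow>
    ('g \<Rightarrow> 'a \<Rightarrow> 'a) \<Rightarrow> 'a germ_family \<Rightarrow> 'a coset_family" where
  "E_class G V \<alpha> F =
     (\<lambda>x\<in>carrier V. kernel_ideal G V \<alpha> x +>\<^bsub>invariant_stalk G V \<alpha> x\<^esub> F x)"

text \<open>\<open>M(G, W)\<close>, for \<open>G\<close>-invariant \<open>W\<close>; it is \<open>\<bbbE>\<^sup>G\<close> at the orbit if \<open>W\<close> is an orbit. \<open>a\<close> acts on
  a class by acting on a representative in \<open>invariant_germs G V \<alpha> W\<close>; this is meaningful (and
  independent of the choice) if \<open>a\<close> preserves that space. The fields \<open>mult\<close> and \<open>one\<close>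
  of the record are not used.\<close>

definition M_module :: "('g, 'h) monoid_scheme \<Rightarrow> ('a, 'n::finite) lie_group \<Rightarrow>
    ('g \<Rightarrow> 'a \<Rightarrow> 'a) \<Rightarrow> 'a set \<Rightarrow> ('a skew, 'a coset_family) module" where
  "M_module G V \<alpha> W =
     \<lparr>carrier = {m \<in> \<Pi>\<^sub>E x\<in>carrier V. carrier (E_stalk G V \<alpha> x).
        finite {x\<in>carrier V. m x \<noteq> \<zero>\<^bsub>E_stalk G V \<alpha> x\<^esub>} \<and>
        (\<forall>x\<in>carrier V - W. m x = \<zero>\<^bsub>E_stalk G V \<alpha> x\<^esub>) \<and>
        (\<forall>g\<in>carrier G. \<forall>x\<in>carrier V. m (\<alpha> g x) = gact G V \<alpha> g x ` m x)},
      mult = undefined,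
      one = undefined,
      zero = \<lambda>x\<in>carrier V. \<zero>\<^bsub>E_stalk G V \<alpha> x\<^esub>,
      add = \<lambda>m m'. \<lambda>x\<in>carrier V. m x \<oplus>\<^bsub>E_stalk G V \<alpha> x\<^esub> m' x,
      smult = \<lambda>a m. E_class G V \<alpha>
        (skew_act V a (SOME F. F \<in> invariant_germs G V \<alpha> W \<and> E_class G V \<alpha> F = m))\<rparr>"

definition unit_class :: "('g, 'h) monoid_scheme \<Rightarrow> ('a, 'n::finite) lie_group \<Rightarrow>
    ('g \<Rightarrow> 'a \<Rightarrow> 'a) \<Rightarrow> 'a \<Rightarrow> 'a coset_family" where
  "unit_class G V \<alpha> w = (\<lambda>x\<in>carrier V.
     if x \<in> orbit G \<alpha> w then \<one>\<^bsub>E_stalk G V \<alpha> x\<^esub> else \<zero>\<^bsub>E_stalk G V \<alpha> x\<^esub>)"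

text \<open>\<open>B\<close> is a subring of the skew-group ring; the notion of submodule does not need it to be
  commutative.\<close>

abbreviation M_submodule :: "('g, 'h) monoid_scheme \<Rightarrow> ('a, 'n::finite) lie_group \<Rightarrow>
    ('g \<Rightarrow> 'a \<Rightarrow> 'a) \<Rightarrow> 'a skew set \<Rightarrow> 'a set \<Rightarrow> 'a coset_family set \<Rightarrow> bool" where
  "M_submodule G V \<alpha> B W N \<equiv>
     submodule N ((skew_ring V)\<lparr>carrier := B\<rparr>) (M_module G V \<alpha> W)"

definition M_span :: "('g, 'h) monoid_scheme \<Rightarrow> ('a, 'n::finite) lie_group \<Rightarrow>
    ('g \<Rightarrow> 'a \<Rightarrow> 'a) \<Rightarrow> 'a skew set \<Rightarrow> 'a set \<Rightarrow> 'a coset_family set \<Rightarrow> 'a coset_family set" where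
  "M_span G V \<alpha> B W S = M_submodule G V \<alpha> B W hull S"

definition is_maximal_submodule :: "('g, 'h) monoid_scheme \<Rightarrow> ('a, 'n::finite) lie_group \<Rightarrow>
    ('g \<Rightarrow> 'a \<Rightarrow> 'a) \<Rightarrow> 'a skew set \<Rightarrow> 'a set \<Rightarrow> 'a coset_family set \<Rightarrow> 'a coset_family set \<Rightarrow> bool" where
  "is_maximal_submodule G V \<alpha> B W N P \<longleftrightarrow>
     M_submodule G V \<alpha> B W P \<and> P \<subset> N \<and>
     (\<forall>Q. M_submodule G V \<alpha> B W Q \<longrightarrow> P \<subseteq> Q \<longrightarrow> Q \<subset> N \<longrightarrow> Q = P)"

definition semidirect_orbit :: "('g, 'h) monoid_scheme \<Rightarrow> ('a, 'n::finite) lie_group \<Rightarrow>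
    ('g \<Rightarrow> 'a \<Rightarrow> 'a) \<Rightarrow> 'a set \<Rightarrow> 'a \<Rightarrow> 'a set" where
  "semidirect_orbit G V \<alpha> \<Gamma> v = {\<alpha> g (\<xi> \<otimes>\<^bsub>V\<^esub> v) | g \<xi>. g \<in> carrier G \<and> \<xi> \<in> \<Gamma>}"

end

theory Submission
  imports Defs "HOL-Algebra.Subrings" "HOL-Computational_Algebra.Polynomial"
begin

text \<open>
  Invariant functions act on \<open>\<bbbE>\<^sub>x\<close> by multiplication, and a function \<open>f\<close> vanishing at \<open>x\<close> acts
  nilpotently: translated to \<open>e\<close> it becomes a function \<open>u\<close> vanishing at \<open>e\<close>, which is a root of the
  polynomial \<open>\<Prod>\<^sub>g (X - u \<circ> g)\<close>, and the lower coefficients of this polynomial are invariant and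
  vanish at \<open>e\<close>. So \<open>f\<^bsup>|G|\<^esup>\<close> lies in the ideal that is divided out in \<open>\<bbbE>\<^sub>x\<close> (\<open>power_in_J_at\<close>).

  Let \<open>m \<in> M(G, W)\<close>. As \<open>\<bbbE>\<^sup>G\<close> at the orbit of \<open>w\<close> is generated by the unit class, the component of \<open>m\<close>
  there is \<open>h \<cdot> 1\<close> for an invariant function \<open>h\<close>. Suppose that \<open>h w \<noteq> 0\<close>. By nilpotency, \<open>h\<close> is
  invertible on this component, with a polynomial in \<open>h\<close> as inverse. Since invariant functions
  separate the orbits in the finite support of \<open>m\<close>, a polynomial in an invariant function also acts as
  the projection to the component at \<open>w\<close>. Multiplying both gives one invariant function that maps
  \<open>m\<close> to the unit class (\<open>unit_class_multiple\<close>). Hence all elements of a submodule that does not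
  contain the unit class, that is, of a proper submodule of the one generated by the unit class, vanish at \<open>w\<close>.
  Vanishing at \<open>w\<close> is preserved by sums, and the unit class does not vanish, so the sum of two proper
  submodules is proper. The union of all proper submodules is therefore the largest proper submodule
  (\<open>unique_maximal_submodule\<close>).

  The sum of two submodules is a submodule because \<open>A\<close> acts additively on \<open>M(G, W)\<close>, and for this the
  action has to be independent of the choice of representatives. In \<open>skew_act_J_at\<close> this is reduced to the fact that a \<open>G\<close>-invariant germ at \<open>e\<close>,
  translated to all points of \<open>V\<close>, gives a family of germs that is invariant under \<open>G\<close> and under all
  translations; multiplication by this family commutes with the action of the skew-group ring.
\<close>

section \<open>Holomorphic functions and translations\<close>

lemma complex_differentiable_on_const: "complex_differentiable_on scl (\<lambda>_. k) D"
  unfolding complex_differentiable_on_def by (auto intro!: exI[of _ "\<lambda>_. 0"])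

lemma complex_differentiable_on_add:
  "complex_differentiable_on scl f D \<Longrightarrow> complex_differentiable_on scl g D \<Longrightarrow>
    complex_differentiable_on scl (\<lambda>z. f z + g z) D"
  unfolding complex_differentiable_on_def
proof
  fix a assume "\<forall>a\<in>D. \<exists>L. (f has_derivative L) (at a within D) \<and> (\<forall>k u. L (scl k u) = k * L u)"
    "\<forall>a\<in>D. \<exists>L. (g has_derivative L) (at a within D) \<and> (\<forall>k u. L (scl k u) = k * L u)" "a \<in> D"
  then obtain L L' where "(f has_derivative L) (at a within D)" "\<forall>k u. L (scl k u) = k * L u"
    "(g has_derivative L') (at a within D)" "\<forall>k u. L' (scl k u) = k * L' u" by meson
  then show "\<exists>L. ((\<lambda>z. f z + g z) has_derivative L) (at a within D) \<and> (\<forall>k u. L (scl k u) = k * L u)"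
    by (intro exI[of _ "\<lambda>h. L h + L' h"]) (auto simp: algebra_simps intro!: derivative_eq_intros)
qed

lemma complex_differentiable_on_mult:
  "complex_differentiable_on scl f D \<Longrightarrow> complex_differentiable_on scl g D \<Longrightarrow>
    complex_differentiable_on scl (\<lambda>z. f z * g z) D"
  unfolding complex_differentiable_on_def
proof
  fix a assume "\<forall>a\<in>D. \<exists>L. (f has_derivative L) (at a within D) \<and> (\<forall>k u. L (scl k u) = k * L u)"
    "\<forall>a\<in>D. \<exists>L. (g has_derivative L) (at a within D) \<and> (\<forall>k u. L (scl k u) = k * L u)" "a \<in> D"
  then obtain L L' where "(f has_derivative L) (at a within D)" "\<forall>k u. L (scl k u) = k * L u"
    "(g has_derivative L') (at a within D)" "\<forall>k u. L' (scl k u) = k * L' u" by meson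
  then show "\<exists>L. ((\<lambda>z. f z * g z) has_derivative L) (at a within D) \<and> (\<forall>k u. L (scl k u) = k * L u)"
    by (intro exI[of _ "\<lambda>h. f a * L' h + L h * g a"] conjI has_derivative_mult)
      (auto simp: algebra_simps)
qed

lemma complex_differentiable_on_subset:
  "complex_differentiable_on scl f D \<Longrightarrow> D' \<subseteq> D \<Longrightarrow> complex_differentiable_on scl f D'"
  unfolding complex_differentiable_on_def by (meson has_derivative_subset subsetD)

lemma holo_on_open: "holo_on V f D \<Longrightarrow> openin (topo V) D"
  by (simp add: holo_on_def)

lemma holo_on_add: "holo_on V f D \<Longrightarrow> holo_on V g D \<Longrightarrow> holo_on V (\<lambda>x. f x + g x) D"
  unfolding holo_on_def by (fastforce intro: complex_differentiable_on_add)

lemma holo_on_mult: "holo_on V f D \<Longrightarrow> holo_on V g D \<Longrightarrow> holo_on V (\<lambda>x. f x * g x) D"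
  unfolding holo_on_def by (fastforce intro: complex_differentiable_on_mult)

lemma holo_on_const: "openin (topo V) D \<Longrightarrow> holo_on V (\<lambda>_. k) D"
  unfolding holo_on_def by (fastforce intro: complex_differentiable_on_const)

lemma holo_on_subset: "holo_on V f D \<Longrightarrow> D' \<subseteq> D \<Longrightarrow> openin (topo V) D' \<Longrightarrow> holo_on V f D'"
  unfolding holo_on_def by (fastforce intro: complex_differentiable_on_subset)

lemma holo_at_add:
  assumes "holo_at V x f" "holo_at V x g" shows "holo_at V x (\<lambda>y. f y + g y)"
proof -
  obtain D D' where D: "x \<in> D" "holo_on V f D" "x \<in> D'" "holo_on V g D'"
    using assms by (auto simp: holo_at_def)
  have "openin (topo V) (D \<inter> D')"
    by (intro openin_Int holo_on_open[OF D(2)] holo_on_open[OF D(4)])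
  with D have "holo_on V f (D \<inter> D')" "holo_on V g (D \<inter> D')"
    by (simp_all add: holo_on_subset[OF D(2)] holo_on_subset[OF D(4)])
  then show ?thesis unfolding holo_at_def using D by (intro exI[of _ "D \<inter> D'"]) (simp add: holo_on_add)
qed

lemma holo_at_mult:
  assumes "holo_at V x f" "holo_at V x g" shows "holo_at V x (\<lambda>y. f y * g y)"
proof -
  obtain D D' where D: "x \<in> D" "holo_on V f D" "x \<in> D'" "holo_on V g D'"
    using assms by (auto simp: holo_at_def)
  have "openin (topo V) (D \<inter> D')"
    by (intro openin_Int holo_on_open[OF D(2)] holo_on_open[OF D(4)])
  with D have "holo_on V f (D \<inter> D')" "holo_on V g (D \<inter> D')"
    by (simp_all add: holo_on_subset[OF D(2)] holo_on_subset[OF D(4)])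
  then show ?thesis unfolding holo_at_def using D by (intro exI[of _ "D \<inter> D'"]) (simp add: holo_on_mult)
qed

locale lie =
  fixes V :: "('a, 'n::finite) lie_group"
  assumes complex_Lie_group: "complex_Lie_group V"
begin

sublocale V: group V
  using complex_Lie_group by (simp add: complex_Lie_group_def)

lemma topspace_V: "topspace (topo V) = carrier V"
  using complex_Lie_group by (simp add: complex_Lie_group_def complex_manifold_def)

lemma eventually_nhds:
  "x \<in> carrier V \<Longrightarrow> eventually P (nhdsin (topo V) x) \<longleftrightarrow>
     (\<exists>S. openin (topo V) S \<and> x \<in> S \<and> (\<forall>y\<in>S. P y))"
  by (simp add: eventually_nhdsin topspace_V)

lemma eventually_nhds_at: "eventually P (nhdsin (topo V) x) \<Longrightarrow> x \<in> carrier V \<Longrightarrow> P x"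
  by (auto simp: eventually_nhds)

lemma open_carrier: "openin (topo V) (carrier V)"
  by (metis openin_topspace topspace_V)

lemma eventually_in_carrier: "eventually (\<lambda>y. y \<in> carrier V) (nhdsin (topo V) x)"
  by (cases "x \<in> carrier V") (auto simp: eventually_nhds topspace_V intro: open_carrier)

lemma holo_on_carrier_const: "holo_on V (\<lambda>_. k) (carrier V)"
  by (simp add: holo_on_const open_carrier)

lemma holo_at_const: "x \<in> carrier V \<Longrightarrow> holo_at V x (\<lambda>_. k)"
  unfolding holo_at_def using holo_on_carrier_const by blast

lemma holo_at_uminus: "holo_at V x f \<Longrightarrow> holo_at V x (\<lambda>y. - f y)"
proof -
  assume f: "holo_at V x f"
  then have "x \<in> carrier V"
    by (metis holo_at_def holo_on_open openin_subset subsetD topspace_V)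
  from holo_at_mult[OF holo_at_const[OF this, of "-1"] f] show ?thesis by simp
qed

lemma holo_at_diff: "holo_at V x f \<Longrightarrow> holo_at V x g \<Longrightarrow> holo_at V x (\<lambda>y. f y - g y)"
  using holo_at_add[OF _ holo_at_uminus, of x f g] by simp

lemma holo_at_global: "holo_on V f (carrier V) \<Longrightarrow> x \<in> carrier V \<Longrightarrow> holo_at V x f"
  by (auto simp: holo_at_def)

lemma holo_on_uminus: "holo_on V f (carrier V) \<Longrightarrow> holo_on V (\<lambda>y. - f y) (carrier V)"
  using holo_on_mult[OF holo_on_carrier_const[of "-1"]] by fastforce

lemma holo_on_diff: "holo_on V f (carrier V) \<Longrightarrow> holo_on V g (carrier V) \<Longrightarrow>
    holo_on V (\<lambda>y. f y - g y) (carrier V)"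
  using holo_on_add[OF _ holo_on_uminus, of f g] by simp

lemma holo_on_sum:
  "(\<And>i. i \<in> I \<Longrightarrow> holo_on V (f i) (carrier V)) \<Longrightarrow> holo_on V (\<lambda>y. \<Sum>i\<in>I. f i y) (carrier V)"
  by (induction I rule: infinite_finite_induct) (auto intro!: holo_on_add holo_on_carrier_const)

lemma holo_on_power: "holo_on V f (carrier V) \<Longrightarrow> holo_on V (\<lambda>y. f y ^ k) (carrier V)"
  by (induction k) (auto intro!: holo_on_mult holo_on_carrier_const)

lemma chart_inj:
  assumes "(U, c) \<in> atlas V" shows "inj_on c U"
proof -
  have "homeomorphic_map (subtopology (topo V) U) (top_of_set (c ` U)) c" "openin (topo V) U"
    using complex_Lie_group assms by (auto simp: complex_Lie_group_def complex_manifold_def)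
  then have "inj_on c (topspace (subtopology (topo V) U))" "U \<subseteq> topspace (topo V)"
    by (auto simp: homeomorphic_map_def openin_subset dest: homeomorphic_imp_injective_map)
  then show ?thesis by (simp add: topspace_subtopology inf_absorb2)
qed

text \<open>Left translation by \<open>\<xi>\<close> is the restriction of the multiplication to the slice \<open>{\<xi>} \<times> V\<close>; in
  charts, its derivative is the derivative of the multiplication along the second factor.\<close>

lemma holo_map_translation:
  assumes \<xi>: "\<xi> \<in> carrier V"
  shows "holo_map V (\<lambda>z. \<xi> \<otimes>\<^bsub>V\<^esub> z)"
  unfolding holo_map_def
proof (intro conjI allI impI)
  have mult: "continuous_map (prod_topology (topo V) (topo V)) (topo V) (\<lambda>(x, y). x \<otimes>\<^bsub>V\<^esub> y)"
    using complex_Lie_group by (simp add: complex_Lie_group_def)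
  have "continuous_map (topo V) (prod_topology (topo V) (topo V)) (\<lambda>z. (\<xi>, z))"
    using \<xi> by (intro continuous_map_pairedI) (auto simp: topspace_V)
  from continuous_map_compose[OF this mult]
  show cont: "continuous_map (topo V) (topo V) (\<lambda>z. \<xi> \<otimes>\<^bsub>V\<^esub> z)" by (simp add: o_def)
  fix f D assume f: "holo_on V f D"
  let ?E = "{x \<in> carrier V. \<xi> \<otimes>\<^bsub>V\<^esub> x \<in> D}"
  let ?D2 = "{(x, y). x \<in> carrier V \<and> y \<in> carrier V \<and> x \<otimes>\<^bsub>V\<^esub> y \<in> D}"
  have holo2: "holo2_on V (\<lambda>(x, y). f (x \<otimes>\<^bsub>V\<^esub> y)) ?D2"
    using complex_Lie_group f by (simp add: complex_Lie_group_def)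
  have "(\<Union>(U, c)\<in>atlas V. U) = carrier V"
    using complex_Lie_group by (simp add: complex_Lie_group_def complex_manifold_def)
  then have "\<xi> \<in> (\<Union>(U, c)\<in>atlas V. U)"
    using \<xi> by simp
  then obtain U c where U: "(U, c) \<in> atlas V" "\<xi> \<in> U"
    by auto
  have inv_c: "the_inv_into U c (c \<xi>) = \<xi>"
    using chart_inj[OF U(1)] U(2) by (rule the_inv_into_f_f)
  have "complex_differentiable_on (*s) (\<lambda>z. f (\<xi> \<otimes>\<^bsub>V\<^esub> the_inv_into U' c' z)) (c' ` (U' \<inter> ?E))"
    if U': "(U', c') \<in> atlas V" for U' c'
    unfolding complex_differentiable_on_def
  proof
    fix a assume a: "a \<in> c' ` (U' \<inter> ?E)"
    let ?S = "map_prod c c' ` (U \<times> U' \<inter> ?D2)"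
    let ?F = "\<lambda>(z, z'). f (the_inv_into U c z \<otimes>\<^bsub>V\<^esub> the_inv_into U' c' z')"
    have sub: "Pair (c \<xi>) ` (c' ` (U' \<inter> ?E)) \<subseteq> ?S"
      using \<xi> U(2) by (auto intro!: image_eqI[of _ "map_prod c c'"])
    have "complex_differentiable_on (\<lambda>k (u, u'). (k *s u, k *s u')) ?F ?S"
      using holo2 U U' by (auto simp: holo2_on_def)
    moreover have "(c \<xi>, a) \<in> ?S"
      using sub a by (rule subsetD[OF _ imageI])
    ultimately have "\<exists>L. (?F has_derivative L) (at (c \<xi>, a) within ?S) \<and>
        (\<forall>k u. L ((\<lambda>(u, u'). (k *s u, k *s u')) u) = k * L u)"
      unfolding complex_differentiable_on_def by (rule bspec)
    then obtain L where L: "(?F has_derivative L) (at (c \<xi>, a) within ?S)"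
      "\<forall>k u. L ((\<lambda>(u, u'). (k *s u, k *s u')) u) = k * L u"
      by (elim exE conjE)
    have "(Pair (c \<xi>) has_derivative (\<lambda>h. (0, h))) (at a within c' ` (U' \<inter> ?E))"
      by (auto intro!: derivative_eq_intros)
    from has_derivative_in_compose[OF this has_derivative_subset[OF L(1) sub]]
    have "((\<lambda>z. f (\<xi> \<otimes>\<^bsub>V\<^esub> the_inv_into U' c' z)) has_derivative (\<lambda>h. L (0, h)))
        (at a within c' ` (U' \<inter> ?E))"
      by (simp add: inv_c)
    moreover have "L (0, k *s u) = k * L (0, u)" for k u
      using L(2)[rule_format, of k "(0, u)"] by (simp add: vec_eq_iff)
    ultimately show "\<exists>L. ((\<lambda>z. f (\<xi> \<otimes>\<^bsub>V\<^esub> the_inv_into U' c' z)) has_derivative L)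
        (at a within c' ` (U' \<inter> ?E)) \<and> (\<forall>k u. L (k *s u) = k * L u)" by blast
  qed
  moreover have "openin (topo V) ?E"
    using openin_continuous_map_preimage[OF cont holo_on_open[OF f]] by (simp add: topspace_V)
  ultimately show "holo_on V (\<lambda>x. f (\<xi> \<otimes>\<^bsub>V\<^esub> x)) ?E" by (auto simp: holo_on_def)
qed

end

section \<open>The rings of germs\<close>

lemma UN_const_on: "A \<noteq> {} \<Longrightarrow> (\<And>z. z \<in> A \<Longrightarrow> f z = c) \<Longrightarrow> (\<Union>z\<in>A. f z) = c"
  by auto

text \<open>These identities give the transitivity of the equality of fractions, and the independence of
  their products and sums of the choice of representatives.\<close>

lemma fraction_identities:
  fixes p :: complex
  assumes "p * s = r * q"
  shows "r * u = t * s \<Longrightarrow> s * (p * u - t * q) = 0"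
    and "p' * s' = r' * q' \<Longrightarrow> r * r' * (q * q') = p * p' * (s * s')"
    and "p' * s' = r' * q' \<Longrightarrow> (r * s' + r' * s) * (q * q') = (p * q' + p' * q) * (s * s')"
proof -
  assume "r * u = t * s"
  have "s * (p * u - t * q) = (p * s) * u - (t * s) * q" by (simp add: algebra_simps)
  also have "\<dots> = 0" unfolding assms \<open>r * u = t * s\<close>[symmetric] by simp
  finally show "s * (p * u - t * q) = 0" .
next
  assume *: "p' * s' = r' * q'"
  have "r * r' * (q * q') = (r * q) * (r' * q')" by simp
  then show "r * r' * (q * q') = p * p' * (s * s')" unfolding assms[symmetric] *[symmetric] by simp
  have "(r * s' + r' * s) * (q * q') = (r * q) * (s' * q') + (r' * q') * (s * q)"
    by (simp add: algebra_simps)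
  then show "(r * s' + r' * s) * (q * q') = (p * q' + p' * q) * (s * s')"
    unfolding assms[symmetric] *[symmetric] by (simp add: algebra_simps)
qed

lemma nonzerodivisor_at_one: "nonzerodivisor_at V x (\<lambda>_. 1)"
  by (simp add: nonzerodivisor_at_def)

lemma nonzerodivisor_at_mult:
  assumes "nonzerodivisor_at V x q" "nonzerodivisor_at V x r" "holo_at V x r"
  shows "nonzerodivisor_at V x (\<lambda>y. q y * r y)"
  unfolding nonzerodivisor_at_def
proof (intro allI impI)
  fix h assume h: "holo_at V x h" "\<forall>\<^sub>F y in nhdsin (topo V) x. q y * r y * h y = 0"
  then have "\<forall>\<^sub>F y in nhdsin (topo V) x. r y * h y = 0"
    using assms(1)[unfolded nonzerodivisor_at_def, rule_format, OF holo_at_mult[OF assms(3) h(1)]]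
    by (simp only: mult.assoc)
  then show "\<forall>\<^sub>F y in nhdsin (topo V) x. h y = 0"
    using assms(2) h(1) by (simp add: nonzerodivisor_at_def)
qed

lemma mero_stalk_simps:
  "carrier (mero_stalk V x) = fractions V x // frac_rel V x"
  "\<one>\<^bsub>mero_stalk V x\<^esub> = holo_germ V x (\<lambda>_. 1)"
  "\<zero>\<^bsub>mero_stalk V x\<^esub> = holo_germ V x (\<lambda>_. 0)"
  by (simp_all add: mero_stalk_def)

lemma holo_stalk_simps [simp]:
  "carrier (holo_stalk V x) = {holo_germ V x f | f. holo_at V x f}"
  "\<one>\<^bsub>holo_stalk V x\<^esub> = \<one>\<^bsub>mero_stalk V x\<^esub>"
  "\<zero>\<^bsub>holo_stalk V x\<^esub> = \<zero>\<^bsub>mero_stalk V x\<^esub>"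
  "mult (holo_stalk V x) = mult (mero_stalk V x)"
  "add (holo_stalk V x) = add (mero_stalk V x)"
  by (simp_all add: holo_stalk_def)

context lie
begin

abbreviation "\<M> \<equiv> mero_stalk V"
abbreviation "\<O> \<equiv> holo_stalk V"
abbreviation "\<F> \<equiv> family_ring V"
abbreviation "\<e> \<equiv> \<one>\<^bsub>V\<^esub>"

lemma fractions_mult:
  "(p, q) \<in> fractions V x \<Longrightarrow> (r, s) \<in> fractions V x \<Longrightarrow> (\<lambda>y. p y * r y, \<lambda>y. q y * s y) \<in> fractions V x"
  by (simp add: fractions_def holo_at_mult nonzerodivisor_at_mult)

lemma fractions_add:
  "(p, q) \<in> fractions V x \<Longrightarrow> (r, s) \<in> fractions V x \<Longrightarrow>
    (\<lambda>y. p y * s y + r y * q y, \<lambda>y. q y * s y) \<in> fractions V x"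
  by (simp add: fractions_def holo_at_mult holo_at_add nonzerodivisor_at_mult)

lemma fractions_uminus: "(p, q) \<in> fractions V x \<Longrightarrow> (\<lambda>y. - p y, q) \<in> fractions V x"
  by (simp add: fractions_def holo_at_uminus)

lemma holo_at_carrier: "holo_at V x f \<Longrightarrow> x \<in> carrier V"
  by (metis holo_at_def holo_on_open openin_subset subsetD topspace_V)

lemma fractions_holo: "holo_at V x f \<Longrightarrow> (f, \<lambda>_. 1) \<in> fractions V x"
  by (simp add: fractions_def nonzerodivisor_at_one holo_at_const holo_at_carrier)

lemma equiv_frac_rel: "equiv (fractions V x) (frac_rel V x)"
proof (rule equivI)
  show "frac_rel V x \<subseteq> fractions V x \<times> fractions V x" by (auto simp: frac_rel_def)
  show "refl_on (fractions V x) (frac_rel V x)" by (auto simp: refl_on_def frac_rel_def)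
  show "sym (frac_rel V x)" by (auto simp: sym_def frac_rel_def elim!: eventually_mono)
  show "trans (frac_rel V x)"
  proof (rule transI)
    fix a b c assume ab: "(a, b) \<in> frac_rel V x" and bc: "(b, c) \<in> frac_rel V x"
    obtain p q r s t u where abc: "a = (p, q)" "b = (r, s)" "c = (t, u)" by (metis surj_pair)
    have fr: "(p, q) \<in> fractions V x" "(r, s) \<in> fractions V x" "(t, u) \<in> fractions V x"
      and eq: "\<forall>\<^sub>F y in nhdsin (topo V) x. p y * s y = r y * q y"
        "\<forall>\<^sub>F y in nhdsin (topo V) x. r y * u y = t y * s y"
      using ab bc by (auto simp: frac_rel_def abc)
    have "holo_at V x (\<lambda>y. p y * u y - t y * q y)"
      using fr by (auto simp: fractions_def intro!: holo_at_diff holo_at_mult)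
    moreover have "\<forall>\<^sub>F y in nhdsin (topo V) x. s y * (p y * u y - t y * q y) = 0"
      using eq by eventually_elim (rule fraction_identities)
    ultimately have "\<forall>\<^sub>F y in nhdsin (topo V) x. p y * u y - t y * q y = 0"
      using fr(2) by (auto simp: fractions_def nonzerodivisor_at_def)
    then show "(a, c) \<in> frac_rel V x"
      using fr by (simp add: frac_rel_def abc)
  qed
qed

lemma germ_eq_iff:
  assumes "(p, q) \<in> fractions V x" "(r, s) \<in> fractions V x"
  shows "germ V x p q = germ V x r s \<longleftrightarrow> (\<forall>\<^sub>F y in nhdsin (topo V) x. p y * s y = r y * q y)"
  unfolding germ_def eq_equiv_class_iff[OF equiv_frac_rel assms] using assms
  by (simp add: frac_rel_def)

lemma holo_germ_eq_iff:
  "holo_at V x f \<Longrightarrow> holo_at V x g \<Longrightarrow>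
    holo_germ V x f = holo_germ V x g \<longleftrightarrow> (\<forall>\<^sub>F y in nhdsin (topo V) x. f y = g y)"
  by (simp add: germ_eq_iff fractions_holo)

lemma mem_germ:
  "(p, q) \<in> fractions V x \<Longrightarrow> (r, s) \<in> germ V x p q \<longleftrightarrow>
     (r, s) \<in> fractions V x \<and> (\<forall>\<^sub>F y in nhdsin (topo V) x. p y * s y = r y * q y)"
  by (simp add: germ_def frac_rel_def)

text \<open>Operations on germs are unions over all representatives. Such a union collapses to the value at
  one representative if all representatives give the same value.\<close>

lemma UN_germ:
  assumes "(p, q) \<in> fractions V x"
    and "\<And>r s. (r, s) \<in> fractions V x \<Longrightarrow> \<forall>\<^sub>F y in nhdsin (topo V) x. p y * s y = r y * q y \<Longrightarrow> F r s = c"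
  shows "(\<Union>(r, s)\<in>germ V x p q. F r s) = c"
proof (rule UN_const_on)
  show "germ V x p q \<noteq> {}" using mem_germ[OF assms(1), of p q] assms(1) by auto
  fix z assume "z \<in> germ V x p q"
  moreover obtain r s where "z = (r, s)" by (rule prod.exhaust)
  ultimately show "(case z of (r, s) \<Rightarrow> F r s) = c"
    using assms(2)[of r s] by (simp add: mem_germ[OF assms(1)])
qed

lemma germ_mult:
  assumes "(p, q) \<in> fractions V x" "(p', q') \<in> fractions V x"
  shows "germ V x p q \<otimes>\<^bsub>\<M> x\<^esub> germ V x p' q' = germ V x (\<lambda>y. p y * p' y) (\<lambda>y. q y * q' y)"
  unfolding mero_stalk_def monoid.select_convs
proof (intro UN_germ assms)
  fix r s r' s'
  assume fr: "(r, s) \<in> fractions V x" "(r', s') \<in> fractions V x"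
    and eq: "\<forall>\<^sub>F y in nhdsin (topo V) x. p y * s y = r y * q y"
    "\<forall>\<^sub>F y in nhdsin (topo V) x. p' y * s' y = r' y * q' y"
  from eq have "\<forall>\<^sub>F y in nhdsin (topo V) x. r y * r' y * (q y * q' y) = p y * p' y * (s y * s' y)"
    by eventually_elim (rule fraction_identities)
  then show "germ V x (\<lambda>y. r y * r' y) (\<lambda>y. s y * s' y) = germ V x (\<lambda>y. p y * p' y) (\<lambda>y. q y * q' y)"
    by (simp add: germ_eq_iff fractions_mult fr assms)
qed

lemma germ_add:
  assumes "(p, q) \<in> fractions V x" "(p', q') \<in> fractions V x"
  shows "germ V x p q \<oplus>\<^bsub>\<M> x\<^esub> germ V x p' q' =
    germ V x (\<lambda>y. p y * q' y + p' y * q y) (\<lambda>y. q y * q' y)"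
  unfolding mero_stalk_def ring.select_convs
proof (intro UN_germ assms)
  fix r s r' s'
  assume fr: "(r, s) \<in> fractions V x" "(r', s') \<in> fractions V x"
    and eq: "\<forall>\<^sub>F y in nhdsin (topo V) x. p y * s y = r y * q y"
    "\<forall>\<^sub>F y in nhdsin (topo V) x. p' y * s' y = r' y * q' y"
  from eq have "\<forall>\<^sub>F y in nhdsin (topo V) x.
      (r y * s' y + r' y * s y) * (q y * q' y) = (p y * q' y + p' y * q y) * (s y * s' y)"
    by eventually_elim (rule fraction_identities)
  then show "germ V x (\<lambda>y. r y * s' y + r' y * s y) (\<lambda>y. s y * s' y) =
      germ V x (\<lambda>y. p y * q' y + p' y * q y) (\<lambda>y. q y * q' y)"
    by (simp add: germ_eq_iff fractions_mult fractions_add fr assms)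
qed

lemma germ_in_carrier: "(p, q) \<in> fractions V x \<Longrightarrow> germ V x p q \<in> carrier (\<M> x)"
  by (simp add: mero_stalk_simps germ_def quotientI)

lemma mero_stalk_cases:
  assumes "a \<in> carrier (\<M> x)"
  obtains p q where "(p, q) \<in> fractions V x" "a = germ V x p q"
  using assms by (auto simp: mero_stalk_simps germ_def elim!: quotientE)

lemma cring_mero_stalk:
  assumes x: "x \<in> carrier V" shows "cring (\<M> x)" (is "cring ?M")
proof -
  have frs: "(\<lambda>_. k, \<lambda>_. 1) \<in> fractions V x" for k
    using x by (simp add: fractions_holo holo_at_const)
  note closed = fractions_mult fractions_add fractions_uminus frs germ_in_carrier
  have minus: "\<exists>b\<in>carrier ?M. b \<oplus>\<^bsub>?M\<^esub> a = \<zero>\<^bsub>?M\<^esub>"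
    if a: "a \<in> carrier ?M" for a
  proof -
    obtain p q where pq: "(p, q) \<in> fractions V x" "a = germ V x p q" using mero_stalk_cases[OF a] .
    have "germ V x (\<lambda>y. - p y) q \<oplus>\<^bsub>?M\<^esub> a = \<zero>\<^bsub>?M\<^esub>"
      unfolding pq(2) germ_add[OF fractions_uminus[OF pq(1)] pq(1)] mero_stalk_simps(3)
      by (subst germ_eq_iff) (use fractions_add[OF fractions_uminus[OF pq(1)] pq(1)] frs[of 0] in auto)
    then show ?thesis by (rule bexI) (intro germ_in_carrier fractions_uminus pq)
  qed
  have add: "abelian_group ?M"
  proof (rule abelian_groupI)
    show "\<zero>\<^bsub>?M\<^esub> \<in> carrier ?M"
      by (subst mero_stalk_simps) (intro closed)
    fix a b c assume abc: "a \<in> carrier ?M" "b \<in> carrier ?M" "c \<in> carrier ?M"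
    obtain p q r s t u where reps: "(p, q) \<in> fractions V x" "a = germ V x p q"
      "(r, s) \<in> fractions V x" "b = germ V x r s" "(t, u) \<in> fractions V x" "c = germ V x t u"
      using mero_stalk_cases[OF abc(1)] mero_stalk_cases[OF abc(2)] mero_stalk_cases[OF abc(3)] by metis
    show "a \<oplus>\<^bsub>?M\<^esub> b \<in> carrier ?M" "a \<oplus>\<^bsub>?M\<^esub> b = b \<oplus>\<^bsub>?M\<^esub> a" "\<zero>\<^bsub>?M\<^esub> \<oplus>\<^bsub>?M\<^esub> a = a"
      "a \<oplus>\<^bsub>?M\<^esub> b \<oplus>\<^bsub>?M\<^esub> c = a \<oplus>\<^bsub>?M\<^esub> (b \<oplus>\<^bsub>?M\<^esub> c)"
      by (simp_all only: reps mero_stalk_simps(3) germ_add closed) (simp_all add: algebra_simps)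
    show "\<exists>b\<in>carrier ?M. b \<oplus>\<^bsub>?M\<^esub> a = \<zero>\<^bsub>?M\<^esub>" by (rule minus[OF abc(1)])
  qed
  have mult: "comm_monoid ?M"
  proof (rule comm_monoidI)
    show "\<one>\<^bsub>?M\<^esub> \<in> carrier ?M"
      by (subst mero_stalk_simps) (intro closed)
    fix a b c assume abc: "a \<in> carrier ?M" "b \<in> carrier ?M" "c \<in> carrier ?M"
    obtain p q r s t u where reps: "(p, q) \<in> fractions V x" "a = germ V x p q"
      "(r, s) \<in> fractions V x" "b = germ V x r s" "(t, u) \<in> fractions V x" "c = germ V x t u"
      using mero_stalk_cases[OF abc(1)] mero_stalk_cases[OF abc(2)] mero_stalk_cases[OF abc(3)] by metis
    show "a \<otimes>\<^bsub>?M\<^esub> b \<in> carrier ?M" "a \<otimes>\<^bsub>?M\<^esub> b = b \<otimes>\<^bsub>?M\<^esub> a" "\<one>\<^bsub>?M\<^esub> \<otimes>\<^bsub>?M\<^esub> a = a"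
      "a \<otimes>\<^bsub>?M\<^esub> b \<otimes>\<^bsub>?M\<^esub> c = a \<otimes>\<^bsub>?M\<^esub> (b \<otimes>\<^bsub>?M\<^esub> c)"
      by (simp_all only: reps mero_stalk_simps(2) germ_mult closed) (simp_all add: algebra_simps)
  qed
  show ?thesis
  proof (rule cringI[OF add mult])
    fix a b c assume abc: "a \<in> carrier ?M" "b \<in> carrier ?M" "c \<in> carrier ?M"
    obtain p q r s t u where reps: "(p, q) \<in> fractions V x" "a = germ V x p q"
      "(r, s) \<in> fractions V x" "b = germ V x r s" "(t, u) \<in> fractions V x" "c = germ V x t u"
      using mero_stalk_cases[OF abc(1)] mero_stalk_cases[OF abc(2)] mero_stalk_cases[OF abc(3)] by metis
    show "(a \<oplus>\<^bsub>?M\<^esub> b) \<otimes>\<^bsub>?M\<^esub> c = a \<otimes>\<^bsub>?M\<^esub> c \<oplus>\<^bsub>?M\<^esub> b \<otimes>\<^bsub>?M\<^esub> c"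
      by (simp only: reps germ_add germ_mult closed, subst germ_eq_iff)
        (simp_all only: closed reps, simp add: algebra_simps)
  qed
qed

lemma holo_germ_add:
  "holo_at V x f \<Longrightarrow> holo_at V x g \<Longrightarrow>
    holo_germ V x f \<oplus>\<^bsub>\<M> x\<^esub> holo_germ V x g = holo_germ V x (\<lambda>y. f y + g y)"
  by (simp add: germ_add fractions_holo)

lemma holo_germ_mult:
  "holo_at V x f \<Longrightarrow> holo_at V x g \<Longrightarrow>
    holo_germ V x f \<otimes>\<^bsub>\<M> x\<^esub> holo_germ V x g = holo_germ V x (\<lambda>y. f y * g y)"
  by (simp add: germ_mult fractions_holo)

lemma holo_germ_in_mero: "holo_at V x f \<Longrightarrow> holo_germ V x f \<in> carrier (\<M> x)"
  by (intro germ_in_carrier fractions_holo)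

lemma holo_germ_uminus:
  assumes "holo_at V x f"
  shows "\<ominus>\<^bsub>\<M> x\<^esub> holo_germ V x f = holo_germ V x (\<lambda>y. - f y)"
proof -
  interpret M: cring "\<M> x" using assms by (intro cring_mero_stalk holo_at_carrier)
  have "holo_germ V x (\<lambda>y. - f y) \<oplus>\<^bsub>\<M> x\<^esub> holo_germ V x f = \<zero>\<^bsub>\<M> x\<^esub>"
    using assms by (simp add: holo_germ_add holo_at_uminus mero_stalk_simps)
  then show ?thesis using assms by (simp add: M.minus_equality holo_germ_in_mero holo_at_uminus)
qed

lemma subring_holo:
  assumes "x \<in> carrier V" shows "subring (carrier (\<O> x)) (\<M> x)"
proof -
  interpret M: cring "\<M> x" using assms by (rule cring_mero_stalk)
  show ?thesis
  proof (rule M.subringI)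
    show "carrier (\<O> x) \<subseteq> carrier (\<M> x)" by (auto intro: holo_germ_in_mero)
    show "\<one>\<^bsub>\<M> x\<^esub> \<in> carrier (\<O> x)"
      using holo_at_const[OF assms] by (auto simp: mero_stalk_simps(2))
  next
    fix a assume "a \<in> carrier (\<O> x)"
    then obtain f where f: "a = holo_germ V x f" "holo_at V x f" by auto
    with holo_at_uminus[OF f(2)] show "\<ominus>\<^bsub>\<M> x\<^esub> a \<in> carrier (\<O> x)"
      by (auto simp: holo_germ_uminus)
  next
    fix a b assume "a \<in> carrier (\<O> x)" "b \<in> carrier (\<O> x)"
    then obtain f g where f: "a = holo_germ V x f" "holo_at V x f" "b = holo_germ V x g" "holo_at V x g"
      by auto
    with holo_at_mult[OF f(2,4)] show "a \<otimes>\<^bsub>\<M> x\<^esub> b \<in> carrier (\<O> x)"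
      by (auto simp: holo_germ_mult)
    from f holo_at_add[OF f(2,4)] show "a \<oplus>\<^bsub>\<M> x\<^esub> b \<in> carrier (\<O> x)"
      by (auto simp: holo_germ_add)
  qed
qed

lemma cring_holo_stalk:
  assumes "x \<in> carrier V" shows "cring (\<O> x)"
proof -
  interpret M: cring "\<M> x" using assms by (rule cring_mero_stalk)
  have "subcring (carrier (\<O> x)) (\<M> x)"
    using subring_holo[OF assms] M.subcringI' by blast
  then show ?thesis
    using M.subcring_iff subringE(1)[OF subring_holo[OF assms]] by (simp add: holo_stalk_def)
qed

lemma family_ring_simps:
  "carrier (\<F>) = (\<Pi>\<^sub>E x\<in>carrier V. carrier (\<M> x))"
  "\<one>\<^bsub>\<F>\<^esub> = (\<lambda>x\<in>carrier V. \<one>\<^bsub>\<M> x\<^esub>)"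
  "\<zero>\<^bsub>\<F>\<^esub> = (\<lambda>x\<in>carrier V. \<zero>\<^bsub>\<M> x\<^esub>)"
  "F \<oplus>\<^bsub>\<F>\<^esub> F' = (\<lambda>x\<in>carrier V. F x \<oplus>\<^bsub>\<M> x\<^esub> F' x)"
  "F \<otimes>\<^bsub>\<F>\<^esub> F' = (\<lambda>x\<in>carrier V. F x \<otimes>\<^bsub>\<M> x\<^esub> F' x)"
  by (simp_all add: family_ring_def)

lemma family_eqI:
  "F \<in> carrier (\<F>) \<Longrightarrow> F' \<in> carrier (\<F>) \<Longrightarrow>
    (\<And>x. x \<in> carrier V \<Longrightarrow> F x = F' x) \<Longrightarrow> F = F'"
  unfolding family_ring_simps by (rule PiE_ext)

lemma family_mem: "F \<in> carrier (\<F>) \<Longrightarrow> x \<in> carrier V \<Longrightarrow> F x \<in> carrier (\<M> x)"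
  unfolding family_ring_simps by (rule PiE_mem)

lemma family_restrict_mem:
  "(\<And>x. x \<in> carrier V \<Longrightarrow> f x \<in> carrier (\<M> x)) \<Longrightarrow>
    (\<lambda>x\<in>carrier V. f x) \<in> carrier (\<F>)"
  unfolding family_ring_simps by (simp add: PiE_iff)

lemma cring_family_ring: "cring (\<F>)"
proof -
  note M = cring.cring_simprules[OF cring_mero_stalk]
  note ops = family_ring_simps(2-5)
  have closed: "\<zero>\<^bsub>\<F>\<^esub> \<in> carrier (\<F>)"
    "\<one>\<^bsub>\<F>\<^esub> \<in> carrier (\<F>)"
    "F \<oplus>\<^bsub>\<F>\<^esub> F' \<in> carrier (\<F>)"
    "F \<otimes>\<^bsub>\<F>\<^esub> F' \<in> carrier (\<F>)"
    if "F \<in> carrier (\<F>)" "F' \<in> carrier (\<F>)" for F F'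
    using that unfolding ops by (auto intro!: family_restrict_mem simp: family_mem M)
  note zero = closed(1) and one = closed(2) and plus = closed(3) and times = closed(4)
  have minus: "\<exists>F'\<in>carrier (\<F>). F' \<oplus>\<^bsub>\<F>\<^esub> F = \<zero>\<^bsub>\<F>\<^esub>"
    if F: "F \<in> carrier (\<F>)" for F
  proof (rule bexI)
    show *: "(\<lambda>x\<in>carrier V. \<ominus>\<^bsub>\<M> x\<^esub> F x) \<in> carrier (\<F>)"
      by (rule family_restrict_mem) (simp add: family_mem F M)
    show "(\<lambda>x\<in>carrier V. \<ominus>\<^bsub>\<M> x\<^esub> F x) \<oplus>\<^bsub>\<F>\<^esub> F = \<zero>\<^bsub>\<F>\<^esub>"
      by (rule family_eqI) (simp_all add: plus * F zero[OF F F], simp add: ops M family_mem F)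
  qed
  have add: "abelian_group (\<F>)"
  proof (rule abelian_groupI)
    have "(\<lambda>x\<in>carrier V. \<zero>\<^bsub>\<M> x\<^esub>) \<in> carrier (\<F>)"
      by (rule family_restrict_mem) (simp add: M)
    then show "\<zero>\<^bsub>\<F>\<^esub> \<in> carrier (\<F>)"
      by (simp add: ops)
    fix F F' F'' assume F: "F \<in> carrier (\<F>)" "F' \<in> carrier (\<F>)"
      "F'' \<in> carrier (\<F>)"
    show "F \<oplus>\<^bsub>\<F>\<^esub> F' \<oplus>\<^bsub>\<F>\<^esub> F'' = F \<oplus>\<^bsub>\<F>\<^esub> (F' \<oplus>\<^bsub>\<F>\<^esub> F'')"
      by (rule family_eqI) (simp_all add: plus F, simp add: ops M family_mem F)
  next
    fix F F' assume F: "F \<in> carrier (\<F>)" "F' \<in> carrier (\<F>)"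
    show "F \<oplus>\<^bsub>\<F>\<^esub> F' = F' \<oplus>\<^bsub>\<F>\<^esub> F"
      by (rule family_eqI) (simp_all add: plus F, simp add: ops M family_mem F)
  next
    fix F assume F: "F \<in> carrier (\<F>)"
    show "\<zero>\<^bsub>\<F>\<^esub> \<oplus>\<^bsub>\<F>\<^esub> F = F"
      by (rule family_eqI) (simp_all add: plus zero[OF F F] F, simp add: ops family_mem F M)
  qed (fact minus plus)+
  have mult: "comm_monoid (\<F>)"
  proof (rule comm_monoidI)
    have "(\<lambda>x\<in>carrier V. \<one>\<^bsub>\<M> x\<^esub>) \<in> carrier (\<F>)"
      by (rule family_restrict_mem) (simp add: M)
    then show "\<one>\<^bsub>\<F>\<^esub> \<in> carrier (\<F>)"
      by (simp add: ops)
    fix F F' F'' assume F: "F \<in> carrier (\<F>)" "F' \<in> carrier (\<F>)"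
      "F'' \<in> carrier (\<F>)"
    show "F \<otimes>\<^bsub>\<F>\<^esub> F' \<otimes>\<^bsub>\<F>\<^esub> F'' = F \<otimes>\<^bsub>\<F>\<^esub> (F' \<otimes>\<^bsub>\<F>\<^esub> F'')"
      by (rule family_eqI) (simp_all add: times F, simp add: ops M family_mem F)
  next
    fix F F' assume F: "F \<in> carrier (\<F>)" "F' \<in> carrier (\<F>)"
    show "F \<otimes>\<^bsub>\<F>\<^esub> F' = F' \<otimes>\<^bsub>\<F>\<^esub> F"
      by (rule family_eqI) (simp_all add: times F, simp add: ops M family_mem F)
  next
    fix F assume F: "F \<in> carrier (\<F>)"
    show "\<one>\<^bsub>\<F>\<^esub> \<otimes>\<^bsub>\<F>\<^esub> F = F"
      by (rule family_eqI) (simp_all add: times one[OF F F] F, simp add: ops family_mem F M(12))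
  qed (fact times)
  show ?thesis
  proof (rule cringI[OF add mult])
    fix F F' F'' assume F: "F \<in> carrier (\<F>)" "F' \<in> carrier (\<F>)"
      "F'' \<in> carrier (\<F>)"
    show "(F \<oplus>\<^bsub>\<F>\<^esub> F') \<otimes>\<^bsub>\<F>\<^esub> F'' =
        F \<otimes>\<^bsub>\<F>\<^esub> F'' \<oplus>\<^bsub>\<F>\<^esub> F' \<otimes>\<^bsub>\<F>\<^esub> F''"
      by (rule family_eqI) (simp_all add: plus times F, simp add: ops M family_mem F)
  qed
qed

sublocale \<F>: cring "\<F>" by (rule cring_family_ring)

lemma family_uminus:
  assumes "F \<in> carrier (\<F>)" "x \<in> carrier V"
  shows "(\<ominus>\<^bsub>\<F>\<^esub> F) x = \<ominus>\<^bsub>\<M> x\<^esub> F x"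
proof -
  interpret M: cring "\<M> x" using assms(2) by (rule cring_mero_stalk)
  have "(\<ominus>\<^bsub>\<F>\<^esub> F \<oplus>\<^bsub>\<F>\<^esub> F) x = \<zero>\<^bsub>\<F>\<^esub> x"
    using assms by (simp add: \<F>.l_neg)
  then have "(\<ominus>\<^bsub>\<F>\<^esub> F) x \<oplus>\<^bsub>\<M> x\<^esub> F x = \<zero>\<^bsub>\<M> x\<^esub>"
    using assms by (simp add: family_ring_simps)
  then show ?thesis
    using assms by (simp add: M.minus_equality[symmetric] family_mem)
qed

end

section \<open>Pulling germs back along biholomorphic maps\<close>

definition biholo :: "('a, 'n::finite) lie_group \<Rightarrow> ('a \<Rightarrow> 'a) \<Rightarrow> bool" where
  "biholo V \<psi> \<longleftrightarrow> holo_map V \<psi> \<and>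
     (\<exists>\<eta>. holo_map V \<eta> \<and> (\<forall>x\<in>carrier V. \<eta> (\<psi> x) = x \<and> \<psi> (\<eta> x) = x))"

text \<open>Both the translations of families and the action of \<open>G\<close> on them have this form.\<close>

definition pull_family ::
  "('a, 'n::finite) lie_group \<Rightarrow> ('a \<Rightarrow> 'a) \<Rightarrow> 'a germ_family \<Rightarrow> 'a germ_family" where
  "pull_family V \<psi> F = (\<lambda>x\<in>carrier V. pull V \<psi> x (F (\<psi> x)))"

context lie
begin

lemma holo_map_mem: "holo_map V \<psi> \<Longrightarrow> x \<in> carrier V \<Longrightarrow> \<psi> x \<in> carrier V"
  unfolding holo_map_def continuous_map_def topspace_V by (auto simp: Pi_iff)

lemma biholo_mem: "biholo V \<psi> \<Longrightarrow> x \<in> carrier V \<Longrightarrow> \<psi> x \<in> carrier V"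
  by (auto simp: biholo_def intro: holo_map_mem)

lemma holo_map_comp:
  assumes "holo_map V \<psi>" "holo_map V \<eta>" shows "holo_map V (\<lambda>x. \<psi> (\<eta> x))"
  unfolding holo_map_def
proof (intro conjI allI impI)
  show "continuous_map (topo V) (topo V) (\<lambda>x. \<psi> (\<eta> x))"
    using assms continuous_map_compose[of "topo V" "topo V" \<eta> "topo V" \<psi>]
    by (simp add: holo_map_def o_def)
  fix f D assume "holo_on V f D"
  then have "holo_on V (\<lambda>x. f (\<psi> (\<eta> x))) {x \<in> carrier V. \<eta> x \<in> {x \<in> carrier V. \<psi> x \<in> D}}"
    using assms unfolding holo_map_def by blast
  moreover have "{x \<in> carrier V. \<eta> x \<in> {x \<in> carrier V. \<psi> x \<in> D}} = {x \<in> carrier V. \<psi> (\<eta> x) \<in> D}"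
    using holo_map_mem[OF assms(2)] by blast
  ultimately show "holo_on V (\<lambda>x. f (\<psi> (\<eta> x))) {x \<in> carrier V. \<psi> (\<eta> x) \<in> D}" by simp
qed

lemma biholo_comp:
  assumes "biholo V \<psi>" "biholo V \<eta>" shows "biholo V (\<lambda>x. \<psi> (\<eta> x))"
proof -
  obtain \<psi>' \<eta>' where inv: "holo_map V \<psi>'" "\<forall>x\<in>carrier V. \<psi>' (\<psi> x) = x \<and> \<psi> (\<psi>' x) = x"
    "holo_map V \<eta>'" "\<forall>x\<in>carrier V. \<eta>' (\<eta> x) = x \<and> \<eta> (\<eta>' x) = x"
    using assms by (auto simp: biholo_def)
  then have "holo_map V (\<lambda>x. \<eta>' (\<psi>' x))" "holo_map V (\<lambda>x. \<psi> (\<eta> x))"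
    using assms by (simp_all add: holo_map_comp biholo_def)
  moreover have "\<forall>x\<in>carrier V. \<eta>' (\<psi>' (\<psi> (\<eta> x))) = x \<and> \<psi> (\<eta> (\<eta>' (\<psi>' x))) = x"
    using inv assms(2) biholo_mem[OF assms(2)] holo_map_mem[OF inv(1)] by simp
  ultimately show ?thesis unfolding biholo_def by blast
qed

lemma holo_on_comp:
  "holo_map V \<psi> \<Longrightarrow> holo_on V f (carrier V) \<Longrightarrow> holo_on V (\<lambda>z. f (\<psi> z)) (carrier V)"
proof -
  assume \<psi>: "holo_map V \<psi>" and f: "holo_on V f (carrier V)"
  have "{x \<in> carrier V. \<psi> x \<in> carrier V} = carrier V" using holo_map_mem[OF \<psi>] by blast
  then show ?thesis using \<psi> f unfolding holo_map_def by metis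
qed

lemma holo_at_comp:
  assumes "holo_map V \<psi>" "x \<in> carrier V" "holo_at V (\<psi> x) f"
  shows "holo_at V x (\<lambda>z. f (\<psi> z))"
proof -
  obtain D where D: "\<psi> x \<in> D" "holo_on V f D" using assms(3) by (auto simp: holo_at_def)
  then have "holo_on V (\<lambda>z. f (\<psi> z)) {z \<in> carrier V. \<psi> z \<in> D}"
    using assms(1) by (simp add: holo_map_def)
  then show ?thesis unfolding holo_at_def
    using D(1) assms(2) by (intro exI[of _ "{z \<in> carrier V. \<psi> z \<in> D}"]) simp
qed

lemma eventually_comp:
  assumes "holo_map V \<psi>" "x \<in> carrier V" "\<forall>\<^sub>F y in nhdsin (topo V) (\<psi> x). P y"
  shows "\<forall>\<^sub>F z in nhdsin (topo V) x. P (\<psi> z)"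
proof -
  obtain S where S: "openin (topo V) S" "\<psi> x \<in> S" "\<forall>y\<in>S. P y"
    using assms(3) holo_map_mem[OF assms(1,2)] by (auto simp: eventually_nhds)
  have "openin (topo V) {z \<in> carrier V. \<psi> z \<in> S}"
    using openin_continuous_map_preimage[of "topo V" "topo V" \<psi> S] assms(1) S(1)
    by (simp add: holo_map_def topspace_V)
  then show ?thesis
    using S assms(2) by (subst eventually_nhds) (auto intro!: exI[of _ "{z \<in> carrier V. \<psi> z \<in> S}"])
qed

text \<open>The inverse of \<open>\<psi>\<close> carries a germ \<open>h\<close> at \<open>x\<close> with \<open>(q \<circ> \<psi>) h = 0\<close> to a
  germ at \<open>\<psi> x\<close> that is annihilated by \<open>q\<close>.\<close>

lemma nonzerodivisor_at_comp:
  assumes "biholo V \<psi>" "x \<in> carrier V" "nonzerodivisor_at V (\<psi> x) q"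
  shows "nonzerodivisor_at V x (\<lambda>z. q (\<psi> z))"
  unfolding nonzerodivisor_at_def
proof (intro allI impI)
  fix h assume h: "holo_at V x h" "\<forall>\<^sub>F z in nhdsin (topo V) x. q (\<psi> z) * h z = 0"
  have \<psi>: "holo_map V \<psi>" using assms(1) by (simp add: biholo_def)
  obtain \<eta> where \<eta>: "holo_map V \<eta>" "\<And>x. x \<in> carrier V \<Longrightarrow> \<eta> (\<psi> x) = x"
    "\<And>x. x \<in> carrier V \<Longrightarrow> \<psi> (\<eta> x) = x"
    using assms(1) by (auto simp: biholo_def)
  have \<psi>x: "\<psi> x \<in> carrier V" using holo_map_mem[OF \<psi> assms(2)] .
  have "holo_at V (\<psi> x) (\<lambda>z. h (\<eta> z))"
    using holo_at_comp[OF \<eta>(1) \<psi>x] h(1) \<eta>(2)[OF assms(2)] by simp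
  moreover have "\<forall>\<^sub>F z in nhdsin (topo V) (\<psi> x). q (\<psi> (\<eta> z)) * h (\<eta> z) = 0"
    using eventually_comp[OF \<eta>(1) \<psi>x] h(2) \<eta>(2)[OF assms(2)] by simp
  then have "\<forall>\<^sub>F z in nhdsin (topo V) (\<psi> x). q z * h (\<eta> z) = 0"
    using eventually_in_carrier[of "\<psi> x"] by eventually_elim (simp add: \<eta>(3))
  ultimately have "\<forall>\<^sub>F z in nhdsin (topo V) (\<psi> x). h (\<eta> z) = 0"
    using assms(3) by (simp only: nonzerodivisor_at_def)
  from eventually_comp[OF \<psi> assms(2) this]
  show "\<forall>\<^sub>F z in nhdsin (topo V) x. h z = 0"
    using eventually_in_carrier[of x] by eventually_elim (simp add: \<eta>(2))
qed

lemma fractions_comp: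
  "biholo V \<psi> \<Longrightarrow> x \<in> carrier V \<Longrightarrow> (p, q) \<in> fractions V (\<psi> x) \<Longrightarrow>
    (\<lambda>z. p (\<psi> z), \<lambda>z. q (\<psi> z)) \<in> fractions V x"
  by (simp add: fractions_def nonzerodivisor_at_comp holo_at_comp biholo_def)

lemma pull_germ:
  assumes "biholo V \<psi>" "x \<in> carrier V" "(p, q) \<in> fractions V (\<psi> x)"
  shows "pull V \<psi> x (germ V (\<psi> x) p q) = germ V x (\<lambda>z. p (\<psi> z)) (\<lambda>z. q (\<psi> z))"
  unfolding pull_def
proof (rule UN_germ[OF assms(3)])
  fix r s assume rs: "(r, s) \<in> fractions V (\<psi> x)"
    "\<forall>\<^sub>F y in nhdsin (topo V) (\<psi> x). p y * s y = r y * q y"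
  have "\<forall>\<^sub>F z in nhdsin (topo V) x. p (\<psi> z) * s (\<psi> z) = r (\<psi> z) * q (\<psi> z)"
    by (rule eventually_comp[of \<psi>, OF _ assms(2) rs(2)]) (use assms(1) in \<open>simp add: biholo_def\<close>)
  then show "germ V x (\<lambda>z. r (\<psi> z)) (\<lambda>z. s (\<psi> z)) = germ V x (\<lambda>z. p (\<psi> z)) (\<lambda>z. q (\<psi> z))"
    using germ_eq_iff[OF fractions_comp[OF assms] fractions_comp[OF assms(1,2) rs(1)]] by simp
qed

lemma pull_holo_germ:
  "biholo V \<psi> \<Longrightarrow> x \<in> carrier V \<Longrightarrow> holo_at V (\<psi> x) f \<Longrightarrow>
    pull V \<psi> x (holo_germ V (\<psi> x) f) = holo_germ V x (\<lambda>z. f (\<psi> z))"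
  by (simp add: pull_germ fractions_holo)

lemma pull_ring_hom:
  assumes "biholo V \<psi>" "x \<in> carrier V"
  shows "ring_hom_cring (\<M> (\<psi> x)) (\<M> x) (pull V \<psi> x)"
proof (intro ring_hom_cringI ring_hom_memI cring_mero_stalk biholo_mem[OF assms] assms(2))
  fix a assume "a \<in> carrier (\<M> (\<psi> x))"
  then show "pull V \<psi> x a \<in> carrier (\<M> x)"
    using assms by (auto elim!: mero_stalk_cases simp: pull_germ intro!: germ_in_carrier fractions_comp)
next
  fix a b assume ab: "a \<in> carrier (\<M> (\<psi> x))" "b \<in> carrier (\<M> (\<psi> x))"
  obtain p q r s where reps: "(p, q) \<in> fractions V (\<psi> x)" "a = germ V (\<psi> x) p q"
    "(r, s) \<in> fractions V (\<psi> x)" "b = germ V (\<psi> x) r s"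
    using mero_stalk_cases[OF ab(1)] mero_stalk_cases[OF ab(2)] by metis
  note facts = pull_germ[OF assms] germ_mult germ_add fractions_comp[OF assms] fractions_mult
    fractions_add reps(1,3)
  show "pull V \<psi> x (a \<otimes>\<^bsub>\<M> (\<psi> x)\<^esub> b) = pull V \<psi> x a \<otimes>\<^bsub>\<M> x\<^esub> pull V \<psi> x b"
    unfolding reps(2,4) by (simp only: facts)
  show "pull V \<psi> x (a \<oplus>\<^bsub>\<M> (\<psi> x)\<^esub> b) = pull V \<psi> x a \<oplus>\<^bsub>\<M> x\<^esub> pull V \<psi> x b"
    unfolding reps(2,4) by (simp only: facts)
next
  show "pull V \<psi> x \<one>\<^bsub>\<M> (\<psi> x)\<^esub> = \<one>\<^bsub>\<M> x\<^esub>"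
    using pull_holo_germ[OF assms holo_at_const[OF biholo_mem[OF assms]]] by (simp add: mero_stalk_simps)
qed

lemma pull_holo_stalk:
  assumes "biholo V \<psi>" "x \<in> carrier V" "a \<in> carrier (\<O> (\<psi> x))"
  shows "pull V \<psi> x a \<in> carrier (\<O> x)"
proof -
  obtain f where f: "holo_at V (\<psi> x) f" "a = holo_germ V (\<psi> x) f" using assms(3) by auto
  moreover have "holo_at V x (\<lambda>z. f (\<psi> z))"
    using holo_at_comp assms f(1) by (simp add: biholo_def)
  ultimately show ?thesis using pull_holo_germ[OF assms(1,2)] by auto
qed

lemma pull_pull:
  assumes "biholo V \<psi>" "biholo V \<eta>" "x \<in> carrier V" "a \<in> carrier (\<M> (\<psi> (\<eta> x)))"
  shows "pull V \<eta> x (pull V \<psi> (\<eta> x) a) = pull V (\<lambda>z. \<psi> (\<eta> z)) x a"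
proof -
  obtain p q where pq: "(p, q) \<in> fractions V (\<psi> (\<eta> x))" "a = germ V (\<psi> (\<eta> x)) p q"
    using mero_stalk_cases[OF assms(4)] .
  note 1 = fractions_comp[OF assms(1) biholo_mem[OF assms(2,3)] pq(1)]
  show ?thesis unfolding pq(2)
    using pull_germ[OF assms(1) biholo_mem[OF assms(2,3)] pq(1)] pull_germ[OF assms(2,3) 1]
      pull_germ[OF biholo_comp[OF assms(1,2)] assms(3) pq(1)] by simp
qed

lemma pull_cong:
  assumes "biholo V \<psi>" "biholo V \<eta>" "\<And>z. z \<in> carrier V \<Longrightarrow> \<psi> z = \<eta> z" "x \<in> carrier V"
    and "a \<in> carrier (\<M> (\<psi> x))"
  shows "pull V \<psi> x a = pull V \<eta> x a"
proof -
  obtain p q where pq: "(p, q) \<in> fractions V (\<psi> x)" "a = germ V (\<psi> x) p q"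
    using mero_stalk_cases[OF assms(5)] .
  have pq': "(p, q) \<in> fractions V (\<eta> x)" using pq(1) assms(3,4) by simp
  have "germ V x (\<lambda>z. p (\<psi> z)) (\<lambda>z. q (\<psi> z)) = germ V x (\<lambda>z. p (\<eta> z)) (\<lambda>z. q (\<eta> z))"
    unfolding germ_eq_iff[OF fractions_comp[OF assms(1,4) pq(1)] fractions_comp[OF assms(2,4) pq']]
    using eventually_in_carrier[of x] by eventually_elim (simp add: assms(3))
  then show ?thesis unfolding pq(2)
    using pull_germ[OF assms(1,4) pq(1)] pull_germ[OF assms(2,4) pq'] assms(3)[OF assms(4)] by simp
qed

lemma biholo_id: "biholo V (\<lambda>z. z)"
proof -
  have "{x \<in> carrier V. x \<in> D} = D" if "holo_on V f D" for f D
    using openin_subset[OF holo_on_open[OF that]] by (auto simp: topspace_V)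
  then have "holo_map V (\<lambda>z. z)" unfolding holo_map_def by auto
  then show ?thesis unfolding biholo_def by auto
qed

lemma pull_id:
  assumes "x \<in> carrier V" "a \<in> carrier (\<M> x)"
  shows "pull V (\<lambda>z. z) x a = a"
  using assms(2) pull_germ[OF biholo_id assms(1)] by (auto elim!: mero_stalk_cases)

lemma biholo_translation:
  assumes "\<xi> \<in> carrier V" shows "biholo V (\<lambda>z. \<xi> \<otimes>\<^bsub>V\<^esub> z)"
  unfolding biholo_def
  using assms by (intro conjI exI[of _ "\<lambda>z. inv\<^bsub>V\<^esub> \<xi> \<otimes>\<^bsub>V\<^esub> z"])
    (auto simp: holo_map_translation V.m_assoc[symmetric])

lemma pull_family_ring_hom:
  assumes "biholo V \<psi>"
  shows "ring_hom_cring (\<F>) (\<F>) (pull_family V \<psi>)"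
proof -
  have mem: "pull_family V \<psi> F \<in> carrier (\<F>)" if "F \<in> carrier (\<F>)" for F
    unfolding pull_family_def
  proof (rule family_restrict_mem)
    fix x assume x: "x \<in> carrier V"
    interpret h: ring_hom_cring "\<M> (\<psi> x)" "\<M> x" "pull V \<psi> x"
      using assms x by (rule pull_ring_hom)
    show "pull V \<psi> x (F (\<psi> x)) \<in> carrier (\<M> x)"
      using family_mem[OF that biholo_mem[OF assms x]] by (rule h.hom_closed)
  qed
  show ?thesis
  proof (intro ring_hom_cringI ring_hom_memI cring_family_ring mem)
    fix F F' assume F: "F \<in> carrier (\<F>)" "F' \<in> carrier (\<F>)"
    show "pull_family V \<psi> (F \<otimes>\<^bsub>\<F>\<^esub> F') =
        pull_family V \<psi> F \<otimes>\<^bsub>\<F>\<^esub> pull_family V \<psi> F'"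
    proof (rule family_eqI)
      fix x assume x: "x \<in> carrier V"
      interpret h: ring_hom_cring "\<M> (\<psi> x)" "\<M> x" "pull V \<psi> x"
        using assms x by (rule pull_ring_hom)
      show "pull_family V \<psi> (F \<otimes>\<^bsub>\<F>\<^esub> F') x =
          (pull_family V \<psi> F \<otimes>\<^bsub>\<F>\<^esub> pull_family V \<psi> F') x"
        using x biholo_mem[OF assms x] F by (simp add: pull_family_def family_ring_simps(5) family_mem)
    qed (simp_all add: F mem)
    show "pull_family V \<psi> (F \<oplus>\<^bsub>\<F>\<^esub> F') =
        pull_family V \<psi> F \<oplus>\<^bsub>\<F>\<^esub> pull_family V \<psi> F'"
    proof (rule family_eqI)
      fix x assume x: "x \<in> carrier V"
      interpret h: ring_hom_cring "\<M> (\<psi> x)" "\<M> x" "pull V \<psi> x"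
        using assms x by (rule pull_ring_hom)
      show "pull_family V \<psi> (F \<oplus>\<^bsub>\<F>\<^esub> F') x =
          (pull_family V \<psi> F \<oplus>\<^bsub>\<F>\<^esub> pull_family V \<psi> F') x"
        using x biholo_mem[OF assms x] F by (simp add: pull_family_def family_ring_simps(4) family_mem)
    qed (simp_all add: F mem)
  next
    show "pull_family V \<psi> \<one>\<^bsub>\<F>\<^esub> = \<one>\<^bsub>\<F>\<^esub>"
    proof (rule family_eqI)
      fix x assume x: "x \<in> carrier V"
      interpret h: ring_hom_cring "\<M> (\<psi> x)" "\<M> x" "pull V \<psi> x"
        using assms x by (rule pull_ring_hom)
      show "pull_family V \<psi> \<one>\<^bsub>\<F>\<^esub> x = \<one>\<^bsub>\<F>\<^esub> x"
        using x biholo_mem[OF assms x] by (simp add: pull_family_def family_ring_simps(2))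
    qed (simp_all add: mem)
  qed
qed

lemma transl_family_eq:
  "\<xi> \<in> carrier V \<Longrightarrow> transl_family V \<xi> F = pull_family V (\<lambda>z. inv\<^bsub>V\<^esub> \<xi> \<otimes>\<^bsub>V\<^esub> z) F"
  by (auto simp: transl_family_def pull_family_def transl_def V.m_assoc[symmetric] intro!: ext)

lemma transl_ring_hom:
  assumes "\<xi> \<in> carrier V" "x \<in> carrier V"
  shows "ring_hom_cring (\<M> x) (\<M> (\<xi> \<otimes>\<^bsub>V\<^esub> x)) (transl V \<xi> x)"
proof -
  have "transl V \<xi> x = pull V (\<lambda>z. inv\<^bsub>V\<^esub> \<xi> \<otimes>\<^bsub>V\<^esub> z) (\<xi> \<otimes>\<^bsub>V\<^esub> x)"
    by (simp add: transl_def fun_eq_iff)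
  moreover have "inv\<^bsub>V\<^esub> \<xi> \<otimes>\<^bsub>V\<^esub> (\<xi> \<otimes>\<^bsub>V\<^esub> x) = x"
    using assms by (simp add: V.m_assoc[symmetric])
  ultimately show ?thesis
    using pull_ring_hom[of "\<lambda>z. inv\<^bsub>V\<^esub> \<xi> \<otimes>\<^bsub>V\<^esub> z" "\<xi> \<otimes>\<^bsub>V\<^esub> x"] assms by (simp add: biholo_translation)
qed

section \<open>Functions and the skew-group ring acting on families of germs\<close>

lemma zero_mero_ring: "\<zero>\<^bsub>mero_ring V\<^esub> = \<zero>\<^bsub>\<F>\<^esub>"
  by (simp add: mero_ring_def)

lemma skew_ring_coeff: "a \<in> carrier (skew_ring V) \<Longrightarrow> \<xi> \<in> carrier V \<Longrightarrow> a \<xi> \<in> carrier (\<F>)"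
  by (auto simp: skew_ring_def mero_ring_def)

lemma skew_ring_finite: "a \<in> carrier (skew_ring V) \<Longrightarrow> finite (skew_support V a)"
  by (simp add: skew_ring_def)

lemma skew_support_sub: "skew_support V a \<subseteq> carrier V"
  by (auto simp: skew_support_def)

lemma transl_family_ring_hom:
  assumes "\<xi> \<in> carrier V"
  shows "ring_hom_cring (\<F>) (\<F>) (transl_family V \<xi>)"
proof -
  have "transl_family V \<xi> = pull_family V (\<lambda>z. inv\<^bsub>V\<^esub> \<xi> \<otimes>\<^bsub>V\<^esub> z)"
    using assms by (simp add: transl_family_eq fun_eq_iff)
  then show ?thesis using assms by (simp add: pull_family_ring_hom biholo_translation)
qed

lemma transl_family_closed:
  "\<xi> \<in> carrier V \<Longrightarrow> F \<in> carrier (\<F>) \<Longrightarrow> transl_family V \<xi> F \<in> carrier (\<F>)"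
  using ring_hom_closed[OF ring_hom_cring.homh[OF transl_family_ring_hom]] .

lemma skew_act_closed:
  assumes "a \<in> carrier (skew_ring V)" "F \<in> carrier (\<F>)"
  shows "skew_act V a F \<in> carrier (\<F>)"
proof -
  have mem: "\<xi> \<in> carrier V" "a \<xi> \<in> carrier (\<F>)" if "\<xi> \<in> skew_support V a" for \<xi>
    using that skew_support_sub skew_ring_coeff[OF assms(1)] by blast+
  show ?thesis unfolding skew_act_def using mem assms(2)
    by (intro \<F>.finsum_closed) (auto intro!: \<F>.m_closed transl_family_closed)
qed

lemma skew_act_add:
  assumes a: "a \<in> carrier (skew_ring V)" and F: "F \<in> carrier (\<F>)" "F' \<in> carrier (\<F>)"
  shows "skew_act V a (F \<oplus>\<^bsub>\<F>\<^esub> F') = skew_act V a F \<oplus>\<^bsub>\<F>\<^esub> skew_act V a F'"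
proof -
  have mem: "\<xi> \<in> carrier V" "a \<xi> \<in> carrier (\<F>)" if "\<xi> \<in> skew_support V a" for \<xi>
    using that skew_support_sub skew_ring_coeff[OF a] by blast+
  have "skew_act V a (F \<oplus>\<^bsub>\<F>\<^esub> F') = (\<Oplus>\<^bsub>\<F>\<^esub>\<xi>\<in>skew_support V a.
      a \<xi> \<otimes>\<^bsub>\<F>\<^esub> transl_family V \<xi> F \<oplus>\<^bsub>\<F>\<^esub> a \<xi> \<otimes>\<^bsub>\<F>\<^esub> transl_family V \<xi> F')"
    unfolding skew_act_def
  proof (rule \<F>.finsum_cong')
    fix \<xi> assume \<xi>: "\<xi> \<in> skew_support V a"
    show "a \<xi> \<otimes>\<^bsub>\<F>\<^esub> transl_family V \<xi> (F \<oplus>\<^bsub>\<F>\<^esub> F') =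
        a \<xi> \<otimes>\<^bsub>\<F>\<^esub> transl_family V \<xi> F \<oplus>\<^bsub>\<F>\<^esub> a \<xi> \<otimes>\<^bsub>\<F>\<^esub> transl_family V \<xi> F'"
      using ring_hom_add[OF ring_hom_cring.homh[OF transl_family_ring_hom[OF mem(1)[OF \<xi>]]] F]
        mem[OF \<xi>] F by (simp add: \<F>.r_distr transl_family_closed)
  qed (use mem F in \<open>auto intro!: \<F>.a_closed \<F>.m_closed transl_family_closed\<close>)
  also have "\<dots> = skew_act V a F \<oplus>\<^bsub>\<F>\<^esub> skew_act V a F'"
    unfolding skew_act_def using mem F
    by (intro \<F>.finsum_addf) (auto intro!: \<F>.m_closed transl_family_closed)
  finally show ?thesis .
qed

text \<open>A translation-invariant family can be pulled out of the action, since it passes through all the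
  translations \<open>\<phi>\<^sub>\<xi>\<close>.\<close>

lemma skew_act_mult:
  assumes a: "a \<in> carrier (skew_ring V)" and F: "F \<in> carrier (\<F>)" "U \<in> carrier (\<F>)"
    and U: "\<And>\<xi>. \<xi> \<in> carrier V \<Longrightarrow> transl_family V \<xi> U = U"
  shows "skew_act V a (U \<otimes>\<^bsub>\<F>\<^esub> F) = U \<otimes>\<^bsub>\<F>\<^esub> skew_act V a F"
proof -
  have mem: "\<xi> \<in> carrier V" "a \<xi> \<in> carrier (\<F>)" if "\<xi> \<in> skew_support V a" for \<xi>
    using that skew_support_sub skew_ring_coeff[OF a] by blast+
  have "skew_act V a (U \<otimes>\<^bsub>\<F>\<^esub> F) = (\<Oplus>\<^bsub>\<F>\<^esub>\<xi>\<in>skew_support V a.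
      U \<otimes>\<^bsub>\<F>\<^esub> (a \<xi> \<otimes>\<^bsub>\<F>\<^esub> transl_family V \<xi> F))"
    unfolding skew_act_def
  proof (rule \<F>.finsum_cong')
    fix \<xi> assume \<xi>: "\<xi> \<in> skew_support V a"
    show "a \<xi> \<otimes>\<^bsub>\<F>\<^esub> transl_family V \<xi> (U \<otimes>\<^bsub>\<F>\<^esub> F) =
        U \<otimes>\<^bsub>\<F>\<^esub> (a \<xi> \<otimes>\<^bsub>\<F>\<^esub> transl_family V \<xi> F)"
      using ring_hom_mult[OF ring_hom_cring.homh[OF transl_family_ring_hom[OF mem(1)[OF \<xi>]]] F(2,1)]
        mem[OF \<xi>] F U[OF mem(1)[OF \<xi>]] by (simp add: \<F>.m_lcomm transl_family_closed)
  qed (use mem F in \<open>auto intro!: \<F>.m_closed transl_family_closed\<close>)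
  also have "\<dots> = U \<otimes>\<^bsub>\<F>\<^esub> skew_act V a F"
    unfolding skew_act_def using mem F skew_ring_finite[OF a]
    by (intro \<F>.finsum_rdistr[symmetric]) (auto intro!: \<F>.m_closed transl_family_closed)
  finally show ?thesis .
qed

lemma holo_function_apply: "x \<in> carrier V \<Longrightarrow> holo_function V f x = holo_germ V x f"
  by (simp add: holo_function_def)

lemma holo_function_closed: "holo_on V f (carrier V) \<Longrightarrow> holo_function V f \<in> carrier (\<F>)"
  unfolding holo_function_def by (intro family_restrict_mem holo_germ_in_mero holo_at_global)

lemma transl_family_one:
  assumes F: "F \<in> carrier (\<F>)" shows "transl_family V \<e> F = F"
proof (rule family_eqI)
  fix x assume x: "x \<in> carrier V"
  have "pull V (\<lambda>z. inv\<^bsub>V\<^esub> \<e> \<otimes>\<^bsub>V\<^esub> z) x (F x) = pull V (\<lambda>z. z) x (F x)"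
    using x family_mem[OF F x] by (intro pull_cong biholo_id biholo_translation) simp_all
  also have "\<dots> = F x" using x family_mem[OF F x] by (rule pull_id)
  finally show "transl_family V \<e> F x = F x"
    using x by (simp add: transl_family_eq pull_family_def)
qed (simp_all add: F transl_family_closed)

lemma skew_act_function:
  assumes f: "holo_on V f (carrier V)" and F: "F \<in> carrier (\<F>)"
  shows "skew_act V (function_skew V f) F = holo_function V f \<otimes>\<^bsub>\<F>\<^esub> F"
proof (cases "holo_function V f = \<zero>\<^bsub>\<F>\<^esub>")
  case True
  then have "skew_support V (function_skew V f) = {}"
    by (auto simp: skew_support_def function_skew_def zero_mero_ring)
  then show ?thesis using True F by (simp add: skew_act_def)
next
  case False
  then have supp: "skew_support V (function_skew V f) = {\<e>}"
    by (auto simp: skew_support_def function_skew_def zero_mero_ring split: if_splits)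
  have "skew_act V (function_skew V f) F =
      function_skew V f \<e> \<otimes>\<^bsub>\<F>\<^esub> transl_family V \<e> F"
    unfolding skew_act_def supp using holo_function_closed[OF f] F
    by (simp add: function_skew_def transl_family_closed)
  then show ?thesis by (simp add: transl_family_one F function_skew_def)
qed

lemma holo_function_const_transl:
  assumes "\<xi> \<in> carrier V"
  shows "transl_family V \<xi> (holo_function V (\<lambda>_. k)) = holo_function V (\<lambda>_. k)"
proof (rule family_eqI)
  fix x assume x: "x \<in> carrier V"
  have "pull V (\<lambda>z. inv\<^bsub>V\<^esub> \<xi> \<otimes>\<^bsub>V\<^esub> z) x (holo_germ V (inv\<^bsub>V\<^esub> \<xi> \<otimes>\<^bsub>V\<^esub> x) (\<lambda>_. k)) = holo_germ V x (\<lambda>_. k)"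
    using pull_holo_germ[of "\<lambda>z. inv\<^bsub>V\<^esub> \<xi> \<otimes>\<^bsub>V\<^esub> z" x "\<lambda>_. k"] assms x
    by (simp add: biholo_translation holo_at_const)
  then show "transl_family V \<xi> (holo_function V (\<lambda>_. k)) x = holo_function V (\<lambda>_. k) x"
    using assms x by (simp add: transl_family_eq pull_family_def holo_function_apply)
qed (simp_all add: assms transl_family_closed holo_function_closed holo_on_carrier_const)

lemma holo_function_add:
  assumes "holo_on V f (carrier V)" "holo_on V h (carrier V)"
  shows "holo_function V f \<oplus>\<^bsub>\<F>\<^esub> holo_function V h = holo_function V (\<lambda>z. f z + h z)"
proof (rule family_eqI)
  fix x assume "x \<in> carrier V"
  then show "(holo_function V f \<oplus>\<^bsub>\<F>\<^esub> holo_function V h) x = holo_function V (\<lambda>z. f z + h z) x"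
    using assms by (simp add: family_ring_simps(4) holo_function_apply holo_germ_add holo_at_global)
qed (simp_all add: assms holo_function_closed holo_on_add)

lemma holo_function_mult:
  assumes "holo_on V f (carrier V)" "holo_on V h (carrier V)"
  shows "holo_function V f \<otimes>\<^bsub>\<F>\<^esub> holo_function V h = holo_function V (\<lambda>z. f z * h z)"
proof (rule family_eqI)
  fix x assume "x \<in> carrier V"
  then show "(holo_function V f \<otimes>\<^bsub>\<F>\<^esub> holo_function V h) x = holo_function V (\<lambda>z. f z * h z) x"
    using assms by (simp add: family_ring_simps(5) holo_function_apply holo_germ_mult holo_at_global)
qed (simp_all add: assms holo_function_closed holo_on_mult)

lemma holo_function_one: "holo_function V (\<lambda>_. 1) = \<one>\<^bsub>\<F>\<^esub>"
  by (simp add: holo_function_def family_ring_simps(2) mero_stalk_simps(2))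

lemma holo_function_zero: "holo_function V (\<lambda>_. 0) = \<zero>\<^bsub>\<F>\<^esub>"
  by (simp add: holo_function_def family_ring_simps(3) mero_stalk_simps(3))

lemma family_uminus_eq:
  assumes "F \<in> carrier (\<F>)"
  shows "\<ominus>\<^bsub>\<F>\<^esub> F = holo_function V (\<lambda>_. - 1) \<otimes>\<^bsub>\<F>\<^esub> F"
proof (rule \<F>.minus_equality)
  have c: "holo_on V (\<lambda>_. k) (carrier V)" for k by (rule holo_on_carrier_const)
  have "holo_function V (\<lambda>_. - 1) \<otimes>\<^bsub>\<F>\<^esub> F \<oplus>\<^bsub>\<F>\<^esub> F =
      (holo_function V (\<lambda>_. - 1) \<oplus>\<^bsub>\<F>\<^esub> holo_function V (\<lambda>_. 1)) \<otimes>\<^bsub>\<F>\<^esub> F"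
    using assms holo_function_closed[OF c] by (simp add: \<F>.l_distr holo_function_one)
  also have "\<dots> = \<zero>\<^bsub>\<F>\<^esub>"
    using assms by (simp add: holo_function_add c holo_function_zero)
  finally show "holo_function V (\<lambda>_. - 1) \<otimes>\<^bsub>\<F>\<^esub> F \<oplus>\<^bsub>\<F>\<^esub> F = \<zero>\<^bsub>\<F>\<^esub>" .
qed (simp_all add: assms holo_function_closed holo_on_carrier_const)

end

section \<open>The group action and the ideals of germs\<close>

locale lie_action = lie V for V :: "('a, 'n::finite) lie_group" +
  fixes G :: "('g, 'h) monoid_scheme" and \<alpha> :: "'g \<Rightarrow> 'a \<Rightarrow> 'a"
  assumes group_G: "group G" and finite_G: "finite (carrier G)"
    and holomorphic_action: "holomorphic_group_action G V \<alpha>"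
begin

abbreviation "\<H> \<equiv> invariant_functions G V \<alpha>"
abbreviation "\<J> \<equiv> J_e G V \<alpha>"
abbreviation "\<K> \<equiv> kernel_ideal G V \<alpha>"
abbreviation "\<I> \<equiv> invariant_germs G V \<alpha>"
abbreviation "\<E> \<equiv> E_class G V \<alpha>"

sublocale G: group G by (rule group_G)

sublocale act: group_action G "carrier V" \<alpha>
  using holomorphic_action by (simp add: holomorphic_group_action_def)

lemma act_closed: "g \<in> carrier G \<Longrightarrow> x \<in> carrier V \<Longrightarrow> \<alpha> g x \<in> carrier V"
  by (rule act.element_image) auto

lemma act_mult:
  "g \<in> carrier G \<Longrightarrow> h \<in> carrier G \<Longrightarrow> x \<in> carrier V \<Longrightarrow> \<alpha> (g \<otimes>\<^bsub>G\<^esub> h) x = \<alpha> g (\<alpha> h x)"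
  by (rule act.composition_rule)

lemma act_one: "x \<in> carrier V \<Longrightarrow> \<alpha> \<one>\<^bsub>G\<^esub> x = x"
  using act.id_eq_one by (metis restrict_apply')

lemma act_inv: "g \<in> carrier G \<Longrightarrow> x \<in> carrier V \<Longrightarrow> \<alpha> (inv\<^bsub>G\<^esub> g) (\<alpha> g x) = x"
  "g \<in> carrier G \<Longrightarrow> x \<in> carrier V \<Longrightarrow> \<alpha> g (\<alpha> (inv\<^bsub>G\<^esub> g) x) = x"
  by (simp_all add: act_mult[symmetric] act_one)

lemma act_hom: "g \<in> carrier G \<Longrightarrow> group_hom V V (\<alpha> g)"
  using holomorphic_action V.group_axioms
  by (auto simp: holomorphic_group_action_def intro!: group_hom.intro group_hom_axioms.intro)

lemma act_V_mult: "g \<in> carrier G \<Longrightarrow> x \<in> carrier V \<Longrightarrow> y \<in> carrier V \<Longrightarrow>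
    \<alpha> g (x \<otimes>\<^bsub>V\<^esub> y) = \<alpha> g x \<otimes>\<^bsub>V\<^esub> \<alpha> g y"
  using group_hom.hom_mult[OF act_hom] .

lemma act_V_one: "g \<in> carrier G \<Longrightarrow> \<alpha> g \<e> = \<e>"
  using group_hom.hom_one[OF act_hom] .

lemma biholo_act:
  assumes "g \<in> carrier G" shows "biholo V (\<alpha> g)"
proof -
  have "holo_map V (\<alpha> h)" if "h \<in> carrier G" for h
    using holomorphic_action that by (simp add: holomorphic_group_action_def)
  then show ?thesis using assms unfolding biholo_def
    by (intro conjI exI[of _ "\<alpha> (inv\<^bsub>G\<^esub> g)"]) (auto simp: act_inv)
qed

lemma gact_ring_hom:
  assumes "g \<in> carrier G" "x \<in> carrier V"
  shows "ring_hom_cring (\<M> x) (\<M> (\<alpha> g x)) (gact G V \<alpha> g x)"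
proof -
  have "gact G V \<alpha> g x = pull V (\<alpha> (inv\<^bsub>G\<^esub> g)) (\<alpha> g x)" by (simp add: gact_def fun_eq_iff)
  then show ?thesis
    using pull_ring_hom[of "\<alpha> (inv\<^bsub>G\<^esub> g)" "\<alpha> g x"] assms by (simp add: biholo_act act_closed act_inv)
qed

lemma gact_closed:
  assumes "g \<in> carrier G" "x \<in> carrier V" "a \<in> carrier (\<M> x)"
  shows "gact G V \<alpha> g x a \<in> carrier (\<M> (\<alpha> g x))"
proof -
  interpret h: ring_hom_cring "\<M> x" "\<M> (\<alpha> g x)" "gact G V \<alpha> g x"
    by (intro gact_ring_hom assms)
  show ?thesis using assms(3) by (rule h.hom_closed)
qed

lemma gact_holo:
  assumes "g \<in> carrier G" "x \<in> carrier V" "a \<in> carrier (\<O> x)"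
  shows "gact G V \<alpha> g x a \<in> carrier (\<O> (\<alpha> g x))"
  unfolding gact_def using assms
  by (intro pull_holo_stalk) (simp_all add: biholo_act act_closed act_inv del: holo_stalk_simps)

lemma gact_gact:
  assumes "g \<in> carrier G" "h \<in> carrier G" "x \<in> carrier V" "a \<in> carrier (\<M> x)"
  shows "gact G V \<alpha> g (\<alpha> h x) (gact G V \<alpha> h x a) = gact G V \<alpha> (g \<otimes>\<^bsub>G\<^esub> h) x a"
proof -
  let ?g = "\<alpha> (inv\<^bsub>G\<^esub> g)" and ?h = "\<alpha> (inv\<^bsub>G\<^esub> h)" and ?y = "\<alpha> g (\<alpha> h x)"
  have y: "?y \<in> carrier V" "?g ?y = \<alpha> h x" "?h (\<alpha> h x) = x"
    using assms by (simp_all add: act_closed act_inv)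
  have "pull V ?g ?y (pull V ?h (?g ?y) a) = pull V (\<lambda>z. ?h (?g z)) ?y a"
    using assms y by (intro pull_pull) (simp_all add: biholo_act)
  also have "\<dots> = pull V (\<alpha> (inv\<^bsub>G\<^esub> (g \<otimes>\<^bsub>G\<^esub> h))) ?y a"
    using assms y by (intro pull_cong biholo_comp[OF biholo_act biholo_act])
      (simp_all add: biholo_act G.inv_mult_group act_mult)
  finally show ?thesis using assms y by (simp add: gact_def act_mult)
qed

lemma gact_one:
  assumes "x \<in> carrier V" "a \<in> carrier (\<M> x)"
  shows "gact G V \<alpha> \<one>\<^bsub>G\<^esub> x a = a"
proof -
  have "pull V (\<alpha> \<one>\<^bsub>G\<^esub>) x a = pull V (\<lambda>z. z) x a"
    using assms by (intro pull_cong biholo_id) (simp_all add: biholo_act act_one)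
  then show ?thesis using assms by (simp add: gact_def act_one pull_id)
qed

text \<open>\<open>untransl x : \<M>\<^sub>x \<rightarrow> \<M>\<^sub>e\<close> is the inverse of the translation \<open>\<phi>\<^sub>x\<close>.\<close>

definition untransl :: "'a \<Rightarrow> 'a mgerm \<Rightarrow> 'a mgerm" where
  "untransl x = pull V (\<lambda>z. x \<otimes>\<^bsub>V\<^esub> z) \<e>"

lemma untransl_ring_hom:
  assumes "x \<in> carrier V"
  shows "ring_hom_cring (\<M> x) (\<M> \<e>) (untransl x)"
  using pull_ring_hom[of "\<lambda>z. x \<otimes>\<^bsub>V\<^esub> z" "\<e>"] assms
  by (simp add: untransl_def biholo_translation)

lemma untransl_holo:
  "x \<in> carrier V \<Longrightarrow> a \<in> carrier (\<O> x) \<Longrightarrow> untransl x a \<in> carrier (\<O> \<e>)"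
  unfolding untransl_def
  by (intro pull_holo_stalk) (simp_all add: biholo_translation del: holo_stalk_simps)

lemma transl_eq_pull:
  "x \<in> carrier V \<Longrightarrow> transl V x \<e> a = pull V (\<lambda>z. inv\<^bsub>V\<^esub> x \<otimes>\<^bsub>V\<^esub> z) x a"
  by (simp add: transl_def)

lemma transl_holo:
  "x \<in> carrier V \<Longrightarrow> a \<in> carrier (\<O> \<e>) \<Longrightarrow>
    transl V x \<e> a \<in> carrier (\<O> x)"
  unfolding transl_eq_pull
  by (intro pull_holo_stalk) (simp_all add: biholo_translation del: holo_stalk_simps)

lemma untransl_transl:
  assumes "x \<in> carrier V" "a \<in> carrier (\<M> \<e>)"
  shows "untransl x (transl V x \<e> a) = a"
proof -
  have "pull V (\<lambda>z. x \<otimes>\<^bsub>V\<^esub> z) \<e> (pull V (\<lambda>z. inv\<^bsub>V\<^esub> x \<otimes>\<^bsub>V\<^esub> z) (x \<otimes>\<^bsub>V\<^esub> \<e>) a) =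
      pull V (\<lambda>z. inv\<^bsub>V\<^esub> x \<otimes>\<^bsub>V\<^esub> (x \<otimes>\<^bsub>V\<^esub> z)) \<e> a"
    using assms by (intro pull_pull) (simp_all add: biholo_translation)
  also have "\<dots> = pull V (\<lambda>z. z) \<e> a"
    using assms by (intro pull_cong biholo_comp[OF biholo_translation biholo_translation] biholo_id)
      (simp_all add: biholo_translation V.m_assoc[symmetric])
  also have "\<dots> = a" using assms by (intro pull_id) simp_all
  finally show ?thesis using assms by (simp add: untransl_def transl_eq_pull)
qed

lemma transl_untransl:
  assumes "x \<in> carrier V" "a \<in> carrier (\<M> x)"
  shows "transl V x \<e> (untransl x a) = a"
proof -
  have "pull V (\<lambda>z. inv\<^bsub>V\<^esub> x \<otimes>\<^bsub>V\<^esub> z) x (pull V (\<lambda>z. x \<otimes>\<^bsub>V\<^esub> z) (inv\<^bsub>V\<^esub> x \<otimes>\<^bsub>V\<^esub> x) a) =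
      pull V (\<lambda>z. x \<otimes>\<^bsub>V\<^esub> (inv\<^bsub>V\<^esub> x \<otimes>\<^bsub>V\<^esub> z)) x a"
    using assms by (intro pull_pull) (simp_all add: biholo_translation)
  also have "\<dots> = pull V (\<lambda>z. z) x a"
    using assms by (intro pull_cong biholo_comp[OF biholo_translation biholo_translation] biholo_id)
      (simp_all add: biholo_translation V.m_assoc[symmetric])
  also have "\<dots> = a" using assms by (intro pull_id) simp_all
  finally show ?thesis using assms by (simp add: untransl_def transl_eq_pull)
qed

text \<open>\<open>g\<close> is a group automorphism of \<open>V\<close>, so that \<open>g(x z) = g(x) g(z)\<close>.\<close>

lemma untransl_gact:
  assumes "g \<in> carrier G" "x \<in> carrier V" "a \<in> carrier (\<M> x)"
  shows "untransl (\<alpha> g x) (gact G V \<alpha> g x a) = gact G V \<alpha> g \<e> (untransl x a)"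
proof -
  let ?g = "\<alpha> (inv\<^bsub>G\<^esub> g)"
  have gx: "\<alpha> g x \<in> carrier V" "?g (\<alpha> g x) = x" "?g \<e> = \<e>"
    using assms by (simp_all add: act_closed act_inv act_V_one)
  have "pull V (\<lambda>z. \<alpha> g x \<otimes>\<^bsub>V\<^esub> z) \<e> (pull V ?g (\<alpha> g x \<otimes>\<^bsub>V\<^esub> \<e>) a) =
      pull V (\<lambda>z. ?g (\<alpha> g x \<otimes>\<^bsub>V\<^esub> z)) \<e> a"
    using assms gx by (intro pull_pull) (simp_all add: biholo_translation biholo_act)
  also have "\<dots> = pull V (\<lambda>z. x \<otimes>\<^bsub>V\<^esub> ?g z) \<e> a"
    using assms gx by (intro pull_cong biholo_comp[OF biholo_act biholo_translation]
        biholo_comp[OF biholo_translation biholo_act])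
      (simp_all add: biholo_translation biholo_act act_V_mult)
  also have "\<dots> = pull V ?g \<e> (pull V (\<lambda>z. x \<otimes>\<^bsub>V\<^esub> z) (?g \<e>) a)"
    using assms gx by (intro pull_pull[symmetric]) (simp_all add: biholo_translation biholo_act)
  finally show ?thesis using assms gx by (simp add: untransl_def gact_def act_V_one)
qed

definition max_ideal :: "'a \<Rightarrow> 'a mgerm set" where
  "max_ideal x = {holo_germ V x f | f. holo_at V x f \<and> f x = 0}"

lemma max_idealD:
  assumes "holo_germ V x f \<in> max_ideal x" "holo_at V x f" shows "f x = 0"
proof -
  obtain h where h: "holo_germ V x f = holo_germ V x h" "holo_at V x h" "h x = 0"
    using assms by (auto simp: max_ideal_def)
  then show ?thesis
    using eventually_nhds_at[of "\<lambda>y. f y = h y" x] assms holo_at_carrier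
    by (simp add: holo_germ_eq_iff)
qed

lemma ideal_max_ideal:
  assumes x: "x \<in> carrier V" shows "ideal (max_ideal x) (\<O> x)"
proof -
  interpret O: cring "\<O> x" using x by (rule cring_holo_stalk)
  have inv: "\<ominus>\<^bsub>\<O> x\<^esub> holo_germ V x f = holo_germ V x (\<lambda>y. - f y)" if f: "holo_at V x f" for f
  proof -
    have "holo_germ V x (\<lambda>y. - f y) \<oplus>\<^bsub>\<O> x\<^esub> holo_germ V x f = \<zero>\<^bsub>\<O> x\<^esub>"
      using holo_germ_add[OF holo_at_uminus[OF f] f] by (simp add: mero_stalk_simps)
    then show ?thesis
      by (rule O.minus_equality) (use f holo_at_uminus[OF f] in auto)
  qed
  show ?thesis
  proof (rule idealI)
    show "ring (\<O> x)" by (rule O.ring_axioms)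
    show "subgroup (max_ideal x) (add_monoid (\<O> x))"
    proof (rule O.add.subgroupI)
      show "max_ideal x \<subseteq> carrier (\<O> x)" by (auto simp: max_ideal_def)
      show "max_ideal x \<noteq> {}" using holo_at_const[OF x, of 0] by (auto simp: max_ideal_def)
    next
      fix a assume "a \<in> max_ideal x"
      then obtain f where f: "a = holo_germ V x f" "holo_at V x f" "f x = 0" by (auto simp: max_ideal_def)
      then show "\<ominus>\<^bsub>\<O> x\<^esub> a \<in> max_ideal x"
        unfolding f(1) inv[OF f(2)] max_ideal_def using holo_at_uminus[OF f(2)]
        by (intro CollectI exI[of _ "\<lambda>y. - f y"]) simp
    next
      fix a b assume "a \<in> max_ideal x" "b \<in> max_ideal x"
      then obtain f h where f: "a = holo_germ V x f" "holo_at V x f" "f x = 0"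
        "b = holo_germ V x h" "holo_at V x h" "h x = 0" by (auto simp: max_ideal_def)
      then show "a \<oplus>\<^bsub>\<O> x\<^esub> b \<in> max_ideal x"
        using holo_at_add[OF f(2,5)]
        by (simp add: holo_germ_add max_ideal_def) (rule exI[of _ "\<lambda>y. f y + h y"], simp)
    qed
  next
    fix a b assume "a \<in> max_ideal x" "b \<in> carrier (\<O> x)"
    then obtain f h where f: "a = holo_germ V x f" "holo_at V x f" "f x = 0"
      "b = holo_germ V x h" "holo_at V x h" by (auto simp: max_ideal_def)
    show "a \<otimes>\<^bsub>\<O> x\<^esub> b \<in> max_ideal x"
      using f holo_at_mult[OF f(2,5)]
      by (simp add: holo_germ_mult max_ideal_def) (rule exI[of _ "\<lambda>y. f y * h y"], simp)
    show "b \<otimes>\<^bsub>\<O> x\<^esub> a \<in> max_ideal x"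
      using f holo_at_mult[OF f(5,2)]
      by (simp add: holo_germ_mult max_ideal_def) (rule exI[of _ "\<lambda>y. h y * f y"], simp)
  qed
qed

abbreviation J_gen :: "'a mgerm set" where
  "J_gen \<equiv> {a \<in> fixed_germs G V \<alpha> (carrier G) \<e>.
        \<exists>f. holo_at V \<e> f \<and> f \<e> = 0 \<and> a = holo_germ V \<e> f}"

lemma J_gen_sub: "J_gen \<subseteq> carrier (\<O> \<e>)"
  by (auto simp: fixed_germs_def)

lemma ideal_J_e: "ideal (\<J>) (\<O> \<e>)"
proof -
  interpret O: cring "\<O> \<e>" by (rule cring_holo_stalk) simp
  show ?thesis unfolding J_e_def by (rule O.genideal_ideal[OF J_gen_sub])
qed

lemma J_e_minimal: "ideal I (\<O> \<e>) \<Longrightarrow> J_gen \<subseteq> I \<Longrightarrow> \<J> \<subseteq> I"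
proof -
  interpret O: cring "\<O> \<e>" by (rule cring_holo_stalk) simp
  show "ideal I (\<O> \<e>) \<Longrightarrow> J_gen \<subseteq> I \<Longrightarrow> \<J> \<subseteq> I"
    unfolding J_e_def by (rule O.genideal_minimal)
qed

lemma J_gen_J_e: "J_gen \<subseteq> \<J>"
proof -
  interpret O: cring "\<O> \<e>" by (rule cring_holo_stalk) simp
  show ?thesis unfolding J_e_def by (rule O.genideal_self[OF J_gen_sub])
qed

lemma J_e_sub: "\<J> \<subseteq> carrier (\<O> \<e>)"
  using additive_subgroup.a_subset[OF ideal.axioms(1)[OF ideal_J_e]] .

lemma J_e_max: "\<J> \<subseteq> max_ideal \<e>"
  by (rule J_e_minimal[OF ideal_max_ideal]) (auto simp: max_ideal_def)

lemma ring_hom_holo: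
  assumes "ring_hom_cring (\<M> x) (\<M> y) h" "x \<in> carrier V" "y \<in> carrier V"
    and "\<And>a. a \<in> carrier (\<O> x) \<Longrightarrow> h a \<in> carrier (\<O> y)"
  shows "ring_hom_ring (\<O> x) (\<O> y) h"
proof -
  interpret h: ring_hom_cring "\<M> x" "\<M> y" h by (rule assms(1))
  interpret O: cring "\<O> x" using assms(2) by (rule cring_holo_stalk)
  interpret O': cring "\<O> y" using assms(3) by (rule cring_holo_stalk)
  have sub: "a \<in> carrier (\<M> x)" if "a \<in> carrier (\<O> x)" for a
    using subringE(1)[OF subring_holo[OF assms(2)]] that by blast
  show ?thesis
    by (rule ring_hom_ringI[OF O.ring_axioms O'.ring_axioms assms(4)])
      (simp_all add: sub del: holo_stalk_simps(1))
qed

text \<open>\<open>G\<close> fixes the generators of \<open>\<J>\<close>, and the preimage of an ideal is an ideal.\<close>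

lemma gact_J_e:
  assumes "g \<in> carrier G" "a \<in> \<J>" shows "gact G V \<alpha> g \<e> a \<in> \<J>"
proof -
  have 1: "\<alpha> g \<e> = \<e>" by (rule act_V_one[OF assms(1)])
  have "ring_hom_ring (\<O> \<e>) (\<O> \<e>) (gact G V \<alpha> g \<e>)"
    using gact_ring_hom[OF assms(1), of "\<e>"] gact_holo[OF assms(1), of "\<e>"]
    by (intro ring_hom_holo) (simp_all add: 1 del: holo_stalk_simps)
  from ring_hom_ring.ideal_vimage[OF this ideal_J_e]
  have "\<J> \<subseteq> {r \<in> carrier (\<O> \<e>). gact G V \<alpha> g \<e> r \<in> \<J>}"
  proof (rule J_e_minimal)
    show "J_gen \<subseteq> {r \<in> carrier (\<O> \<e>). gact G V \<alpha> g \<e> r \<in> \<J>}"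
    proof
      fix r assume r: "r \<in> J_gen"
      then have "gact G V \<alpha> g \<e> r = r" using assms(1) by (simp add: fixed_germs_def)
      then show "r \<in> {r \<in> carrier (\<O> \<e>). gact G V \<alpha> g \<e> r \<in> \<J>}"
        using r J_gen_J_e J_gen_sub by (metis (mono_tags, lifting) mem_Collect_eq subsetD)
    qed
  qed
  then show ?thesis using assms(2) by blast
qed

text \<open>This is \<open>\<phi>\<^sub>x(\<J>)\<close>; as a preimage it is an ideal of \<open>\<O> x\<close> at once.\<close>

definition J_at :: "'a \<Rightarrow> 'a mgerm set" where
  "J_at x = {a \<in> carrier (\<O> x). untransl x a \<in> \<J>}"

lemma ideal_J_at:
  assumes "x \<in> carrier V" shows "ideal (J_at x) (\<O> x)"
  unfolding J_at_def
  by (intro ring_hom_ring.ideal_vimage[OF _ ideal_J_e] ring_hom_holo untransl_ring_hom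
      untransl_holo assms V.one_closed)

lemma J_at_add:
  "x \<in> carrier V \<Longrightarrow> a \<in> J_at x \<Longrightarrow> b \<in> J_at x \<Longrightarrow> a \<oplus>\<^bsub>\<M> x\<^esub> b \<in> J_at x"
  using additive_subgroup.a_closed[OF ideal.axioms(1)[OF ideal_J_at], of x a b] by simp

lemma J_at_zero: "x \<in> carrier V \<Longrightarrow> \<zero>\<^bsub>\<M> x\<^esub> \<in> J_at x"
  using additive_subgroup.zero_closed[OF ideal.axioms(1)[OF ideal_J_at], of x] by simp

lemma J_at_holo: "a \<in> J_at x \<Longrightarrow> a \<in> carrier (\<O> x)"
  by (simp add: J_at_def)

lemma holo_mero: "x \<in> carrier V \<Longrightarrow> a \<in> carrier (\<O> x) \<Longrightarrow> a \<in> carrier (\<M> x)"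
  using subringE(1)[OF subring_holo] by blast

lemma J_at_mult:
  "x \<in> carrier V \<Longrightarrow> r \<in> carrier (\<O> x) \<Longrightarrow> a \<in> J_at x \<Longrightarrow> r \<otimes>\<^bsub>\<M> x\<^esub> a \<in> J_at x"
  using ideal.I_l_closed[OF ideal_J_at, of x a r] by simp

lemma J_at_uminus:
  assumes "x \<in> carrier V" "a \<in> J_at x" shows "\<ominus>\<^bsub>\<M> x\<^esub> a \<in> J_at x"
proof -
  interpret M: cring "\<M> x" using assms(1) by (rule cring_mero_stalk)
  have a: "a \<in> carrier (\<M> x)" using assms by (intro holo_mero J_at_holo)
  have "\<ominus>\<^bsub>\<M> x\<^esub> \<one>\<^bsub>\<M> x\<^esub> \<otimes>\<^bsub>\<M> x\<^esub> a \<in> J_at x"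
    by (intro J_at_mult assms subringE(3,5)[OF subring_holo])
  then show ?thesis using a by (simp add: M.l_minus)
qed

lemma J_at_max:
  assumes x: "x \<in> carrier V" shows "J_at x \<subseteq> max_ideal x"
proof
  fix a assume a: "a \<in> J_at x"
  then obtain f where f: "a = holo_germ V x f" "holo_at V x f" by (auto simp: J_at_def)
  have "holo_at V \<e> (\<lambda>z. f (x \<otimes>\<^bsub>V\<^esub> z))"
    using holo_at_comp[OF holo_map_translation[OF x], of "\<e>" f] f(2) x by simp
  moreover have "untransl x a = holo_germ V \<e> (\<lambda>z. f (x \<otimes>\<^bsub>V\<^esub> z))"
    using pull_holo_germ[OF biholo_translation[OF x], of "\<e>" f] f x by (simp add: untransl_def)
  moreover have "untransl x a \<in> max_ideal \<e>" using a J_e_max by (auto simp: J_at_def)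
  ultimately have "f (x \<otimes>\<^bsub>V\<^esub> \<e>) = 0" using max_idealD by metis
  then show "a \<in> max_ideal x" using f x by (auto simp: max_ideal_def)
qed

lemma gact_J_at:
  assumes "g \<in> carrier G" "x \<in> carrier V" "a \<in> J_at x"
  shows "gact G V \<alpha> g x a \<in> J_at (\<alpha> g x)"
  using assms holo_mero[OF assms(2)] gact_holo[OF assms(1,2)] gact_J_e[OF assms(1)]
    untransl_gact[OF assms(1,2)]
  by (simp add: J_at_def del: holo_stalk_simps)

text \<open>Translating back to \<open>e\<close> commutes with the stabilizer of \<open>x\<close>, so that \<open>\<phi>\<^sub>x\<close> identifies the
  fixed germs at \<open>e\<close> and at \<open>x\<close>.\<close>

lemma kernel_ideal_eq:
  assumes x: "x \<in> carrier V"
  shows "\<K> x = fixed_germs G V \<alpha> (stabilizer G \<alpha> x) x \<inter> J_at x"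
proof (intro equalityI subsetI)
  have stab: "g \<in> carrier G" "\<alpha> g x = x" if "g \<in> stabilizer G \<alpha> x" for g
    using that by (auto simp: stabilizer_def)
  fix a assume "a \<in> \<K> x"
  then obtain h where h: "a = transl V x \<e> h" "h \<in> fixed_germs G V \<alpha> (stabilizer G \<alpha> x) \<e>"
    "h \<in> \<J>"
    by (auto simp: kernel_ideal_def)
  have hh: "h \<in> carrier (\<O> \<e>)" "h \<in> carrier (\<M> \<e>)"
    using h(3) J_e_sub holo_mero[OF V.one_closed] by blast+
  have aa: "a \<in> carrier (\<O> x)" "untransl x a = h"
    using transl_holo[OF x hh(1)] untransl_transl[OF x hh(2)] by (simp_all add: h(1) del: holo_stalk_simps)
  have am: "a \<in> carrier (\<M> x)" by (rule holo_mero[OF x aa(1)])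
  have "gact G V \<alpha> g x a = a" if g: "g \<in> stabilizer G \<alpha> x" for g
  proof -
    have "untransl x (gact G V \<alpha> g x a) = untransl x a"
      using untransl_gact[OF stab(1)[OF g] x am] h(2) g by (simp add: stab(2) aa(2) fixed_germs_def)
    moreover have "gact G V \<alpha> g x a \<in> carrier (\<M> x)"
      using gact_closed[OF stab(1)[OF g] x am] stab(2)[OF g] by simp
    ultimately show ?thesis using transl_untransl[OF x] am by metis
  qed
  then show "a \<in> fixed_germs G V \<alpha> (stabilizer G \<alpha> x) x \<inter> J_at x"
    using aa h(3) by (simp add: fixed_germs_def J_at_def del: holo_stalk_simps)
next
  have stab: "g \<in> carrier G" "\<alpha> g x = x" if "g \<in> stabilizer G \<alpha> x" for g
    using that by (auto simp: stabilizer_def)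
  fix a assume a: "a \<in> fixed_germs G V \<alpha> (stabilizer G \<alpha> x) x \<inter> J_at x"
  then have aa: "a \<in> carrier (\<O> x)" "untransl x a \<in> \<J>"
    by (simp_all add: J_at_def del: holo_stalk_simps)
  have am: "a \<in> carrier (\<M> x)" by (rule holo_mero[OF x aa(1)])
  have "gact G V \<alpha> g \<e> (untransl x a) = untransl x a" if g: "g \<in> stabilizer G \<alpha> x" for g
    using untransl_gact[OF stab(1)[OF g] x am] a g by (simp add: stab(2) fixed_germs_def)
  then have "untransl x a \<in> fixed_germs G V \<alpha> (stabilizer G \<alpha> x) \<e> \<inter> \<J>"
    using aa untransl_holo[OF x aa(1)] by (simp add: fixed_germs_def del: holo_stalk_simps)
  then show "a \<in> \<K> x"
    unfolding kernel_ideal_def using transl_untransl[OF x am] by (metis imageI)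
qed

section \<open>Nilpotency of invariant functions vanishing at a point\<close>

lemma invariant_functions_holo: "f \<in> \<H> \<Longrightarrow> holo_on V f (carrier V)"
  by (simp add: invariant_functions_def)

lemma invariant_functions_at: "f \<in> \<H> \<Longrightarrow> x \<in> carrier V \<Longrightarrow> holo_at V x f"
  by (intro holo_at_global invariant_functions_holo)

lemma invariant_functions_act:
  "f \<in> \<H> \<Longrightarrow> g \<in> carrier G \<Longrightarrow> x \<in> carrier V \<Longrightarrow> f (\<alpha> g x) = f x"
proof -
  assume f: "f \<in> \<H>" and gx: "g \<in> carrier G" "x \<in> carrier V"
  then have "f (\<alpha> (inv\<^bsub>G\<^esub> (inv\<^bsub>G\<^esub> g)) x) = f x"
    unfolding invariant_functions_def by blast
  then show ?thesis using gx(1) by simp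
qed

lemma invariant_functionsI:
  assumes "holo_on V f (carrier V)" "\<And>g x. g \<in> carrier G \<Longrightarrow> x \<in> carrier V \<Longrightarrow> f (\<alpha> g x) = f x"
  shows "f \<in> \<H>"
  using assms by (simp add: invariant_functions_def)

lemma invariant_functions_const: "(\<lambda>_. k) \<in> \<H>"
  by (intro invariant_functionsI holo_on_carrier_const) simp

lemma invariant_functions_add:
  "f \<in> \<H> \<Longrightarrow> f' \<in> \<H> \<Longrightarrow>
    (\<lambda>x. f x + f' x) \<in> \<H>"
  by (intro invariant_functionsI holo_on_add) (simp_all add: invariant_functions_holo invariant_functions_act)

lemma invariant_functions_diff:
  "f \<in> \<H> \<Longrightarrow> f' \<in> \<H> \<Longrightarrow>
    (\<lambda>x. f x - f' x) \<in> \<H>"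
  by (intro invariant_functionsI holo_on_diff) (simp_all add: invariant_functions_holo invariant_functions_act)

lemma invariant_functions_mult:
  "f \<in> \<H> \<Longrightarrow> f' \<in> \<H> \<Longrightarrow>
    (\<lambda>x. f x * f' x) \<in> \<H>"
  by (intro invariant_functionsI holo_on_mult) (simp_all add: invariant_functions_holo invariant_functions_act)

lemma invariant_functions_power:
  "f \<in> \<H> \<Longrightarrow> (\<lambda>x. f x ^ k) \<in> \<H>"
  by (intro invariant_functionsI holo_on_power) (simp_all add: invariant_functions_holo invariant_functions_act)

lemma invariant_functions_sum:
  "(\<And>i. i \<in> I \<Longrightarrow> f i \<in> \<H>) \<Longrightarrow>
    (\<lambda>x. \<Sum>i\<in>I. f i x) \<in> \<H>"
  by (intro invariant_functionsI holo_on_sum) (simp_all add: invariant_functions_holo invariant_functions_act)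

lemma holo_on_coeff_prod:
  assumes "finite S" "\<And>g. g \<in> S \<Longrightarrow> holo_on V (f g) (carrier V)"
  shows "holo_on V (\<lambda>z. poly.coeff (\<Prod>g\<in>S. [:- f g z, 1:]) k) (carrier V)"
  using assms
proof (induction S arbitrary: k rule: finite_induct)
  case empty
  then show ?case by (simp add: holo_on_carrier_const)
next
  case (insert g S)
  have "poly.coeff (\<Prod>g\<in>insert g S. [:- f g z, 1:]) k = - f g z * poly.coeff (\<Prod>g\<in>S. [:- f g z, 1:]) k +
      (case k of 0 \<Rightarrow> 0 | Suc j \<Rightarrow> poly.coeff (\<Prod>g\<in>S. [:- f g z, 1:]) j)" for z
    using insert(1,2) by (simp add: mult_pCons_left coeff_pCons split: nat.split)
  moreover have "holo_on V (\<lambda>z. case k of 0 \<Rightarrow> 0 | Suc j \<Rightarrow> poly.coeff (\<Prod>g\<in>S. [:- f g z, 1:]) j) (carrier V)"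
    using insert by (cases k) (simp_all add: holo_on_carrier_const)
  ultimately show ?case
    using insert by (simp only:) (intro holo_on_add holo_on_mult holo_on_uminus, auto)
qed

text \<open>A function \<open>u\<close> vanishing at \<open>e\<close> is a root of the monic polynomial \<open>\<Prod>\<^sub>g (X - u \<circ> g)\<close>. Its
  coefficients are \<open>G\<close>-invariant, and all but the leading one vanish at \<open>e\<close>, so that
  \<open>u\<^bsup>|G|\<^esup>\<close> is a combination of generators of \<open>\<J>\<close>.\<close>

lemma power_in_J_e:
  assumes u: "holo_on V u (carrier V)" "u \<e> = 0"
  shows "holo_germ V \<e> (\<lambda>z. u z ^ card (carrier G)) \<in> \<J>"
proof -
  let ?n = "card (carrier G)"
  define P where "P z = (\<Prod>g\<in>carrier G. [:- u (\<alpha> g z), 1:])" for z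
  have hol: "holo_on V (\<lambda>z. poly.coeff (P z) k) (carrier V)" for k
    unfolding P_def using biholo_act u(1)
    by (intro holo_on_coeff_prod[OF finite_G]) (simp add: holo_on_comp biholo_def)
  have inv: "P (\<alpha> h z) = P z" if "h \<in> carrier G" "z \<in> carrier V" for h z
  proof -
    have bij: "bij_betw (\<lambda>g. g \<otimes>\<^bsub>G\<^esub> h) (carrier G) (carrier G)"
      using that(1) by (intro bij_betwI[of _ _ _ "\<lambda>g. g \<otimes>\<^bsub>G\<^esub> inv\<^bsub>G\<^esub> h"]) (auto simp: G.m_assoc)
    have "P (\<alpha> h z) = (\<Prod>g\<in>carrier G. [:- u (\<alpha> (g \<otimes>\<^bsub>G\<^esub> h) z), 1:])"
      unfolding P_def using that by (intro prod.cong) (simp_all add: act_mult)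
    also have "\<dots> = P z"
      unfolding P_def using prod.reindex_bij_betw[OF bij, of "\<lambda>g. [:- u (\<alpha> g z), 1:]"] .
    finally show ?thesis .
  qed
  have P_one: "P \<e> = Polynomial.monom 1 ?n"
  proof -
    have "P \<e> = (\<Prod>g\<in>carrier G. [:0, 1:])"
      unfolding P_def using u(2) by (intro prod.cong) (simp_all add: act_V_one)
    then show ?thesis by (simp add: monom_altdef)
  qed
  have deg: "Polynomial.degree (P z) = ?n" "poly.coeff (P z) ?n = 1" for z
  proof -
    show *: "Polynomial.degree (P z) = ?n"
      unfolding P_def by (subst degree_prod_eq_sum_degree) (simp_all)
    have "lead_coeff (P z) = 1" unfolding P_def by (subst lead_coeff_prod) simp
    then show "poly.coeff (P z) ?n = 1" by (simp add: *)
  qed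
  have root: "poly (P z) (u z) = 0" if "z \<in> carrier V" for z
    unfolding P_def poly_prod using finite_G that
    by (intro prod_zero bexI[of _ "\<one>\<^bsub>G\<^esub>"]) (simp_all add: act_one)
  have expand: "u z ^ ?n = (\<Sum>k<?n. - (u z ^ k) * poly.coeff (P z) k)" if "z \<in> carrier V" for z
  proof -
    have "poly (P z) (u z) = (\<Sum>k\<le>?n. poly.coeff (P z) k * u z ^ k)"
      using deg(1)[of z] by (simp add: poly_altdef)
    also have "\<dots> = (\<Sum>k<?n. poly.coeff (P z) k * u z ^ k) + u z ^ ?n"
      by (simp add: lessThan_Suc_atMost[symmetric] deg(2))
    finally show ?thesis using root[OF that]
      by (simp add: add_eq_0_iff sum_negf mult.commute)
  qed
  interpret J: ideal "\<J>" "\<O> \<e>" by (rule ideal_J_e)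
  have at: "holo_at V \<e> f" if "holo_on V f (carrier V)" for f
    using that by (intro holo_at_global) simp_all
  have coeff: "holo_germ V \<e> (\<lambda>z. poly.coeff (P z) k) \<in> \<J>" if "k < ?n" for k
  proof -
    have "gact G V \<alpha> g \<e> (holo_germ V \<e> (\<lambda>z. poly.coeff (P z) k)) = holo_germ V \<e> (\<lambda>z. poly.coeff (P z) k)"
      if g: "g \<in> carrier G" for g
    proof -
      have "pull V (\<alpha> (inv\<^bsub>G\<^esub> g)) \<e> (holo_germ V \<e> (\<lambda>z. poly.coeff (P z) k)) =
          holo_germ V \<e> (\<lambda>z. poly.coeff (P (\<alpha> (inv\<^bsub>G\<^esub> g) z)) k)"
        using pull_holo_germ[OF biholo_act, of "inv\<^bsub>G\<^esub> g" "\<e>" "\<lambda>z. poly.coeff (P z) k"] g at[OF hol[of k]]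
        by (simp add: act_V_one)
      also have "\<dots> = holo_germ V \<e> (\<lambda>z. poly.coeff (P z) k)"
      proof (subst holo_germ_eq_iff)
        show "holo_at V \<e> (\<lambda>z. poly.coeff (P (\<alpha> (inv\<^bsub>G\<^esub> g) z)) k)"
          using holo_on_comp[OF _ hol[of k], of "\<alpha> (inv\<^bsub>G\<^esub> g)"] biholo_act[of "inv\<^bsub>G\<^esub> g"] g
          by (intro at) (simp add: biholo_def)
        show "\<forall>\<^sub>F z in nhdsin (topo V) \<e>. poly.coeff (P (\<alpha> (inv\<^bsub>G\<^esub> g) z)) k = poly.coeff (P z) k"
          using eventually_in_carrier[of "\<e>"] by eventually_elim (simp add: inv g)
      qed (rule at[OF hol])
      finally show ?thesis using g by (simp add: gact_def act_V_one)
    qed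
    moreover have "poly.coeff (P \<e>) k = 0" using \<open>k < ?n\<close> by (simp add: P_one)
    ultimately have "holo_germ V \<e> (\<lambda>z. poly.coeff (P z) k) \<in> J_gen"
      using at[OF hol[of k]] by (auto simp: fixed_germs_def)
    then show ?thesis using J_gen_J_e by blast
  qed
  have "holo_germ V \<e> (\<lambda>z. \<Sum>k<m. - (u z ^ k) * poly.coeff (P z) k) \<in> \<J>" if "m \<le> ?n" for m
    using that
  proof (induction m)
    case 0
    then show ?case using additive_subgroup.zero_closed[OF J.is_additive_subgroup] by (simp add: mero_stalk_simps)
  next
    case (Suc m)
    have hm: "holo_on V (\<lambda>z. - (u z ^ m)) (carrier V)" by (intro holo_on_uminus holo_on_power u)
    have hs: "holo_on V (\<lambda>z. \<Sum>k<m. - (u z ^ k) * poly.coeff (P z) k) (carrier V)"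
      by (intro holo_on_sum holo_on_mult holo_on_uminus holo_on_power u hol)
    have "holo_germ V \<e> (\<lambda>z. - (u z ^ m)) \<otimes>\<^bsub>\<O> \<e>\<^esub> holo_germ V \<e> (\<lambda>z. poly.coeff (P z) m) \<in> \<J>"
      using Suc.prems at[OF hm] by (intro J.I_l_closed coeff) auto
    then have "holo_germ V \<e> (\<lambda>z. - (u z ^ m) * poly.coeff (P z) m) \<in> \<J>"
      using holo_germ_mult[OF at[OF hm] at[OF hol[of m]]] by simp
    then have "holo_germ V \<e> (\<lambda>z. \<Sum>k<m. - (u z ^ k) * poly.coeff (P z) k) \<oplus>\<^bsub>\<O> \<e>\<^esub>
        holo_germ V \<e> (\<lambda>z. - (u z ^ m) * poly.coeff (P z) m) \<in> \<J>"
      using Suc by (intro additive_subgroup.a_closed[OF J.is_additive_subgroup]) simp_all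
    then show ?case
      using holo_germ_add[OF at[OF hs] at[OF holo_on_mult[OF hm hol[of m]]]] by simp
  qed
  from this[of ?n] have "holo_germ V \<e> (\<lambda>z. \<Sum>k<?n. - (u z ^ k) * poly.coeff (P z) k) \<in> \<J>" by simp
  moreover have "holo_germ V \<e> (\<lambda>z. u z ^ ?n) = holo_germ V \<e> (\<lambda>z. \<Sum>k<?n. - (u z ^ k) * poly.coeff (P z) k)"
  proof (subst holo_germ_eq_iff)
    show "holo_at V \<e> (\<lambda>z. u z ^ ?n)" by (intro at holo_on_power u)
    show "holo_at V \<e> (\<lambda>z. \<Sum>k<?n. - (u z ^ k) * poly.coeff (P z) k)"
      by (intro at holo_on_sum holo_on_mult holo_on_uminus holo_on_power u hol)
    show "\<forall>\<^sub>F z in nhdsin (topo V) \<e>. u z ^ ?n = (\<Sum>k<?n. - (u z ^ k) * poly.coeff (P z) k)"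
      using eventually_in_carrier[of "\<e>"] by eventually_elim (rule expand)
  qed
  ultimately show ?thesis by simp
qed

lemma power_in_J_at:
  assumes f: "holo_on V f (carrier V)" "f x = 0" and x: "x \<in> carrier V"
  shows "holo_germ V x (\<lambda>z. f z ^ card (carrier G)) \<in> J_at x"
proof -
  have hol: "holo_at V x (\<lambda>z. f z ^ card (carrier G))"
    by (intro holo_at_global holo_on_power f x)
  have "holo_germ V \<e> (\<lambda>z. f (x \<otimes>\<^bsub>V\<^esub> z) ^ card (carrier G)) \<in> \<J>"
    using x f by (intro power_in_J_e holo_on_comp[of "\<lambda>z. x \<otimes>\<^bsub>V\<^esub> z" f] holo_map_translation) simp_all
  moreover have "untransl x (holo_germ V x (\<lambda>z. f z ^ card (carrier G))) =
      holo_germ V \<e> (\<lambda>z. f (x \<otimes>\<^bsub>V\<^esub> z) ^ card (carrier G))"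
    using pull_holo_germ[OF biholo_translation[OF x], of "\<e>" "\<lambda>z. f z ^ card (carrier G)"] hol x
    by (simp add: untransl_def)
  ultimately show ?thesis using hol by (auto simp: J_at_def)
qed

section \<open>Invariant families of germs and their classes\<close>

abbreviation fixed :: "'a \<Rightarrow> 'a mgerm set" where
  "fixed x \<equiv> fixed_germs G V \<alpha> (stabilizer G \<alpha> x) x"

lemma stabilizerD: "g \<in> stabilizer G \<alpha> x \<Longrightarrow> g \<in> carrier G \<and> \<alpha> g x = x"
  by (simp add: stabilizer_def)

lemma mero_stalk_subgroupI:
  assumes "x \<in> carrier V" "H \<subseteq> carrier (\<M> x)" "\<zero>\<^bsub>\<M> x\<^esub> \<in> H"
    and "\<And>a b. a \<in> H \<Longrightarrow> b \<in> H \<Longrightarrow> a \<oplus>\<^bsub>\<M> x\<^esub> b \<in> H"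
    and "\<And>a. a \<in> H \<Longrightarrow> \<ominus>\<^bsub>\<M> x\<^esub> a \<in> H"
  shows "abelian_subgroup H (\<M> x)"
proof -
  interpret M: cring "\<M> x" using assms(1) by (rule cring_mero_stalk)
  have "subgroup H (add_monoid (\<M> x))"
    using assms(2-5) by (intro M.add.subgroupI) auto
  then show ?thesis
    by (intro abelian_subgroupI3 additive_subgroupI M.abelian_group_axioms)
qed

lemma subgroup_fixed:
  assumes x: "x \<in> carrier V" shows "abelian_subgroup (fixed x) (\<M> x)"
proof -
  have hom: "ring_hom_cring (\<M> x) (\<M> x) (gact G V \<alpha> g x)"
    if "g \<in> stabilizer G \<alpha> x" for g
    using gact_ring_hom[of g x] stabilizerD[OF that] x by simp
  have mero: "a \<in> carrier (\<M> x)" if "a \<in> fixed x" for a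
    using that holo_mero[OF x] by (simp add: fixed_germs_def del: holo_stalk_simps)
  show ?thesis
  proof (rule mero_stalk_subgroupI[OF x])
    show "fixed x \<subseteq> carrier (\<M> x)" using mero by blast
    show "\<zero>\<^bsub>\<M> x\<^esub> \<in> fixed x"
      using ring_hom_cring.hom_zero[OF hom] subringE(2)[OF subring_holo[OF x]]
      by (simp add: fixed_germs_def del: holo_stalk_simps)
  next
    fix a b assume ab: "a \<in> fixed x" "b \<in> fixed x"
    then have "a \<oplus>\<^bsub>\<M> x\<^esub> b \<in> carrier (\<O> x)"
      by (intro subringE(7)[OF subring_holo[OF x]]) (simp_all add: fixed_germs_def del: holo_stalk_simps)
    moreover have "gact G V \<alpha> g x (a \<oplus>\<^bsub>\<M> x\<^esub> b) = a \<oplus>\<^bsub>\<M> x\<^esub> b"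
      if "g \<in> stabilizer G \<alpha> x" for g
      using ring_hom_add[OF ring_hom_cring.homh[OF hom[OF that]] mero[OF ab(1)] mero[OF ab(2)]] ab that
      by (simp add: fixed_germs_def)
    ultimately show "a \<oplus>\<^bsub>\<M> x\<^esub> b \<in> fixed x" by (simp add: fixed_germs_def del: holo_stalk_simps)
  next
    fix a assume a: "a \<in> fixed x"
    then have "\<ominus>\<^bsub>\<M> x\<^esub> a \<in> carrier (\<O> x)"
      by (intro subringE(5)[OF subring_holo[OF x]]) (simp add: fixed_germs_def del: holo_stalk_simps)
    moreover have "gact G V \<alpha> g x (\<ominus>\<^bsub>\<M> x\<^esub> a) = \<ominus>\<^bsub>\<M> x\<^esub> a"
      if "g \<in> stabilizer G \<alpha> x" for g
      using ring_hom_cring.hom_a_inv[OF hom[OF that] mero[OF a]] a that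
      by (simp add: fixed_germs_def)
    ultimately show "\<ominus>\<^bsub>\<M> x\<^esub> a \<in> fixed x" by (simp add: fixed_germs_def del: holo_stalk_simps)
  qed
qed

lemma fixed_mero: "x \<in> carrier V \<Longrightarrow> a \<in> fixed x \<Longrightarrow> a \<in> carrier (\<M> x)"
  using holo_mero by (simp add: fixed_germs_def del: holo_stalk_simps)

lemma subgroup_kernel_ideal:
  assumes x: "x \<in> carrier V" shows "abelian_subgroup (\<K> x) (\<M> x)"
proof -
  interpret F: abelian_subgroup "fixed x" "\<M> x" using x by (rule subgroup_fixed)
  show ?thesis unfolding kernel_ideal_eq[OF x]
    by (rule mero_stalk_subgroupI[OF x])
      (use x J_at_zero J_at_add J_at_uminus fixed_mero in auto)
qed

lemma r_coset_invariant_stalk: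
  "K +>\<^bsub>invariant_stalk G V \<alpha> x\<^esub> a = K +>\<^bsub>\<M> x\<^esub> a"
  "set_add (invariant_stalk G V \<alpha> x) = set_add (\<M> x)"
  by (simp_all add: invariant_stalk_def holo_stalk_def a_r_coset_def r_coset_def set_add_def set_mult_def fun_eq_iff)

lemma E_stalk_simps:
  "carrier (E_stalk G V \<alpha> x) = (\<lambda>a. \<K> x +>\<^bsub>\<M> x\<^esub> a) ` fixed x"
  "\<zero>\<^bsub>E_stalk G V \<alpha> x\<^esub> = \<K> x"
  "\<one>\<^bsub>E_stalk G V \<alpha> x\<^esub> = \<K> x +>\<^bsub>\<M> x\<^esub> \<one>\<^bsub>\<M> x\<^esub>"
  "A \<oplus>\<^bsub>E_stalk G V \<alpha> x\<^esub> B = A <+>\<^bsub>\<M> x\<^esub> B"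
proof -
  have "carrier (E_stalk G V \<alpha> x) =
      (\<lambda>a. \<K> x +>\<^bsub>invariant_stalk G V \<alpha> x\<^esub> a) ` carrier (invariant_stalk G V \<alpha> x)"
    by (auto simp: E_stalk_def FactRing_def A_RCOSETS_def RCOSETS_def a_r_coset_def)
  then show "carrier (E_stalk G V \<alpha> x) = (\<lambda>a. \<K> x +>\<^bsub>\<M> x\<^esub> a) ` fixed x"
    unfolding r_coset_invariant_stalk by (simp add: invariant_stalk_def)
  have "\<one>\<^bsub>E_stalk G V \<alpha> x\<^esub> = \<K> x +>\<^bsub>invariant_stalk G V \<alpha> x\<^esub> \<one>\<^bsub>invariant_stalk G V \<alpha> x\<^esub>"
    by (simp add: E_stalk_def FactRing_def)
  then show "\<one>\<^bsub>E_stalk G V \<alpha> x\<^esub> = \<K> x +>\<^bsub>\<M> x\<^esub> \<one>\<^bsub>\<M> x\<^esub>"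
    unfolding r_coset_invariant_stalk by (simp add: invariant_stalk_def)
qed (simp_all add: E_stalk_def FactRing_def r_coset_invariant_stalk)

text \<open>For germs fixed by the stabilizer, congruence modulo \<open>\<K> x\<close> is congruence modulo the larger
  \<open>J_at x\<close>, which is an ideal of all of \<open>\<O> x\<close>.\<close>

lemma coset_eq_iff:
  assumes "x \<in> carrier V" "a \<in> fixed x" "b \<in> fixed x"
  shows "\<K> x +>\<^bsub>\<M> x\<^esub> a = \<K> x +>\<^bsub>\<M> x\<^esub> b \<longleftrightarrow>
    a \<ominus>\<^bsub>\<M> x\<^esub> b \<in> J_at x"
proof -
  interpret K: abelian_subgroup "\<K> x" "\<M> x"
    using assms(1) by (rule subgroup_kernel_ideal)
  interpret F: abelian_subgroup "fixed x" "\<M> x" using assms(1) by (rule subgroup_fixed)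
  interpret M: cring "\<M> x" using assms(1) by (rule cring_mero_stalk)
  note ab = fixed_mero[OF assms(1,2)] fixed_mero[OF assms(1,3)]
  have "a \<ominus>\<^bsub>\<M> x\<^esub> b \<in> fixed x"
    unfolding a_minus_def using assms by (intro F.a_closed F.a_inv_closed)
  then have "a \<ominus>\<^bsub>\<M> x\<^esub> b \<in> J_at x \<longleftrightarrow> a \<ominus>\<^bsub>\<M> x\<^esub> b \<in> \<K> x"
    by (simp add: kernel_ideal_eq assms(1))
  also have "\<dots> \<longleftrightarrow> a \<in> \<K> x +>\<^bsub>\<M> x\<^esub> b"
    using K.a_rcos_module_minus[OF M.ring_axioms ab(2) ab(1)] by simp
  also have "\<dots> \<longleftrightarrow> \<K> x +>\<^bsub>\<M> x\<^esub> a = \<K> x +>\<^bsub>\<M> x\<^esub> b"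
    using K.a_repr_independence'[of a b] K.a_rcos_self[of a] ab by auto
  finally show ?thesis by simp
qed

definition stable :: "'a set \<Rightarrow> bool" where
  "stable W \<longleftrightarrow> W \<subseteq> carrier V \<and> (\<forall>g\<in>carrier G. \<forall>x\<in>W. \<alpha> g x \<in> W)"

lemma stable_iff:
  assumes "stable W" "g \<in> carrier G" "x \<in> carrier V" shows "\<alpha> g x \<in> W \<longleftrightarrow> x \<in> W"
  using assms act_inv(1)[OF assms(2,3)] G.inv_closed[OF assms(2)] by (metis stable_def)

definition equivariant :: "'a germ_family \<Rightarrow> bool" where
  "equivariant F \<longleftrightarrow> F \<in> carrier (\<F>) \<and> (\<forall>x\<in>carrier V. F x \<in> carrier (\<O> x)) \<and>
     (\<forall>g\<in>carrier G. \<forall>x\<in>carrier V. F (\<alpha> g x) = gact G V \<alpha> g x (F x))"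

lemma equivariant_carrier: "equivariant F \<Longrightarrow> F \<in> carrier (\<F>)"
  by (simp add: equivariant_def)

lemma equivariant_holo: "equivariant F \<Longrightarrow> x \<in> carrier V \<Longrightarrow> F x \<in> carrier (\<O> x)"
  by (simp add: equivariant_def)

lemma equivariant_mero: "equivariant F \<Longrightarrow> x \<in> carrier V \<Longrightarrow> F x \<in> carrier (\<M> x)"
  by (intro family_mem equivariant_carrier)

lemma equivariant_act:
  "equivariant F \<Longrightarrow> g \<in> carrier G \<Longrightarrow> x \<in> carrier V \<Longrightarrow> F (\<alpha> g x) = gact G V \<alpha> g x (F x)"
  by (simp add: equivariant_def)

lemma equivariant_fixed: "equivariant F \<Longrightarrow> x \<in> carrier V \<Longrightarrow> F x \<in> fixed x"
  using equivariant_act[of F _ x] equivariant_holo[of F x]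
  by (simp add: fixed_germs_def stabilizer_def del: holo_stalk_simps) metis

lemma gact_family_invariant_iff:
  assumes F: "F \<in> carrier (\<F>)"
  shows "(\<forall>g\<in>carrier G. gact_family G V \<alpha> g F = F) \<longleftrightarrow>
    (\<forall>g\<in>carrier G. \<forall>x\<in>carrier V. F (\<alpha> g x) = gact G V \<alpha> g x (F x))"
proof (intro iffI ballI)
  fix g x assume inv: "\<forall>g\<in>carrier G. gact_family G V \<alpha> g F = F" and gx: "g \<in> carrier G" "x \<in> carrier V"
  then have "F (\<alpha> g x) = gact_family G V \<alpha> g F (\<alpha> g x)" by simp
  then show "F (\<alpha> g x) = gact G V \<alpha> g x (F x)"
    using gx by (simp add: gact_family_def act_closed act_inv)
next
  fix g assume eq: "\<forall>g\<in>carrier G. \<forall>x\<in>carrier V. F (\<alpha> g x) = gact G V \<alpha> g x (F x)" and g: "g \<in> carrier G"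
  show "gact_family G V \<alpha> g F = F"
  proof
    fix x
    show "gact_family G V \<alpha> g F x = F x"
    proof (cases "x \<in> carrier V")
      case True
      then have "gact G V \<alpha> g (\<alpha> (inv\<^bsub>G\<^esub> g) x) (F (\<alpha> (inv\<^bsub>G\<^esub> g) x)) = F (\<alpha> g (\<alpha> (inv\<^bsub>G\<^esub> g) x))"
        using eq g by (simp add: act_closed)
      then show ?thesis using True g by (simp add: gact_family_def act_inv)
    next
      case False
      then show ?thesis
        using PiE_arb[OF F[unfolded family_ring_simps(1)] False] by (simp add: gact_family_def)
    qed
  qed
qed

lemma invariant_germs_iff:
  "F \<in> \<I> W \<longleftrightarrow> equivariant F \<and>
     finite {x\<in>carrier V. F x \<noteq> \<zero>\<^bsub>\<M> x\<^esub>} \<and>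
     (\<forall>x\<in>carrier V - W. F x = \<zero>\<^bsub>\<M> x\<^esub>)"
  unfolding invariant_germs_def equivariant_def using gact_family_invariant_iff by blast

lemma invariant_germs_equivariant: "F \<in> \<I> W \<Longrightarrow> equivariant F"
  by (simp add: invariant_germs_iff)

lemma equivariant_add:
  assumes "equivariant F" "equivariant F'" shows "equivariant (F \<oplus>\<^bsub>\<F>\<^esub> F')"
  unfolding equivariant_def
proof (intro conjI ballI)
  show "F \<oplus>\<^bsub>\<F>\<^esub> F' \<in> carrier (\<F>)"
    by (intro \<F>.a_closed equivariant_carrier assms)
  fix x assume x: "x \<in> carrier V"
  show "(F \<oplus>\<^bsub>\<F>\<^esub> F') x \<in> carrier (\<O> x)"
    using subringE(7)[OF subring_holo[OF x]] equivariant_holo[OF assms(1) x] equivariant_holo[OF assms(2) x] x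
    by (simp add: family_ring_simps(4) del: holo_stalk_simps)
  fix g assume g: "g \<in> carrier G"
  show "(F \<oplus>\<^bsub>\<F>\<^esub> F') (\<alpha> g x) = gact G V \<alpha> g x ((F \<oplus>\<^bsub>\<F>\<^esub> F') x)"
    using ring_hom_add[OF ring_hom_cring.homh[OF gact_ring_hom[OF g x]]
        equivariant_mero[OF assms(1) x] equivariant_mero[OF assms(2) x]] x g assms
    by (simp add: family_ring_simps(4) act_closed equivariant_act)
qed

lemma equivariant_mult:
  assumes "equivariant F" "equivariant F'" shows "equivariant (F \<otimes>\<^bsub>\<F>\<^esub> F')"
  unfolding equivariant_def
proof (intro conjI ballI)
  show "F \<otimes>\<^bsub>\<F>\<^esub> F' \<in> carrier (\<F>)"
    by (intro \<F>.m_closed equivariant_carrier assms)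
  fix x assume x: "x \<in> carrier V"
  show "(F \<otimes>\<^bsub>\<F>\<^esub> F') x \<in> carrier (\<O> x)"
    using subringE(6)[OF subring_holo[OF x]] equivariant_holo[OF assms(1) x] equivariant_holo[OF assms(2) x] x
    by (simp add: family_ring_simps(5) del: holo_stalk_simps)
  fix g assume g: "g \<in> carrier G"
  show "(F \<otimes>\<^bsub>\<F>\<^esub> F') (\<alpha> g x) = gact G V \<alpha> g x ((F \<otimes>\<^bsub>\<F>\<^esub> F') x)"
    using ring_hom_mult[OF ring_hom_cring.homh[OF gact_ring_hom[OF g x]]
        equivariant_mero[OF assms(1) x] equivariant_mero[OF assms(2) x]] x g assms
    by (simp add: family_ring_simps(5) act_closed equivariant_act)
qed

lemma equivariant_holo_function:
  assumes f: "f \<in> \<H>" shows "equivariant (holo_function V f)"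
  unfolding equivariant_def
proof (intro conjI ballI)
  note hol = invariant_functions_holo[OF f] and at = invariant_functions_at[OF f]
  show "holo_function V f \<in> carrier (\<F>)" by (rule holo_function_closed[OF hol])
  fix x assume x: "x \<in> carrier V"
  show "holo_function V f x \<in> carrier (\<O> x)"
    using at[OF x] x by (auto simp: holo_function_apply)
  fix g assume g: "g \<in> carrier G"
  have gx: "\<alpha> g x \<in> carrier V" using g x by (rule act_closed)
  have "gact G V \<alpha> g x (holo_germ V x f) = holo_germ V (\<alpha> g x) (\<lambda>z. f (\<alpha> (inv\<^bsub>G\<^esub> g) z))"
    using pull_holo_germ[OF biholo_act gx, of "inv\<^bsub>G\<^esub> g" f] at[OF x] g x by (simp add: gact_def act_inv)
  also have "\<dots> = holo_germ V (\<alpha> g x) f"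
  proof (subst holo_germ_eq_iff)
    show "holo_at V (\<alpha> g x) (\<lambda>z. f (\<alpha> (inv\<^bsub>G\<^esub> g) z))"
      using holo_at_comp[of "\<alpha> (inv\<^bsub>G\<^esub> g)" "\<alpha> g x" f] biholo_act[of "inv\<^bsub>G\<^esub> g"] g gx x at[OF x]
      by (simp add: biholo_def act_inv)
    show "\<forall>\<^sub>F z in nhdsin (topo V) (\<alpha> g x). f (\<alpha> (inv\<^bsub>G\<^esub> g) z) = f z"
      using eventually_in_carrier by eventually_elim (simp add: invariant_functions_act f g)
  qed (rule at[OF gx])
  finally show "holo_function V f (\<alpha> g x) = gact G V \<alpha> g x (holo_function V f x)"
    using x gx by (simp add: holo_function_apply)
qed

lemma equivariant_zero: "equivariant \<zero>\<^bsub>\<F>\<^esub>"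
  using equivariant_holo_function[OF invariant_functions_const[of 0]] by (simp add: holo_function_zero)

lemma equivariant_uminus: "equivariant F \<Longrightarrow> equivariant (\<ominus>\<^bsub>\<F>\<^esub> F)"
  by (simp add: family_uminus_eq equivariant_carrier equivariant_mult equivariant_holo_function
      invariant_functions_const)

text \<open>\<open>\<Oplus>\<^sub>x \<O>\<^sub>x\<close>, where \<open>x\<close> runs through \<open>W\<close>; the invariant families are its \<open>G\<close>-invariants.\<close>

definition holo_sum :: "'a set \<Rightarrow> 'a germ_family set" where
  "holo_sum W = {F \<in> carrier (\<F>). (\<forall>x\<in>carrier V. F x \<in> carrier (\<O> x)) \<and>
     finite {x\<in>carrier V. F x \<noteq> \<zero>\<^bsub>\<M> x\<^esub>} \<and>
     (\<forall>x\<in>carrier V - W. F x = \<zero>\<^bsub>\<M> x\<^esub>)}"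

lemma holo_sum_carrier: "F \<in> holo_sum W \<Longrightarrow> F \<in> carrier (\<F>)"
  by (simp add: holo_sum_def)

lemma holo_sum_add:
  assumes "F \<in> holo_sum W" "F' \<in> holo_sum W"
  shows "F \<oplus>\<^bsub>\<F>\<^esub> F' \<in> holo_sum W"
proof -
  have zero: "(F \<oplus>\<^bsub>\<F>\<^esub> F') x = \<zero>\<^bsub>\<M> x\<^esub>"
    if "x \<in> carrier V" "F x = \<zero>\<^bsub>\<M> x\<^esub>" "F' x = \<zero>\<^bsub>\<M> x\<^esub>" for x
    using that cring.cring_simprules(2,8)[OF cring_mero_stalk[OF that(1)]] by (simp add: family_ring_simps(4))
  have "finite ({x\<in>carrier V. F x \<noteq> \<zero>\<^bsub>\<M> x\<^esub>} \<union> {x\<in>carrier V. F' x \<noteq> \<zero>\<^bsub>\<M> x\<^esub>})"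
    using assms by (simp add: holo_sum_def)
  then have "finite {x\<in>carrier V. (F \<oplus>\<^bsub>\<F>\<^esub> F') x \<noteq> \<zero>\<^bsub>\<M> x\<^esub>}"
    by (rule rev_finite_subset) (use zero in blast)
  moreover have "(F \<oplus>\<^bsub>\<F>\<^esub> F') x \<in> carrier (\<O> x)" if "x \<in> carrier V" for x
    using subringE(7)[OF subring_holo[OF that]] assms that
    by (simp add: family_ring_simps(4) holo_sum_def del: holo_stalk_simps)
  ultimately show ?thesis using assms zero by (simp add: holo_sum_def \<F>.a_closed)
qed

lemma holo_sum_mult:
  assumes U: "U \<in> carrier (\<F>)" "\<And>x. x \<in> carrier V \<Longrightarrow> U x \<in> carrier (\<O> x)"
    and F: "F \<in> holo_sum W"
  shows "U \<otimes>\<^bsub>\<F>\<^esub> F \<in> holo_sum W"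
proof -
  have zero: "(U \<otimes>\<^bsub>\<F>\<^esub> F) x = \<zero>\<^bsub>\<M> x\<^esub>"
    if "x \<in> carrier V" "F x = \<zero>\<^bsub>\<M> x\<^esub>" for x
    using that cring.cring_simprules(27)[OF cring_mero_stalk[OF that(1)] family_mem[OF U(1) that(1)]]
    by (simp add: family_ring_simps(5))
  have "finite {x\<in>carrier V. F x \<noteq> \<zero>\<^bsub>\<M> x\<^esub>}"
    using F by (simp add: holo_sum_def)
  then have "finite {x\<in>carrier V. (U \<otimes>\<^bsub>\<F>\<^esub> F) x \<noteq> \<zero>\<^bsub>\<M> x\<^esub>}"
    by (rule rev_finite_subset) (use zero in blast)
  moreover have "(U \<otimes>\<^bsub>\<F>\<^esub> F) x \<in> carrier (\<O> x)" if "x \<in> carrier V" for x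
    using subringE(6)[OF subring_holo[OF that]] U(2)[OF that] F that
    by (simp add: family_ring_simps(5) holo_sum_def del: holo_stalk_simps)
  ultimately show ?thesis
    using F zero \<F>.m_closed[OF U(1) holo_sum_carrier[OF F]] by (simp add: holo_sum_def)
qed

lemma invariant_germs_holo_sum:
  "F \<in> \<I> W \<longleftrightarrow> equivariant F \<and> F \<in> holo_sum W"
  by (auto simp: invariant_germs_iff holo_sum_def equivariant_def)

lemma invariant_germs_zero: "\<zero>\<^bsub>\<F>\<^esub> \<in> \<I> W"
  unfolding invariant_germs_iff by (intro conjI equivariant_zero) (simp_all add: family_ring_simps(3))

lemma holo_sum_zero: "\<zero>\<^bsub>\<F>\<^esub> \<in> holo_sum W"
  using invariant_germs_zero invariant_germs_holo_sum by blast

lemma invariant_germs_add: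
  "F \<in> \<I> W \<Longrightarrow> F' \<in> \<I> W \<Longrightarrow>
    F \<oplus>\<^bsub>\<F>\<^esub> F' \<in> \<I> W"
  by (auto simp: invariant_germs_holo_sum intro: equivariant_add holo_sum_add)

lemma invariant_germs_mult:
  "equivariant U \<Longrightarrow> F \<in> \<I> W \<Longrightarrow> U \<otimes>\<^bsub>\<F>\<^esub> F \<in> \<I> W"
  unfolding invariant_germs_holo_sum
  by (intro conjI equivariant_mult holo_sum_mult equivariant_carrier equivariant_holo) simp_all

lemma invariant_germs_uminus:
  assumes "F \<in> \<I> W" shows "\<ominus>\<^bsub>\<F>\<^esub> F \<in> \<I> W"
  unfolding family_uminus_eq[OF equivariant_carrier[OF invariant_germs_equivariant[OF assms]]]
  by (intro invariant_germs_mult equivariant_holo_function invariant_functions_const assms)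

lemma E_class_apply:
  "x \<in> carrier V \<Longrightarrow> \<E> F x = \<K> x +>\<^bsub>\<M> x\<^esub> F x"
  by (simp add: E_class_def r_coset_invariant_stalk)

lemma E_class_eq_iff:
  assumes "equivariant F" "equivariant F'"
  shows "\<E> F = \<E> F' \<longleftrightarrow>
    (\<forall>x\<in>carrier V. F x \<ominus>\<^bsub>\<M> x\<^esub> F' x \<in> J_at x)"
proof -
  have "\<E> F = \<E> F' \<longleftrightarrow> (\<forall>x\<in>carrier V. \<E> F x = \<E> F' x)"
  proof
    assume "\<forall>x\<in>carrier V. \<E> F x = \<E> F' x"
    then show "\<E> F = \<E> F'"
      unfolding E_class_def by (auto simp: fun_eq_iff restrict_def split: if_splits)
  qed simp
  then show ?thesis using assms by (simp add: E_class_apply coset_eq_iff equivariant_fixed)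
qed

lemma E_class_add:
  assumes "equivariant F" "equivariant F'"
  shows "\<E> (F \<oplus>\<^bsub>\<F>\<^esub> F') = \<E> F \<oplus>\<^bsub>M_module G V \<alpha> W\<^esub> \<E> F'"
proof
  fix x
  show "\<E> (F \<oplus>\<^bsub>\<F>\<^esub> F') x = (\<E> F \<oplus>\<^bsub>M_module G V \<alpha> W\<^esub> \<E> F') x"
  proof (cases "x \<in> carrier V")
    case True
    interpret K: abelian_subgroup "\<K> x" "\<M> x"
      using True by (rule subgroup_kernel_ideal)
    show ?thesis
      using True assms
      by (simp add: M_module_def E_class_apply E_stalk_simps K.a_rcos_sum family_ring_simps(4) equivariant_mero)
  next
    case False
    then show ?thesis by (simp add: M_module_def E_class_def)
  qed
qed

lemma coset_zero:
  assumes "x \<in> carrier V"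
  shows "\<K> x +>\<^bsub>\<M> x\<^esub> \<zero>\<^bsub>\<M> x\<^esub> = \<K> x"
proof -
  interpret K: abelian_subgroup "\<K> x" "\<M> x"
    using assms by (rule subgroup_kernel_ideal)
  show ?thesis using K.a_coset_add_zero[OF K.a_subset] .
qed

lemma E_class_zero: "\<E> \<zero>\<^bsub>\<F>\<^esub> = \<zero>\<^bsub>M_module G V \<alpha> W\<^esub>"
proof
  fix x
  show "\<E> \<zero>\<^bsub>\<F>\<^esub> x = \<zero>\<^bsub>M_module G V \<alpha> W\<^esub> x"
  proof (cases "x \<in> carrier V")
    case True
    then show ?thesis
      using coset_zero[OF True] by (simp add: M_module_def E_class_apply E_stalk_simps family_ring_simps(3))
  next
    case False
    then show ?thesis by (simp add: M_module_def E_class_def)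
  qed
qed

text \<open>A germ fixed by the stabilizer of \<open>x\<close> can be transported to another point of the orbit
  independently of the group element used.\<close>

lemma gact_same:
  assumes "g \<in> carrier G" "h \<in> carrier G" "x \<in> carrier V" "\<alpha> g x = \<alpha> h x" "a \<in> fixed x"
  shows "gact G V \<alpha> g x a = gact G V \<alpha> h x a"
proof -
  let ?k = "inv\<^bsub>G\<^esub> g \<otimes>\<^bsub>G\<^esub> h"
  have k: "?k \<in> stabilizer G \<alpha> x"
    using assms by (simp add: stabilizer_def act_mult flip: assms(4)) (simp add: act_inv)
  then have "gact G V \<alpha> ?k x a = a" using assms(5) by (simp add: fixed_germs_def)
  then have "gact G V \<alpha> g x a = gact G V \<alpha> (g \<otimes>\<^bsub>G\<^esub> ?k) x a"
    using gact_gact[of g ?k x a] assms fixed_mero[OF assms(3,5)] stabilizerD[OF k] by simp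
  then show ?thesis using assms by (simp add: G.m_assoc[symmetric])
qed

lemma gact_fixed:
  assumes "g \<in> carrier G" "x \<in> carrier V" "a \<in> fixed x"
  shows "gact G V \<alpha> g x a \<in> fixed (\<alpha> g x)"
proof -
  have a: "a \<in> carrier (\<M> x)" "a \<in> carrier (\<O> x)"
    using assms fixed_mero by (simp_all add: fixed_germs_def del: holo_stalk_simps)
  have "gact G V \<alpha> h (\<alpha> g x) (gact G V \<alpha> g x a) = gact G V \<alpha> g x a"
    if h: "h \<in> stabilizer G \<alpha> (\<alpha> g x)" for h
    using gact_gact[of h g x a] gact_same[of "h \<otimes>\<^bsub>G\<^esub> g" g x a] assms a stabilizerD[OF h]
    by (simp add: act_mult)
  then show ?thesis using gact_holo[OF assms(1,2) a(2)] by (simp add: fixed_germs_def del: holo_stalk_simps)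
qed

lemma gact_kernel_ideal:
  assumes g: "g \<in> carrier G" and x: "x \<in> carrier V"
  shows "gact G V \<alpha> g x ` \<K> x = \<K> (\<alpha> g x)"
proof -
  have sub: "gact G V \<alpha> h y ` \<K> y \<subseteq> \<K> (\<alpha> h y)"
    if "h \<in> carrier G" "y \<in> carrier V" for h y
    using that gact_fixed gact_J_at by (auto simp: kernel_ideal_eq act_closed)
  show ?thesis
  proof (rule equalityI[OF sub[OF g x]], rule subsetI)
    fix a assume a: "a \<in> \<K> (\<alpha> g x)"
    have gx: "\<alpha> g x \<in> carrier V" using g x by (rule act_closed)
    have am: "a \<in> carrier (\<M> (\<alpha> g x))"
      using a fixed_mero[OF gx] by (simp add: kernel_ideal_eq gx)
    have "gact G V \<alpha> (inv\<^bsub>G\<^esub> g) (\<alpha> g x) a \<in> \<K> (\<alpha> (inv\<^bsub>G\<^esub> g) (\<alpha> g x))"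
      using sub[of "inv\<^bsub>G\<^esub> g" "\<alpha> g x"] a g gx by blast
    moreover have "gact G V \<alpha> g (\<alpha> (inv\<^bsub>G\<^esub> g) (\<alpha> g x)) (gact G V \<alpha> (inv\<^bsub>G\<^esub> g) (\<alpha> g x) a) = a"
      using gact_gact[of g "inv\<^bsub>G\<^esub> g" "\<alpha> g x" a] gact_one[OF gx am] g gx am by simp
    ultimately show "a \<in> gact G V \<alpha> g x ` \<K> x"
      using g x by (simp add: act_inv) (metis imageI)
  qed
qed

lemma gact_coset:
  assumes g: "g \<in> carrier G" and x: "x \<in> carrier V" and a: "a \<in> fixed x"
  shows "gact G V \<alpha> g x ` (\<K> x +>\<^bsub>\<M> x\<^esub> a) =
    \<K> (\<alpha> g x) +>\<^bsub>\<M> (\<alpha> g x)\<^esub> gact G V \<alpha> g x a"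
proof -
  interpret h: ring_hom_cring "\<M> x" "\<M> (\<alpha> g x)" "gact G V \<alpha> g x"
    using g x by (rule gact_ring_hom)
  have K: "k \<in> carrier (\<M> x)" if "k \<in> \<K> x" for k
    using that fixed_mero[OF x] by (simp add: kernel_ideal_eq x)
  show ?thesis
    unfolding gact_kernel_ideal[OF g x, symmetric]
    using K fixed_mero[OF x a] by (force simp: a_r_coset_def r_coset_def)
qed

lemma orbit_act: "g \<in> carrier G \<Longrightarrow> x \<in> carrier V \<Longrightarrow> orbit G \<alpha> (\<alpha> g x) = orbit G \<alpha> x"
proof -
  assume g: "g \<in> carrier G" and x: "x \<in> carrier V"
  have 1: "orbit G \<alpha> (\<alpha> h y) \<subseteq> orbit G \<alpha> y" if "h \<in> carrier G" "y \<in> carrier V" for h y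
    using that by (auto simp: orbit_def act_mult[symmetric])
  from 1[of "inv\<^bsub>G\<^esub> g" "\<alpha> g x"] 1[of g x] show ?thesis
    using g x by (simp add: act_inv act_closed)
qed

lemma stable_orbit: "x \<in> carrier V \<Longrightarrow> stable (orbit G \<alpha> x)"
  by (auto simp: stable_def orbit_def act_closed act_mult[symmetric])

lemma finite_orbit: "finite (orbit G \<alpha> x)"
proof -
  have "orbit G \<alpha> x = (\<lambda>g. \<alpha> g x) ` carrier G" by (auto simp: orbit_def)
  then show ?thesis using finite_G by simp
qed

lemma E_class_in_M:
  assumes F: "F \<in> \<I> W"
  shows "\<E> F \<in> carrier (M_module G V \<alpha> W)"
proof -
  note eqv = invariant_germs_equivariant[OF F]
  have zero: "\<E> F x = \<zero>\<^bsub>E_stalk G V \<alpha> x\<^esub>" if "x \<in> carrier V" "F x = \<zero>\<^bsub>\<M> x\<^esub>" for x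
    using that by (simp add: E_class_apply E_stalk_simps coset_zero)
  have "finite {x\<in>carrier V. F x \<noteq> \<zero>\<^bsub>\<M> x\<^esub>}" using F by (simp add: invariant_germs_iff)
  then have "finite {x\<in>carrier V. \<E> F x \<noteq> \<zero>\<^bsub>E_stalk G V \<alpha> x\<^esub>}"
    by (rule rev_finite_subset) (use zero in blast)
  moreover have "\<E> F \<in> (\<Pi>\<^sub>E x\<in>carrier V. carrier (E_stalk G V \<alpha> x))"
  proof (rule PiE_I)
    show "\<E> F x \<in> carrier (E_stalk G V \<alpha> x)" if "x \<in> carrier V" for x
      using that equivariant_fixed[OF eqv that] by (simp add: E_class_apply E_stalk_simps)
  qed (simp add: E_class_def)
  moreover have "\<forall>x\<in>carrier V - W. \<E> F x = \<zero>\<^bsub>E_stalk G V \<alpha> x\<^esub>"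
    using zero F by (simp add: invariant_germs_iff)
  moreover have "\<forall>g\<in>carrier G. \<forall>x\<in>carrier V. \<E> F (\<alpha> g x) = gact G V \<alpha> g x ` \<E> F x"
    using eqv by (simp add: E_class_apply act_closed gact_coset equivariant_fixed equivariant_act)
  ultimately show ?thesis by (simp add: M_module_def)
qed

text \<open>An element of \<open>M(G, W)\<close> is lifted orbit by orbit: a representative at one point of an orbit,
  fixed by the stabilizer, is transported along the orbit.\<close>

lemma M_lift:
  assumes m: "m \<in> carrier (M_module G V \<alpha> W)" and W: "stable W"
  shows "\<exists>F\<in>\<I> W. \<E> F = m"
proof -
  have m_ext: "m \<in> (\<Pi>\<^sub>E x\<in>carrier V. carrier (E_stalk G V \<alpha> x))"
    and m_fin: "finite {x\<in>carrier V. m x \<noteq> \<zero>\<^bsub>E_stalk G V \<alpha> x\<^esub>}"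
    and m_W: "\<And>x. x \<in> carrier V \<Longrightarrow> x \<notin> W \<Longrightarrow> m x = \<zero>\<^bsub>E_stalk G V \<alpha> x\<^esub>"
    and m_act: "\<And>g x. g \<in> carrier G \<Longrightarrow> x \<in> carrier V \<Longrightarrow> m (\<alpha> g x) = gact G V \<alpha> g x ` m x"
    using m by (auto simp: M_module_def)
  let ?c = "\<lambda>x a. \<K> x +>\<^bsub>\<M> x\<^esub> a"
  \<comment> \<open>\<open>r x\<close> is a representative of the orbit of \<open>x\<close>, the same for all its points, and \<open>k x\<close> carries
    \<open>r x\<close> to \<open>x\<close>. The lift \<open>s\<close> takes the value \<open>0\<close> where \<open>m\<close> does, to keep the support finite.\<close>
  define r where "r x = (SOME y. y \<in> orbit G \<alpha> x)" for x
  have r_orbit: "r x \<in> orbit G \<alpha> x" if "x \<in> carrier V" for x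
    unfolding r_def using act.orbit_refl[OF that] by (rule someI)
  have r_act: "r (\<alpha> g x) = r x" if "g \<in> carrier G" "x \<in> carrier V" for g x
    using that by (simp add: r_def orbit_act)
  have r_mem: "r x \<in> carrier V" if "x \<in> carrier V" for x
    using r_orbit[OF that] that by (auto simp: orbit_def act_closed)
  have "\<forall>x\<in>carrier V. \<exists>g. g \<in> carrier G \<and> \<alpha> g (r x) = x"
  proof
    fix x assume x: "x \<in> carrier V"
    then have "x \<in> orbit G \<alpha> (r x)" using act.orbit_sym r_orbit r_mem by blast
    then show "\<exists>g. g \<in> carrier G \<and> \<alpha> g (r x) = x" by (auto simp: orbit_def)
  qed
  then obtain k where k: "\<And>x. x \<in> carrier V \<Longrightarrow> k x \<in> carrier G \<and> \<alpha> (k x) (r x) = x" by metis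
  have "\<forall>x\<in>carrier V. \<exists>a. a \<in> fixed x \<and> m x = ?c x a \<and>
      (m x = \<zero>\<^bsub>E_stalk G V \<alpha> x\<^esub> \<longrightarrow> a = \<zero>\<^bsub>\<M> x\<^esub>)"
  proof
    fix x assume x: "x \<in> carrier V"
    interpret fx: abelian_subgroup "fixed x" "\<M> x" using x by (rule subgroup_fixed)
    have "m x \<in> carrier (E_stalk G V \<alpha> x)" using m_ext x by (rule PiE_mem)
    then obtain a where "a \<in> fixed x" "m x = ?c x a" by (auto simp: E_stalk_simps)
    moreover have "\<zero>\<^bsub>\<M> x\<^esub> \<in> fixed x"
      by (rule additive_subgroup.zero_closed[OF fx.is_additive_subgroup])
    ultimately show "\<exists>a. a \<in> fixed x \<and> m x = ?c x a \<and>
        (m x = \<zero>\<^bsub>E_stalk G V \<alpha> x\<^esub> \<longrightarrow> a = \<zero>\<^bsub>\<M> x\<^esub>)"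
      using coset_zero[OF x] by (cases "m x = \<zero>\<^bsub>E_stalk G V \<alpha> x\<^esub>") (auto simp: E_stalk_simps)
  qed
  then obtain s where s: "\<And>x. x \<in> carrier V \<Longrightarrow> s x \<in> fixed x"
    "\<And>x. x \<in> carrier V \<Longrightarrow> m x = ?c x (s x)"
    "\<And>x. x \<in> carrier V \<Longrightarrow> m x = \<zero>\<^bsub>E_stalk G V \<alpha> x\<^esub> \<Longrightarrow> s x = \<zero>\<^bsub>\<M> x\<^esub>"
    by metis
  define F where "F = (\<lambda>x\<in>carrier V. gact G V \<alpha> (k x) (r x) (s (r x)))"
  have F_fixed: "F x \<in> fixed x" if "x \<in> carrier V" for x
    using gact_fixed[OF _ r_mem[OF that] s(1)[OF r_mem[OF that]], of "k x"] k[OF that] that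
    by (simp add: F_def)
  have eqv: "equivariant F"
    unfolding equivariant_def
  proof (intro conjI ballI)
    have "gact G V \<alpha> (k x) (r x) (s (r x)) \<in> carrier (\<M> x)" if "x \<in> carrier V" for x
      using fixed_mero[OF that F_fixed[OF that]] that by (simp add: F_def)
    then show "F \<in> carrier (\<F>)"
      unfolding F_def by (rule family_restrict_mem)
    fix x assume x: "x \<in> carrier V"
    show "F x \<in> carrier (\<O> x)"
      using F_fixed[OF x] by (simp add: fixed_germs_def del: holo_stalk_simps)
    fix g assume g: "g \<in> carrier G"
    have gx: "\<alpha> g x \<in> carrier V" using g x by (rule act_closed)
    have "F (\<alpha> g x) = gact G V \<alpha> (k (\<alpha> g x)) (r x) (s (r x))"
      using g x gx by (simp add: F_def r_act)
    also have "\<dots> = gact G V \<alpha> (g \<otimes>\<^bsub>G\<^esub> k x) (r x) (s (r x))"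
      using k[OF gx] k[OF x] g r_mem[OF x] s(1)[OF r_mem[OF x]]
      by (intro gact_same) (simp_all add: act_mult r_act[OF g x])
    also have "\<dots> = gact G V \<alpha> g x (F x)"
      using gact_gact[OF g _ r_mem[OF x] fixed_mero[OF r_mem[OF x] s(1)[OF r_mem[OF x]]], of "k x"] k[OF x] x
      by (simp add: F_def)
    finally show "F (\<alpha> g x) = gact G V \<alpha> g x (F x)" .
  qed
  have zero: "F x = \<zero>\<^bsub>\<M> x\<^esub>" if "x \<in> carrier V" "m (r x) = \<zero>\<^bsub>E_stalk G V \<alpha> (r x)\<^esub>" for x
    using s(3)[OF r_mem[OF that(1)] that(2)] ring_hom_cring.hom_zero[OF gact_ring_hom[OF _ r_mem[OF that(1)]]]
      k[OF that(1)] that(1) by (simp add: F_def)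
  have "finite (\<Union>y\<in>{x\<in>carrier V. m x \<noteq> \<zero>\<^bsub>E_stalk G V \<alpha> x\<^esub>}. orbit G \<alpha> y)"
    using m_fin finite_orbit by blast
  moreover have "{x\<in>carrier V. F x \<noteq> \<zero>\<^bsub>\<M> x\<^esub>} \<subseteq>
      (\<Union>y\<in>{x\<in>carrier V. m x \<noteq> \<zero>\<^bsub>E_stalk G V \<alpha> x\<^esub>}. orbit G \<alpha> y)"
  proof
    fix x assume x: "x \<in> {x\<in>carrier V. F x \<noteq> \<zero>\<^bsub>\<M> x\<^esub>}"
    then have "m (r x) \<noteq> \<zero>\<^bsub>E_stalk G V \<alpha> (r x)\<^esub>" "r x \<in> carrier V" using zero r_mem by auto
    moreover have "x \<in> orbit G \<alpha> (r x)" using x k[of x] by (auto simp: orbit_def)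
    ultimately show "x \<in> (\<Union>y\<in>{x\<in>carrier V. m x \<noteq> \<zero>\<^bsub>E_stalk G V \<alpha> x\<^esub>}. orbit G \<alpha> y)" by blast
  qed
  ultimately have fin: "finite {x\<in>carrier V. F x \<noteq> \<zero>\<^bsub>\<M> x\<^esub>}" by (rule rev_finite_subset)
  have "F x = \<zero>\<^bsub>\<M> x\<^esub>" if "x \<in> carrier V" "x \<notin> W" for x
  proof (rule zero[OF that(1)], rule m_W[OF r_mem[OF that(1)]])
    show "r x \<notin> W" using k[OF that(1)] stable_iff[OF W, of "k x" "r x"] r_mem[OF that(1)] that by simp
  qed
  with eqv fin have F: "F \<in> \<I> W" by (simp add: invariant_germs_iff)
  have "\<E> F = m"
  proof (rule PiE_ext[of _ "carrier V" "\<lambda>x. carrier (E_stalk G V \<alpha> x)"])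
    show "\<E> F \<in> (\<Pi>\<^sub>E x\<in>carrier V. carrier (E_stalk G V \<alpha> x))"
      using E_class_in_M[OF F] by (simp add: M_module_def)
    fix x assume x: "x \<in> carrier V"
    have "m x = m (\<alpha> (k x) (r x))" using k[OF x] by simp
    also have "\<dots> = gact G V \<alpha> (k x) (r x) ` ?c (r x) (s (r x))"
      using m_act[of "k x" "r x"] k[OF x] r_mem[OF x] s(2)[OF r_mem[OF x]] by simp
    also have "\<dots> = ?c x (F x)"
      using gact_coset[OF _ r_mem[OF x] s(1)[OF r_mem[OF x]], of "k x"] k[OF x] x by (simp add: F_def)
    finally show "\<E> F x = m x" using x by (simp add: E_class_apply)
  qed (fact m_ext)
  with F show ?thesis by blast
qed

lemma abelian_group_M:
  assumes W: "stable W" shows "abelian_group (M_module G V \<alpha> W)"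
proof -
  let ?M = "M_module G V \<alpha> W" and ?E = "\<E>"
  note eqv = invariant_germs_equivariant
  note car = equivariant_carrier[OF eqv]
  show ?thesis
  proof (rule abelian_groupI)
    show "\<zero>\<^bsub>?M\<^esub> \<in> carrier ?M" using E_class_in_M[OF invariant_germs_zero, of W] by (simp only: E_class_zero[of W])
    fix m1 m2 m3 assume m: "m1 \<in> carrier ?M" "m2 \<in> carrier ?M" "m3 \<in> carrier ?M"
    obtain F1 F2 F3 where F: "F1 \<in> \<I> W" "m1 = ?E F1"
      "F2 \<in> \<I> W" "m2 = ?E F2" "F3 \<in> \<I> W" "m3 = ?E F3"
      using M_lift[OF m(1) W] M_lift[OF m(2) W] M_lift[OF m(3) W] by auto
    note add = E_class_add[where W=W, symmetric] and e = eqv[OF F(1)] eqv[OF F(3)] eqv[OF F(5)]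
    note c = e[THEN equivariant_carrier]
    show "m1 \<oplus>\<^bsub>?M\<^esub> m2 \<in> carrier ?M"
      using E_class_in_M[OF invariant_germs_add[OF F(1,3)]] by (simp add: F add e)
    show "m1 \<oplus>\<^bsub>?M\<^esub> m2 = m2 \<oplus>\<^bsub>?M\<^esub> m1" by (simp add: F add e c \<F>.a_comm)
    show "m1 \<oplus>\<^bsub>?M\<^esub> m2 \<oplus>\<^bsub>?M\<^esub> m3 = m1 \<oplus>\<^bsub>?M\<^esub> (m2 \<oplus>\<^bsub>?M\<^esub> m3)"
      by (simp add: F add e c equivariant_add \<F>.a_assoc)
    show "\<zero>\<^bsub>?M\<^esub> \<oplus>\<^bsub>?M\<^esub> m1 = m1"
      by (simp add: F(2) E_class_zero[where W=W, symmetric] add e equivariant_zero c)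
    have "?E (\<ominus>\<^bsub>\<F>\<^esub> F1) \<oplus>\<^bsub>?M\<^esub> m1 = \<zero>\<^bsub>?M\<^esub>"
      by (simp add: F(2) E_class_zero[where W=W, symmetric] add e equivariant_uminus c \<F>.l_neg)
    then show "\<exists>m'\<in>carrier ?M. m' \<oplus>\<^bsub>?M\<^esub> m1 = \<zero>\<^bsub>?M\<^esub>"
      using E_class_in_M[OF invariant_germs_uminus[OF F(1)]] by (rule bexI)
  qed
qed

section \<open>The action of the skew-group ring is well defined on classes\<close>

lemma gact_family_ring_hom:
  assumes "g \<in> carrier G"
  shows "ring_hom_cring (\<F>) (\<F>) (gact_family G V \<alpha> g)"
proof -
  have "gact_family G V \<alpha> g = pull_family V (\<alpha> (inv\<^bsub>G\<^esub> g))"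
    using assms by (auto simp: gact_family_def pull_family_def gact_def fun_eq_iff act_inv)
  then show ?thesis using assms by (simp add: pull_family_ring_hom biholo_act)
qed

lemma gact_family_closed:
  "g \<in> carrier G \<Longrightarrow> F \<in> carrier (\<F>) \<Longrightarrow> gact_family G V \<alpha> g F \<in> carrier (\<F>)"
  using ring_hom_closed[OF ring_hom_cring.homh[OF gact_family_ring_hom]] .

lemma gact_family_gact_family:
  assumes "g \<in> carrier G" "h \<in> carrier G" "F \<in> carrier (\<F>)"
  shows "gact_family G V \<alpha> g (gact_family G V \<alpha> h F) = gact_family G V \<alpha> (g \<otimes>\<^bsub>G\<^esub> h) F"
proof (rule family_eqI)
  fix x assume x: "x \<in> carrier V"
  let ?y = "\<alpha> (inv\<^bsub>G\<^esub> h) (\<alpha> (inv\<^bsub>G\<^esub> g) x)"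
  have y: "?y \<in> carrier V" "\<alpha> h ?y = \<alpha> (inv\<^bsub>G\<^esub> g) x" using assms x by (simp_all add: act_closed act_inv)
  show "gact_family G V \<alpha> g (gact_family G V \<alpha> h F) x = gact_family G V \<alpha> (g \<otimes>\<^bsub>G\<^esub> h) F x"
    using gact_gact[OF assms(1,2) y(1) family_mem[OF assms(3) y(1)]] assms x y
    by (simp add: gact_family_def act_closed G.inv_mult_group act_mult)
qed (simp_all add: assms gact_family_closed)

lemma holo_sum_gact:
  assumes W: "stable W" and g: "g \<in> carrier G" and F: "F \<in> holo_sum W"
  shows "gact_family G V \<alpha> g F \<in> holo_sum W"
proof -
  let ?h = "\<alpha> (inv\<^bsub>G\<^esub> g)"
  have h: "?h x \<in> carrier V" "\<alpha> g (?h x) = x" if "x \<in> carrier V" for x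
    using that g by (simp_all add: act_closed act_inv)
  have zero: "gact_family G V \<alpha> g F x = \<zero>\<^bsub>\<M> x\<^esub>"
    if x: "x \<in> carrier V" "F (?h x) = \<zero>\<^bsub>\<M> (?h x)\<^esub>" for x
    using ring_hom_cring.hom_zero[OF gact_ring_hom[OF g h(1)[OF x(1)]]] x h(2)[OF x(1)]
    by (simp add: gact_family_def)
  have "finite (\<alpha> g ` {x\<in>carrier V. F x \<noteq> \<zero>\<^bsub>\<M> x\<^esub>})"
    using F by (simp add: holo_sum_def)
  moreover have "{x\<in>carrier V. gact_family G V \<alpha> g F x \<noteq> \<zero>\<^bsub>\<M> x\<^esub>} \<subseteq>
      \<alpha> g ` {x\<in>carrier V. F x \<noteq> \<zero>\<^bsub>\<M> x\<^esub>}"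
  proof
    fix x assume "x \<in> {x\<in>carrier V. gact_family G V \<alpha> g F x \<noteq> \<zero>\<^bsub>\<M> x\<^esub>}"
    then have "x = \<alpha> g (?h x)" "?h x \<in> {x\<in>carrier V. F x \<noteq> \<zero>\<^bsub>\<M> x\<^esub>}"
      using h zero by auto
    then show "x \<in> \<alpha> g ` {x\<in>carrier V. F x \<noteq> \<zero>\<^bsub>\<M> x\<^esub>}" by (rule image_eqI)
  qed
  ultimately have "finite {x\<in>carrier V. gact_family G V \<alpha> g F x \<noteq> \<zero>\<^bsub>\<M> x\<^esub>}"
    by (rule rev_finite_subset)
  moreover have "gact_family G V \<alpha> g F x \<in> carrier (\<O> x)" if x: "x \<in> carrier V" for x
    using gact_holo[OF g h(1)[OF x], of "F (?h x)"] F h[OF x] x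
    by (simp add: gact_family_def holo_sum_def del: holo_stalk_simps)
  moreover have "gact_family G V \<alpha> g F x = \<zero>\<^bsub>\<M> x\<^esub>" if "x \<in> carrier V - W" for x
    using zero[of x] that F h[of x] stable_iff[OF W, of "inv\<^bsub>G\<^esub> g" x] g by (simp add: holo_sum_def)
  ultimately show ?thesis using g F by (simp add: holo_sum_def gact_family_closed)
qed

definition group_trace :: "'a germ_family \<Rightarrow> 'a germ_family" where
  "group_trace F = (\<Oplus>\<^bsub>\<F>\<^esub>g\<in>carrier G. gact_family G V \<alpha> g F)"

lemma group_trace_closed: "F \<in> carrier (\<F>) \<Longrightarrow> group_trace F \<in> carrier (\<F>)"
  unfolding group_trace_def by (intro \<F>.finsum_closed) (simp add: gact_family_closed)

lemma holo_sum_finsum: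
  assumes "finite S" "\<And>i. i \<in> S \<Longrightarrow> f i \<in> holo_sum W"
  shows "(\<Oplus>\<^bsub>\<F>\<^esub>i\<in>S. f i) \<in> holo_sum W"
  using assms
proof (induction S rule: finite_induct)
  case (insert i S)
  then show ?case
    using holo_sum_carrier by (subst \<F>.finsum_insert) (auto intro!: holo_sum_add)
qed (simp add: holo_sum_zero)

lemma group_trace_invariant:
  assumes W: "stable W" and F: "F \<in> holo_sum W" shows "group_trace F \<in> \<I> W"
proof -
  note Fc = holo_sum_carrier[OF F]
  have "gact_family G V \<alpha> h (group_trace F) = group_trace F" if h: "h \<in> carrier G" for h
  proof -
    interpret gh: ring_hom_cring "\<F>" "\<F>" "gact_family G V \<alpha> h"
      using h by (rule gact_family_ring_hom)
    have bij: "inj_on (\<lambda>g. h \<otimes>\<^bsub>G\<^esub> g) (carrier G)" "(\<lambda>g. h \<otimes>\<^bsub>G\<^esub> g) ` carrier G = carrier G"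
      using h by (simp_all add: G.inj_on_cmult G.surj_const_mult)
    have "gact_family G V \<alpha> h (group_trace F) = (\<Oplus>\<^bsub>\<F>\<^esub>g\<in>carrier G. gact_family G V \<alpha> (h \<otimes>\<^bsub>G\<^esub> g) F)"
      unfolding group_trace_def using h Fc
      by (subst gh.hom_finsum) (auto intro!: \<F>.finsum_cong' simp: gact_family_closed gact_family_gact_family)
    also have "\<dots> = group_trace F"
      unfolding group_trace_def using \<F>.finsum_reindex[OF _ bij(1), of "\<lambda>g. gact_family G V \<alpha> g F"] Fc
      by (simp add: bij(2) gact_family_closed)
    finally show ?thesis .
  qed
  moreover have "group_trace F \<in> holo_sum W"
    unfolding group_trace_def by (intro holo_sum_finsum finite_G holo_sum_gact W F)
  ultimately show ?thesis unfolding invariant_germs_def holo_sum_def by blast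
qed

lemma group_trace_add:
  "F \<in> carrier (\<F>) \<Longrightarrow> F' \<in> carrier (\<F>) \<Longrightarrow>
    group_trace (F \<oplus>\<^bsub>\<F>\<^esub> F') = group_trace F \<oplus>\<^bsub>\<F>\<^esub> group_trace F'"
proof -
  assume F: "F \<in> carrier (\<F>)" "F' \<in> carrier (\<F>)"
  have "group_trace (F \<oplus>\<^bsub>\<F>\<^esub> F') =
      (\<Oplus>\<^bsub>\<F>\<^esub>g\<in>carrier G. gact_family G V \<alpha> g F \<oplus>\<^bsub>\<F>\<^esub> gact_family G V \<alpha> g F')"
    unfolding group_trace_def using F
    by (intro \<F>.finsum_cong')
      (auto simp: gact_family_closed ring_hom_add[OF ring_hom_cring.homh[OF gact_family_ring_hom]])
  also have "\<dots> = group_trace F \<oplus>\<^bsub>\<F>\<^esub> group_trace F'"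
    unfolding group_trace_def using F by (intro \<F>.finsum_addf) (auto simp: gact_family_closed)
  finally show ?thesis .
qed

lemma group_trace_mult:
  assumes U: "equivariant U" and F: "F \<in> carrier (\<F>)"
  shows "group_trace (U \<otimes>\<^bsub>\<F>\<^esub> F) = U \<otimes>\<^bsub>\<F>\<^esub> group_trace F"
proof -
  note Uc = equivariant_carrier[OF U]
  have Ug: "gact_family G V \<alpha> g U = U" if "g \<in> carrier G" for g
    using U gact_family_invariant_iff[OF Uc] that by (simp add: equivariant_def)
  have "group_trace (U \<otimes>\<^bsub>\<F>\<^esub> F) =
      (\<Oplus>\<^bsub>\<F>\<^esub>g\<in>carrier G. U \<otimes>\<^bsub>\<F>\<^esub> gact_family G V \<alpha> g F)"
    unfolding group_trace_def using F Uc
    by (intro \<F>.finsum_cong')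
      (auto simp: gact_family_closed Ug ring_hom_mult[OF ring_hom_cring.homh[OF gact_family_ring_hom]])
  also have "\<dots> = U \<otimes>\<^bsub>\<F>\<^esub> group_trace F"
    unfolding group_trace_def using F Uc finite_G
    by (intro \<F>.finsum_rdistr[symmetric]) (auto simp: gact_family_closed)
  finally show ?thesis .
qed

lemma finsum_const_family:
  assumes "finite S" "F \<in> carrier (\<F>)"
  shows "(\<Oplus>\<^bsub>\<F>\<^esub>i\<in>S. F) = holo_function V (\<lambda>_. of_nat (card S)) \<otimes>\<^bsub>\<F>\<^esub> F"
  using assms(1)
proof (induction S rule: finite_induct)
  case empty
  then show ?case using assms(2) by (simp add: holo_function_zero)
next
  case (insert i S)
  note c = holo_function_closed[OF holo_on_carrier_const]
  have "(\<Oplus>\<^bsub>\<F>\<^esub>i\<in>insert i S. F) =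
      holo_function V (\<lambda>_. 1) \<otimes>\<^bsub>\<F>\<^esub> F \<oplus>\<^bsub>\<F>\<^esub> holo_function V (\<lambda>_. of_nat (card S)) \<otimes>\<^bsub>\<F>\<^esub> F"
    using insert assms(2) by (subst \<F>.finsum_insert) (simp_all add: holo_function_one)
  also have "\<dots> = holo_function V (\<lambda>_. of_nat (card (insert i S))) \<otimes>\<^bsub>\<F>\<^esub> F"
    using insert assms(2)
    by (simp add: \<F>.l_distr[symmetric] c holo_function_add holo_on_carrier_const)
  finally show ?case .
qed

lemma group_trace_average:
  assumes "F \<in> \<I> W"
  shows "F = holo_function V (\<lambda>_. 1 / of_nat (card (carrier G))) \<otimes>\<^bsub>\<F>\<^esub> group_trace F"
proof -
  have F: "F \<in> carrier (\<F>)" "\<And>g. g \<in> carrier G \<Longrightarrow> gact_family G V \<alpha> g F = F"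
    using assms by (simp_all add: invariant_germs_def)
  have "card (carrier G) \<noteq> 0" using finite_G G.one_closed by auto
  note c = holo_function_closed[OF holo_on_carrier_const]
  have "group_trace F = (\<Oplus>\<^bsub>\<F>\<^esub>g\<in>carrier G. F)"
    unfolding group_trace_def using F by (intro \<F>.finsum_cong') auto
  then have "holo_function V (\<lambda>_. 1 / of_nat (card (carrier G))) \<otimes>\<^bsub>\<F>\<^esub> group_trace F =
      (holo_function V (\<lambda>_. 1 / of_nat (card (carrier G))) \<otimes>\<^bsub>\<F>\<^esub>
        holo_function V (\<lambda>_. of_nat (card (carrier G)))) \<otimes>\<^bsub>\<F>\<^esub> F"
    using F(1) by (simp add: finsum_const_family finite_G \<F>.m_assoc c)
  also have "\<dots> = F"
    using F(1) \<open>card (carrier G) \<noteq> 0\<close> by (simp add: holo_function_mult holo_on_carrier_const holo_function_one)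
  finally show ?thesis by simp
qed

text \<open>The family obtained by translating a germ at \<open>e\<close> to all points of \<open>V\<close>. It is invariant under
  translations, and under \<open>G\<close> if the germ is.\<close>

definition spread :: "'a mgerm \<Rightarrow> 'a germ_family" where
  "spread u = (\<lambda>x\<in>carrier V. transl V x \<e> u)"

lemma spread_closed:
  assumes "u \<in> carrier (\<O> \<e>)" shows "spread u \<in> carrier (\<F>)"
  unfolding spread_def by (intro family_restrict_mem holo_mero transl_holo assms)

lemma spread_transl:
  assumes u: "u \<in> carrier (\<O> \<e>)" and \<xi>: "\<xi> \<in> carrier V"
  shows "transl_family V \<xi> (spread u) = spread u"
proof (rule family_eqI)
  fix x assume x: "x \<in> carrier V"
  let ?y = "inv\<^bsub>V\<^esub> \<xi> \<otimes>\<^bsub>V\<^esub> x"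
  have um: "u \<in> carrier (\<M> \<e>)" using u by (rule holo_mero[OF V.one_closed])
  have y: "?y \<in> carrier V" using x \<xi> by simp
  have eq: "inv\<^bsub>V\<^esub> ?y \<otimes>\<^bsub>V\<^esub> (inv\<^bsub>V\<^esub> \<xi> \<otimes>\<^bsub>V\<^esub> z) = inv\<^bsub>V\<^esub> x \<otimes>\<^bsub>V\<^esub> z" if "z \<in> carrier V" for z
    using x \<xi> that by (simp add: V.inv_mult_group V.m_assoc) (simp add: V.m_assoc[symmetric])
  have "pull V (\<lambda>z. inv\<^bsub>V\<^esub> \<xi> \<otimes>\<^bsub>V\<^esub> z) x (pull V (\<lambda>z. inv\<^bsub>V\<^esub> ?y \<otimes>\<^bsub>V\<^esub> z) ?y u) =
      pull V (\<lambda>z. inv\<^bsub>V\<^esub> ?y \<otimes>\<^bsub>V\<^esub> (inv\<^bsub>V\<^esub> \<xi> \<otimes>\<^bsub>V\<^esub> z)) x u"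
    using x \<xi> y um by (intro pull_pull) (simp_all add: biholo_translation)
  also have "\<dots> = pull V (\<lambda>z. inv\<^bsub>V\<^esub> x \<otimes>\<^bsub>V\<^esub> z) x u"
    using x \<xi> y um by (intro pull_cong biholo_comp[OF biholo_translation biholo_translation])
      (simp_all only: eq V.l_inv V.inv_closed biholo_translation)
  finally show "transl_family V \<xi> (spread u) x = spread u x"
    using x \<xi> y by (simp add: transl_family_eq pull_family_def spread_def transl_eq_pull)
qed (simp_all add: spread_closed[OF u] \<xi> transl_family_closed)

lemma equivariant_spread:
  assumes u: "u \<in> fixed_germs G V \<alpha> (carrier G) \<e>" shows "equivariant (spread u)"
  unfolding equivariant_def
proof (intro conjI ballI)
  have uh: "u \<in> carrier (\<O> \<e>)" using u by (simp add: fixed_germs_def)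
  have um: "u \<in> carrier (\<M> \<e>)" using uh by (rule holo_mero[OF V.one_closed])
  show "spread u \<in> carrier (\<F>)" using uh by (rule spread_closed)
  fix x assume x: "x \<in> carrier V"
  show "spread u x \<in> carrier (\<O> x)" using transl_holo[OF x uh] x by (simp add: spread_def)
  fix g assume g: "g \<in> carrier G"
  have gx: "\<alpha> g x \<in> carrier V" using g x by (rule act_closed)
  have tm: "transl V x \<e> u \<in> carrier (\<M> x)" by (rule holo_mero[OF x transl_holo[OF x uh]])
  have "untransl (\<alpha> g x) (gact G V \<alpha> g x (transl V x \<e> u)) = u"
    using untransl_gact[OF g x tm] untransl_transl[OF x um] u g by (simp add: fixed_germs_def)
  then have "gact G V \<alpha> g x (transl V x \<e> u) = transl V (\<alpha> g x) \<e> u"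
    using transl_untransl[OF gx gact_closed[OF g x tm]] by simp
  then show "spread u (\<alpha> g x) = gact G V \<alpha> g x (spread u x)" using x gx by (simp add: spread_def)
qed

lemma spread_J_at:
  assumes "u \<in> \<J>" "x \<in> carrier V" shows "spread u x \<in> J_at x"
proof -
  have u: "u \<in> carrier (\<O> \<e>)" using assms(1) J_e_sub by blast
  show ?thesis
    using assms transl_holo[OF assms(2) u] untransl_transl[OF assms(2) holo_mero[OF V.one_closed u]]
    by (simp add: J_at_def spread_def del: holo_stalk_simps)
qed

definition delta :: "'a \<Rightarrow> 'a mgerm \<Rightarrow> 'a germ_family" where
  "delta x b = (\<lambda>y\<in>carrier V. if y = x then b else \<zero>\<^bsub>\<M> y\<^esub>)"

lemma zero_mero: "x \<in> carrier V \<Longrightarrow> \<zero>\<^bsub>\<M> x\<^esub> \<in> carrier (\<M> x)"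
  using cring.cring_simprules(2)[OF cring_mero_stalk] .

lemma delta_holo_sum:
  assumes "x \<in> carrier V" "x \<in> W" "b \<in> carrier (\<O> x)" shows "delta x b \<in> holo_sum W"
proof -
  have "delta x b \<in> carrier (\<F>)"
    unfolding delta_def using assms holo_mero[OF assms(1,3)]
    by (intro family_restrict_mem) (simp add: zero_mero)
  moreover have "finite {y\<in>carrier V. delta x b y \<noteq> \<zero>\<^bsub>\<M> y\<^esub>}"
    by (rule finite_subset[of _ "{x}"]) (auto simp: delta_def)
  moreover have "delta x b y \<in> carrier (\<O> y)" if "y \<in> carrier V" for y
    using that assms(3) subringE(2)[OF subring_holo[OF that]] by (simp add: delta_def del: holo_stalk_simps)
  moreover have "delta x b y = \<zero>\<^bsub>\<M> y\<^esub>" if "y \<in> carrier V - W" for y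
    using that assms(2) by (auto simp: delta_def)
  ultimately show ?thesis by (simp add: holo_sum_def)
qed

lemma delta_closed: "x \<in> carrier V \<Longrightarrow> b \<in> carrier (\<O> x) \<Longrightarrow> delta x b \<in> carrier (\<F>)"
  using delta_holo_sum[of x UNIV b] holo_sum_carrier by blast

lemma delta_add:
  assumes "x \<in> carrier V" "b \<in> carrier (\<O> x)" "c \<in> carrier (\<O> x)"
  shows "delta x (b \<oplus>\<^bsub>\<M> x\<^esub> c) = delta x b \<oplus>\<^bsub>\<F>\<^esub> delta x c"
  using assms cring.cring_simprules(8)[OF cring_mero_stalk] zero_mero
  by (auto simp: delta_def family_ring_simps(4) fun_eq_iff)

lemma delta_zero: "delta x \<zero>\<^bsub>\<M> x\<^esub> = \<zero>\<^bsub>\<F>\<^esub>"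
  by (auto simp: delta_def family_ring_simps(3) fun_eq_iff)

lemma mult_delta:
  assumes "U \<in> carrier (\<F>)" "x \<in> carrier V"
  shows "U \<otimes>\<^bsub>\<F>\<^esub> delta x r = delta x (U x \<otimes>\<^bsub>\<M> x\<^esub> r)"
  using assms cring.cring_simprules(27)[OF cring_mero_stalk] family_mem[OF assms(1)]
  by (auto simp: delta_def family_ring_simps(5) fun_eq_iff)

lemma transl_hom_holo:
  assumes "x \<in> carrier V"
  shows "ring_hom_ring (\<O> \<e>) (\<O> x) (transl V x \<e>)"
  using transl_ring_hom[OF assms V.one_closed] assms
  by (intro ring_hom_holo transl_holo) simp_all

text \<open>If \<open>a\<close> preserves the invariant families, it preserves the families with values in the ideals
  \<open>J_at x\<close>. Such a family is an average of traces of germs supported at one point \<open>x\<close>, and there of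
  sums of products \<open>\<phi>\<^sub>x(u) r\<close> with \<open>u\<close> a \<open>G\<close>-invariant germ at \<open>e\<close> vanishing at \<open>e\<close>. The family
  \<open>spread u\<close> commutes with the trace and with \<open>a\<close>, so that \<open>a\<close> maps the trace of \<open>\<phi>\<^sub>x(u) r\<close> to a
  multiple of \<open>spread u\<close>.\<close>

lemma skew_act_J_at:
  assumes W: "stable W" and a: "a \<in> carrier (skew_ring V)"
    and preserves: "\<And>F. F \<in> \<I> W \<Longrightarrow> skew_act V a F \<in> \<I> W"
    and F: "F \<in> \<I> W" "\<And>x. x \<in> carrier V \<Longrightarrow> F x \<in> J_at x"
    and y: "y \<in> carrier V"
  shows "skew_act V a F y \<in> J_at y"
proof -
  define B where "B = {F \<in> holo_sum W. \<forall>x\<in>carrier V. skew_act V a (group_trace F) x \<in> J_at x}"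
  have B_add: "F \<oplus>\<^bsub>\<F>\<^esub> F' \<in> B" if "F \<in> B" "F' \<in> B" for F F'
  proof -
    have c: "F \<in> carrier (\<F>)" "F' \<in> carrier (\<F>)"
      using that holo_sum_carrier by (auto simp: B_def)
    have "skew_act V a (group_trace (F \<oplus>\<^bsub>\<F>\<^esub> F')) =
        skew_act V a (group_trace F) \<oplus>\<^bsub>\<F>\<^esub> skew_act V a (group_trace F')"
      by (simp add: group_trace_add skew_act_add a c group_trace_closed)
    moreover have "F \<oplus>\<^bsub>\<F>\<^esub> F' \<in> holo_sum W"
      using that by (auto simp: B_def intro: holo_sum_add)
    ultimately show ?thesis
      using that unfolding B_def by (simp add: family_ring_simps(4)[of "skew_act V a _"] J_at_add)
  qed
  have B_zero: "\<zero>\<^bsub>\<F>\<^esub> \<in> B"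
  proof -
    have "group_trace \<zero>\<^bsub>\<F>\<^esub> = \<zero>\<^bsub>\<F>\<^esub>"
      using group_trace_mult[OF equivariant_zero \<F>.zero_closed] by (simp add: group_trace_closed)
    moreover have "skew_act V a \<zero>\<^bsub>\<F>\<^esub> = \<zero>\<^bsub>\<F>\<^esub>"
      using skew_act_mult[OF a \<F>.zero_closed \<F>.zero_closed] skew_act_closed[OF a \<F>.zero_closed]
        ring_hom_cring.hom_zero[OF transl_family_ring_hom] by simp
    ultimately show ?thesis
      by (simp add: B_def holo_sum_zero) (simp add: family_ring_simps(3) J_at_zero)
  qed
  have B_spread: "spread u \<otimes>\<^bsub>\<F>\<^esub> F \<in> B" if u: "u \<in> J_gen" and F: "F \<in> holo_sum W" for u F
  proof -
    have uh: "u \<in> carrier (\<O> \<e>)" and uf: "u \<in> fixed_germs G V \<alpha> (carrier G) \<e>"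
      and uJ: "u \<in> \<J>"
      using u J_gen_sub J_gen_J_e by blast+
    note Fc = holo_sum_carrier[OF F] and sc = spread_closed[OF uh]
    have act: "skew_act V a (group_trace (spread u \<otimes>\<^bsub>\<F>\<^esub> F)) =
        spread u \<otimes>\<^bsub>\<F>\<^esub> skew_act V a (group_trace F)"
      unfolding group_trace_mult[OF equivariant_spread[OF uf] Fc]
      by (intro skew_act_mult a group_trace_closed Fc sc spread_transl uh)
    have "(spread u \<otimes>\<^bsub>\<F>\<^esub> skew_act V a (group_trace F)) x \<in> J_at x" if x: "x \<in> carrier V" for x
    proof -
      interpret M: cring "\<M> x" using x by (rule cring_mero_stalk)
      have h: "skew_act V a (group_trace F) x \<in> carrier (\<O> x)"
        by (rule equivariant_holo[OF invariant_germs_equivariant[OF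
                preserves[OF group_trace_invariant[OF W F]]] x])
      have "skew_act V a (group_trace F) x \<otimes>\<^bsub>\<M> x\<^esub> spread u x \<in> J_at x"
        by (intro J_at_mult x h spread_J_at uJ)
      then show ?thesis
        using M.m_comm[OF family_mem[OF sc x] holo_mero[OF x h]] x by (simp add: family_ring_simps(5))
    qed
    moreover have "spread u \<otimes>\<^bsub>\<F>\<^esub> F \<in> holo_sum W"
      by (rule holo_sum_mult[OF sc equivariant_holo[OF equivariant_spread[OF uf]] F])
    ultimately show ?thesis by (simp add: B_def act)
  qed
  have B_delta: "delta x b \<in> B" if x: "x \<in> carrier V" "x \<in> W" and b: "b \<in> J_at x" for x b
  proof -
    interpret O: cring "\<O> x" using x(1) by (rule cring_holo_stalk)
    \<comment> \<open>The quantifier over \<open>r\<close> makes \<open>?S\<close> an ideal; the trace itself is not linear over \<open>\<O> x\<close>.\<close>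
    let ?S = "{b \<in> carrier (\<O> x). \<forall>r\<in>carrier (\<O> x). delta x (r \<otimes>\<^bsub>\<O> x\<^esub> b) \<in> B}"
    have "ideal ?S (\<O> x)"
    proof (rule idealI[OF O.ring_axioms])
      show "subgroup ?S (add_monoid (\<O> x))"
      proof (rule O.add.subgroupI)
        have "delta x (r \<otimes>\<^bsub>\<O> x\<^esub> \<zero>\<^bsub>\<O> x\<^esub>) \<in> B" if "r \<in> carrier (\<O> x)" for r
          using O.r_null[OF that] B_zero by (simp add: delta_zero)
        then show "?S \<noteq> {}" using O.zero_closed by blast
      next
        fix b assume b: "b \<in> ?S"
        then have "r \<otimes>\<^bsub>\<O> x\<^esub> \<ominus>\<^bsub>\<O> x\<^esub> b = \<ominus>\<^bsub>\<O> x\<^esub> r \<otimes>\<^bsub>\<O> x\<^esub> b"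
          if "r \<in> carrier (\<O> x)" for r
          using that by (simp add: O.r_minus O.l_minus del: holo_stalk_simps)
        then show "\<ominus>\<^bsub>\<O> x\<^esub> b \<in> ?S"
          using b by (simp del: holo_stalk_simps)
      next
        fix b c assume bc: "b \<in> ?S" "c \<in> ?S"
        have "delta x (r \<otimes>\<^bsub>\<O> x\<^esub> (b \<oplus>\<^bsub>\<O> x\<^esub> c)) \<in> B" if r: "r \<in> carrier (\<O> x)" for r
        proof -
          have c: "r \<otimes>\<^bsub>\<O> x\<^esub> b \<in> carrier (\<O> x)" "r \<otimes>\<^bsub>\<O> x\<^esub> c \<in> carrier (\<O> x)"
            using bc r by (simp_all del: holo_stalk_simps)
          have "r \<otimes>\<^bsub>\<O> x\<^esub> (b \<oplus>\<^bsub>\<O> x\<^esub> c) =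
              r \<otimes>\<^bsub>\<O> x\<^esub> b \<oplus>\<^bsub>\<M> x\<^esub> r \<otimes>\<^bsub>\<O> x\<^esub> c"
            using O.r_distr[of b c r] bc r by (simp only: mem_Collect_eq holo_stalk_simps(5))
          then show ?thesis using delta_add[OF x(1) c] B_add bc r by simp
        qed
        then show "b \<oplus>\<^bsub>\<O> x\<^esub> c \<in> ?S" using bc by (simp del: holo_stalk_simps)
      qed auto
    next
      fix b s assume b: "b \<in> ?S" and s: "s \<in> carrier (\<O> x)"
      then have "r \<otimes>\<^bsub>\<O> x\<^esub> (s \<otimes>\<^bsub>\<O> x\<^esub> b) = (r \<otimes>\<^bsub>\<O> x\<^esub> s) \<otimes>\<^bsub>\<O> x\<^esub> b"
        if "r \<in> carrier (\<O> x)" for r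
        using that by (simp add: O.m_assoc del: holo_stalk_simps)
      then show "s \<otimes>\<^bsub>\<O> x\<^esub> b \<in> ?S" using b s by (simp del: holo_stalk_simps)
      then show "b \<otimes>\<^bsub>\<O> x\<^esub> s \<in> ?S" using b s O.m_comm[of b s] by (simp del: holo_stalk_simps)
    qed
    from ring_hom_ring.ideal_vimage[OF transl_hom_holo[OF x(1)] this]
    have "\<J> \<subseteq> {h \<in> carrier (\<O> \<e>). transl V x \<e> h \<in> ?S}"
    proof (rule J_e_minimal)
      show "J_gen \<subseteq> {h \<in> carrier (\<O> \<e>). transl V x \<e> h \<in> ?S}"
      proof
        fix u assume u: "u \<in> J_gen"
        then have uh: "u \<in> carrier (\<O> \<e>)" using J_gen_sub by blast
        note th = transl_holo[OF x(1) uh]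
        have "delta x (r \<otimes>\<^bsub>\<O> x\<^esub> transl V x \<e> u) \<in> B" if r: "r \<in> carrier (\<O> x)" for r
        proof -
          have "r \<otimes>\<^bsub>\<O> x\<^esub> transl V x \<e> u = spread u x \<otimes>\<^bsub>\<M> x\<^esub> r"
            using O.m_comm[OF r th] x(1) by (simp only: holo_stalk_simps(4) spread_def restrict_apply')
          then show ?thesis
            using B_spread[OF u delta_holo_sum[OF x r]] mult_delta[OF spread_closed[OF uh] x(1)] by simp
        qed
        then show "u \<in> {h \<in> carrier (\<O> \<e>). transl V x \<e> h \<in> ?S}"
          using uh th by blast
      qed
    qed
    then have "transl V x \<e> (untransl x b) \<in> ?S" using b by (auto simp: J_at_def)
    then have "b \<in> ?S" using transl_untransl[OF x(1) holo_mero[OF x(1) J_at_holo[OF b]]] by simp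
    then have "delta x (\<one>\<^bsub>\<O> x\<^esub> \<otimes>\<^bsub>\<O> x\<^esub> b) \<in> B" using O.one_closed by blast
    then show ?thesis using O.l_one[OF J_at_holo[OF b]] by simp
  qed
  have B_all: "F \<in> B" if "finite T" "F \<in> holo_sum W" "\<forall>x\<in>carrier V. F x \<in> J_at x"
    "{x\<in>carrier V. F x \<noteq> \<zero>\<^bsub>\<M> x\<^esub>} \<subseteq> T" for T F
    using that
  proof (induction T arbitrary: F rule: finite_induct)
    case empty
    have "F = \<zero>\<^bsub>\<F>\<^esub>"
      by (rule family_eqI[OF holo_sum_carrier[OF empty(1)] \<F>.zero_closed])
        (use empty(3) in \<open>auto simp: family_ring_simps(3)\<close>)
    then show ?case using B_zero by simp
  next
    case (insert x T)
    show ?case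
    proof (cases "x \<in> carrier V \<and> F x \<noteq> \<zero>\<^bsub>\<M> x\<^esub>")
      case False
      then show ?thesis using insert by (intro insert.IH) auto
    next
      case True
      then have x: "x \<in> carrier V" "x \<in> W" using insert.prems(1) by (auto simp: holo_sum_def)
      define F' where "F' = (\<lambda>y\<in>carrier V. if y = x then \<zero>\<^bsub>\<M> y\<^esub> else F y)"
      note Fc = holo_sum_carrier[OF insert.prems(1)]
      have F'c: "F' \<in> carrier (\<F>)"
        unfolding F'_def by (rule family_restrict_mem) (simp add: zero_mero x family_mem[OF Fc])
      have "F' \<in> holo_sum W"
      proof -
        have "finite {y\<in>carrier V. F' y \<noteq> \<zero>\<^bsub>\<M> y\<^esub>}"
          by (rule finite_subset[of _ "insert x T"]) (use insert in \<open>auto simp: F'_def\<close>)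
        moreover have "F' y \<in> carrier (\<O> y)" if "y \<in> carrier V" for y
          using that insert.prems(1) subringE(2)[OF subring_holo[OF that]]
          by (auto simp: F'_def holo_sum_def simp del: holo_stalk_simps)
        moreover have "F' y = \<zero>\<^bsub>\<M> y\<^esub>" if "y \<in> carrier V - W" for y
          using that insert.prems(1) by (auto simp: F'_def holo_sum_def)
        ultimately show ?thesis using F'c by (simp add: holo_sum_def)
      qed
      then have "F' \<in> B"
      proof (rule insert.IH)
        show "\<forall>y\<in>carrier V. F' y \<in> J_at y" using insert.prems(2) by (auto simp: F'_def J_at_zero)
        show "{y\<in>carrier V. F' y \<noteq> \<zero>\<^bsub>\<M> y\<^esub>} \<subseteq> T" using insert.prems(3) by (auto simp: F'_def)
      qed
      moreover have "delta x (F x) \<in> B" using insert.prems(2) x by (intro B_delta) auto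
      moreover have "F = delta x (F x) \<oplus>\<^bsub>\<F>\<^esub> F'"
      proof (rule family_eqI[OF Fc])
        have "F x \<in> carrier (\<O> x)" using insert.prems(2) x by (intro J_at_holo) auto
        then show "delta x (F x) \<oplus>\<^bsub>\<F>\<^esub> F' \<in> carrier (\<F>)"
          by (intro \<F>.a_closed delta_closed x F'c)
        fix y assume y: "y \<in> carrier V"
        interpret M: cring "\<M> y" using y by (rule cring_mero_stalk)
        show "F y = (delta x (F x) \<oplus>\<^bsub>\<F>\<^esub> F') y"
          using y family_mem[OF Fc y] M.r_zero[of "F y"]
          by (cases "y = x") (simp_all add: family_ring_simps(4) delta_def F'_def)
      qed
      ultimately show ?thesis using B_add by metis
    qed
  qed
  have "F \<in> holo_sum W" using F(1) by (simp add: invariant_germs_holo_sum)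
  then have FB: "F \<in> B" using F(2) by (intro B_all[of "{x\<in>carrier V. F x \<noteq> \<zero>\<^bsub>\<M> x\<^esub>}"]) (auto simp: holo_sum_def)
  let ?c = "\<lambda>_. 1 / of_nat (card (carrier G)) :: complex"
  note c = holo_function_closed[OF holo_on_carrier_const]
  have Fc: "F \<in> carrier (\<F>)" by (rule equivariant_carrier[OF invariant_germs_equivariant[OF F(1)]])
  have "skew_act V a F = skew_act V a (holo_function V ?c \<otimes>\<^bsub>\<F>\<^esub> group_trace F)"
    using group_trace_average[OF F(1)] by simp
  also have "\<dots> = holo_function V ?c \<otimes>\<^bsub>\<F>\<^esub> skew_act V a (group_trace F)"
    by (intro skew_act_mult a group_trace_closed Fc c holo_function_const_transl)
  finally have "skew_act V a F y = holo_germ V y ?c \<otimes>\<^bsub>\<M> y\<^esub> skew_act V a (group_trace F) y"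
    using y by (simp add: family_ring_simps(5) holo_function_apply)
  moreover have "holo_germ V y ?c \<in> carrier (\<O> y)" using holo_at_const[OF y] by auto
  ultimately show ?thesis using FB y J_at_mult by (simp add: B_def)
qed

text \<open>Two representatives of a class differ by an invariant family with values in the ideals \<open>J_at x\<close>,
  which \<open>a\<close> preserves. So the choice of a representative in the definition of the action does not
  matter.\<close>

lemma smult_E_class:
  assumes W: "stable W" and a: "a \<in> carrier (skew_ring V)"
    and preserves: "\<And>F. F \<in> \<I> W \<Longrightarrow> skew_act V a F \<in> \<I> W"
    and F: "F \<in> \<I> W"
  shows "a \<odot>\<^bsub>M_module G V \<alpha> W\<^esub> \<E> F = \<E> (skew_act V a F)"
proof -
  define F' where "F' = (SOME F'. F' \<in> \<I> W \<and> \<E> F' = \<E> F)"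
  have F': "F' \<in> \<I> W" "\<E> F' = \<E> F"
    unfolding F'_def using someI[of "\<lambda>F'. F' \<in> \<I> W \<and> \<E> F' = \<E> F" F] F
    by auto
  note e = invariant_germs_equivariant[OF F] invariant_germs_equivariant[OF F'(1)]
  note c = e[THEN equivariant_carrier]
  define D where "D = F' \<oplus>\<^bsub>\<F>\<^esub> \<ominus>\<^bsub>\<F>\<^esub> F"
  have D: "D \<in> \<I> W"
    unfolding D_def by (intro invariant_germs_add invariant_germs_uminus F F')
  have DJ: "D x \<in> J_at x" if x: "x \<in> carrier V" for x
    using F'(2) x e family_uminus[OF c(1) x]
    by (simp add: D_def E_class_eq_iff family_ring_simps(4) a_minus_def)
  have Dc: "D \<in> carrier (\<F>)" by (rule equivariant_carrier[OF invariant_germs_equivariant[OF D]])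
  have "F' = D \<oplus>\<^bsub>\<F>\<^esub> F"
    unfolding D_def using c by (simp add: \<F>.a_assoc \<F>.l_neg)
  then have eq: "skew_act V a F' = skew_act V a D \<oplus>\<^bsub>\<F>\<^esub> skew_act V a F"
    using skew_act_add[OF a Dc c(1)] by simp
  have "\<E> (skew_act V a F') = \<E> (skew_act V a F)"
  proof (subst E_class_eq_iff)
    show "\<forall>x\<in>carrier V. skew_act V a F' x \<ominus>\<^bsub>\<M> x\<^esub> skew_act V a F x \<in> J_at x"
    proof
      fix x assume x: "x \<in> carrier V"
      interpret M: cring "\<M> x" using x by (rule cring_mero_stalk)
      have "skew_act V a D x \<in> J_at x" by (rule skew_act_J_at[OF W a preserves D DJ x])
      moreover have "skew_act V a F' x \<ominus>\<^bsub>\<M> x\<^esub> skew_act V a F x = skew_act V a D x"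
        using x family_mem[OF skew_act_closed[OF a Dc] x] family_mem[OF skew_act_closed[OF a c(1)] x]
        by (simp add: eq family_ring_simps(4) M.minus_eq M.a_assoc M.r_neg)
      ultimately show "skew_act V a F' x \<ominus>\<^bsub>\<M> x\<^esub> skew_act V a F x \<in> J_at x" by simp
    qed
  qed (fact invariant_germs_equivariant[OF preserves[OF F'(1)]] invariant_germs_equivariant[OF preserves[OF F]])+
  then show ?thesis by (simp add: M_module_def F'_def)
qed

lemma function_skew_in_skew_ring:
  assumes f: "holo_on V f (carrier V)" shows "function_skew V f \<in> carrier (skew_ring V)"
proof -
  have mero: "holo_function V h \<in> carrier (mero_ring V)" if h: "holo_on V h (carrier V)" for h
  proof -
    have "\<forall>y\<in>carrier V. nonzerodivisor_at V y (\<lambda>_. 1) \<and> holo_function V h y = holo_germ V y h"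
      by (simp add: nonzerodivisor_at_one holo_function_apply)
    then have "\<forall>x\<in>carrier V. \<exists>D p q. x \<in> D \<and> holo_on V p D \<and> holo_on V q D \<and>
        (\<forall>y\<in>D. nonzerodivisor_at V y q \<and> holo_function V h y = germ V y p q)"
      using h holo_on_carrier_const[of 1] by blast
    then show ?thesis using holo_function_closed[OF h] by (simp add: mero_ring_def)
  qed
  have "\<zero>\<^bsub>mero_ring V\<^esub> \<in> carrier (mero_ring V)"
    using mero[OF holo_on_carrier_const[of 0]] by (simp add: holo_function_zero zero_mero_ring)
  moreover have "finite (skew_support V (function_skew V f))"
    by (rule finite_subset[of _ "{\<e>}"]) (auto simp: skew_support_def function_skew_def split: if_splits)
  ultimately show ?thesis
    using mero[OF f] by (simp add: skew_ring_def) (simp add: function_skew_def)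
qed

lemma smult_function:
  assumes "stable W" and f: "f \<in> \<H>" and F: "F \<in> \<I> W"
  shows "function_skew V f \<odot>\<^bsub>M_module G V \<alpha> W\<^esub> \<E> F =
    \<E> (holo_function V f \<otimes>\<^bsub>\<F>\<^esub> F)"
proof -
  have act: "skew_act V (function_skew V f) F' = holo_function V f \<otimes>\<^bsub>\<F>\<^esub> F'"
    if "F' \<in> \<I> W" for F'
    by (intro skew_act_function invariant_functions_holo[OF f] equivariant_carrier
        invariant_germs_equivariant[OF that])
  show ?thesis
    unfolding act[OF F, symmetric]
    using assms act by (intro smult_E_class function_skew_in_skew_ring invariant_functions_holo)
      (simp_all add: invariant_germs_mult equivariant_holo_function)
qed

section \<open>Recovering the unit class from a nonvanishing element\<close>

definition unit_family :: "'a \<Rightarrow> 'a germ_family" where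
  "unit_family w = (\<lambda>x\<in>carrier V. if x \<in> orbit G \<alpha> w then \<one>\<^bsub>\<M> x\<^esub> else \<zero>\<^bsub>\<M> x\<^esub>)"

lemma unit_family_invariant:
  assumes w: "w \<in> carrier V" shows "unit_family w \<in> \<I> (orbit G \<alpha> w)"
proof -
  have "equivariant (unit_family w)"
    unfolding equivariant_def
  proof (intro conjI ballI)
    show "unit_family w \<in> carrier (\<F>)"
      unfolding unit_family_def
      by (rule family_restrict_mem) (simp add: zero_mero cring.cring_simprules(6)[OF cring_mero_stalk])
    fix x assume x: "x \<in> carrier V"
    show "unit_family w x \<in> carrier (\<O> x)"
      using x subringE(2,3)[OF subring_holo[OF x]] by (simp add: unit_family_def del: holo_stalk_simps)
    fix g assume g: "g \<in> carrier G"
    interpret h: ring_hom_cring "\<M> x" "\<M> (\<alpha> g x)" "gact G V \<alpha> g x"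
      using g x by (rule gact_ring_hom)
    show "unit_family w (\<alpha> g x) = gact G V \<alpha> g x (unit_family w x)"
      using x g act_closed[OF g x] stable_iff[OF stable_orbit[OF w] g x] by (simp add: unit_family_def)
  qed
  moreover have "finite {x\<in>carrier V. unit_family w x \<noteq> \<zero>\<^bsub>\<M> x\<^esub>}"
    by (rule finite_subset[OF _ finite_orbit[of w]]) (auto simp: unit_family_def)
  ultimately show ?thesis by (simp add: invariant_germs_iff) (simp add: unit_family_def)
qed

lemma unit_class_eq: "unit_class G V \<alpha> w = \<E> (unit_family w)"
proof
  fix x
  show "unit_class G V \<alpha> w x = \<E> (unit_family w) x"
  proof (cases "x \<in> carrier V")
    case True
    then show ?thesis
      by (simp add: unit_class_def E_class_apply unit_family_def E_stalk_simps coset_zero)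
  next
    case False
    then show ?thesis by (simp add: unit_class_def E_class_def)
  qed
qed

lemma invariant_germs_mono: "W \<subseteq> W' \<Longrightarrow> F \<in> \<I> W \<Longrightarrow> F \<in> \<I> W'"
  by (auto simp: invariant_germs_iff)

lemma submoduleI:
  "subgroup H (add_monoid M) \<Longrightarrow> (\<And>a m. a \<in> carrier R \<Longrightarrow> m \<in> H \<Longrightarrow> a \<odot>\<^bsub>M\<^esub> m \<in> H) \<Longrightarrow> submodule H R M"
  by (simp add: submodule_def submodule_axioms_def)

text \<open>The multiples of \<open>1\<close> by invariant functions already form a submodule.\<close>

lemma span_unit_class:
  assumes w: "w \<in> carrier V"
    and m: "m \<in> M_span G V \<alpha> (function_skew V ` \<H>) (orbit G \<alpha> w)
        {unit_class G V \<alpha> w}"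
  shows "\<exists>h\<in>\<H>.
    m = \<E> (holo_function V h \<otimes>\<^bsub>\<F>\<^esub> unit_family w)"
proof -
  let ?W = "orbit G \<alpha> w" and ?I = "\<H>"
  let ?M = "M_module G V \<alpha> ?W"
  let ?e = "\<lambda>h. \<E> (holo_function V h \<otimes>\<^bsub>\<F>\<^esub> unit_family w)"
  note u = unit_family_invariant[OF w]
  note uc = equivariant_carrier[OF invariant_germs_equivariant[OF u]]
  note hc = holo_function_closed[OF invariant_functions_holo]
  interpret M: abelian_group ?M by (rule abelian_group_M[OF stable_orbit[OF w]])
  have inv: "holo_function V h \<otimes>\<^bsub>\<F>\<^esub> unit_family w \<in> \<I> ?W" if "h \<in> ?I" for h
    by (intro invariant_germs_mult equivariant_holo_function that u)
  have mem: "?e h \<in> carrier ?M" if "h \<in> ?I" for h by (rule E_class_in_M[OF inv[OF that]])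
  have add: "?e h \<oplus>\<^bsub>?M\<^esub> ?e h' = ?e (\<lambda>z. h z + h' z)" if "h \<in> ?I" "h' \<in> ?I" for h h'
    using that uc
    by (simp add: E_class_add[where W="?W", symmetric] invariant_germs_equivariant[OF inv]
        \<F>.l_distr[symmetric] hc holo_function_add invariant_functions_holo)
  have "submodule (?e ` ?I) ((skew_ring V)\<lparr>carrier := function_skew V ` ?I\<rparr>) ?M"
  proof (rule submoduleI)
    show "subgroup (?e ` ?I) (add_monoid ?M)"
    proof (rule M.add.subgroupI)
      show "?e ` ?I \<subseteq> carrier ?M" using mem by blast
      show "?e ` ?I \<noteq> {}" using invariant_functions_const by blast
    next
      fix a assume "a \<in> ?e ` ?I"
      then obtain h where h: "h \<in> ?I" "a = ?e h" by blast
      let ?h = "\<lambda>z. 0 - h z"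
      have h': "?h \<in> ?I" by (intro invariant_functions_diff invariant_functions_const h)
      have "?e ?h \<oplus>\<^bsub>?M\<^esub> a = \<zero>\<^bsub>?M\<^esub>"
        using add[OF h' h(1)] uc E_class_zero[of ?W] by (simp add: h(2) holo_function_zero)
      then have "\<ominus>\<^bsub>?M\<^esub> a = ?e ?h" using mem[OF h'] mem[OF h(1)] h(2) by (intro M.minus_equality) simp_all
      then show "\<ominus>\<^bsub>?M\<^esub> a \<in> ?e ` ?I" using h' by simp
    next
      fix a b assume "a \<in> ?e ` ?I" "b \<in> ?e ` ?I"
      then obtain h h' where h: "h \<in> ?I" "a = ?e h" "h' \<in> ?I" "b = ?e h'" by blast
      show "a \<oplus>\<^bsub>?M\<^esub> b \<in> ?e ` ?I"
        using add[OF h(1,3)] invariant_functions_add[OF h(1,3)] h by simp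
    qed
  next
    fix a m assume "a \<in> carrier ((skew_ring V)\<lparr>carrier := function_skew V ` ?I\<rparr>)" "m \<in> ?e ` ?I"
    then obtain f h where f: "f \<in> ?I" "a = function_skew V f" "h \<in> ?I" "m = ?e h" by auto
    have "a \<odot>\<^bsub>?M\<^esub> m = ?e (\<lambda>z. f z * h z)"
      unfolding f(2,4) using f uc
      by (simp add: smult_function[OF stable_orbit[OF w] f(1) inv[OF f(3)]] \<F>.m_assoc[symmetric] hc
          holo_function_mult invariant_functions_holo)
    then show "a \<odot>\<^bsub>?M\<^esub> m \<in> ?e ` ?I" using invariant_functions_mult[OF f(1,3)] by simp
  qed
  moreover have "{unit_class G V \<alpha> w} \<subseteq> ?e ` ?I"
    using invariant_functions_const[of 1] uc by (auto simp: unit_class_eq holo_function_one intro!: image_eqI[of _ _ "\<lambda>_. 1"])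
  ultimately have "M_span G V \<alpha> (function_skew V ` ?I) ?W {unit_class G V \<alpha> w} \<subseteq> ?e ` ?I"
    unfolding M_span_def by (intro hull_minimal)
  then show ?thesis using m by blast
qed

text \<open>Multiplying \<open>F\<close> by the indicator family of the orbit of \<open>w\<close> gives an element of \<open>\<bbbE>\<^sup>G\<close> at this
  orbit, where the unit class is a generator.\<close>

lemma leading_function:
  assumes w: "w \<in> carrier V" "w \<in> W" and F: "F \<in> \<I> W"
    and generated: "M_span G V \<alpha> (function_skew V ` \<H>) (orbit G \<alpha> w)
        {unit_class G V \<alpha> w} = carrier (M_module G V \<alpha> (orbit G \<alpha> w))"
  shows "\<exists>h\<in>\<H>. \<forall>x\<in>orbit G \<alpha> w.
    F x \<ominus>\<^bsub>\<M> x\<^esub> holo_germ V x h \<in> J_at x"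
proof -
  note u = unit_family_invariant[OF w(1)]
  have in_V: "x \<in> carrier V" if "x \<in> orbit G \<alpha> w" for x
    using that stable_orbit[OF w(1)] by (auto simp: stable_def)
  have "F \<otimes>\<^bsub>\<F>\<^esub> unit_family w \<in> \<I> (orbit G \<alpha> w)"
    by (rule invariant_germs_mult[OF invariant_germs_equivariant[OF F] u])
  from E_class_in_M[OF this] obtain h where h: "h \<in> \<H>"
    and eq: "\<E> (F \<otimes>\<^bsub>\<F>\<^esub> unit_family w) =
      \<E> (holo_function V h \<otimes>\<^bsub>\<F>\<^esub> unit_family w)"
    using span_unit_class[OF w(1)] unfolding generated by blast
  have e: "equivariant (F \<otimes>\<^bsub>\<F>\<^esub> unit_family w)"
    "equivariant (holo_function V h \<otimes>\<^bsub>\<F>\<^esub> unit_family w)"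
    by (intro equivariant_mult equivariant_holo_function h invariant_germs_equivariant[OF F]
        invariant_germs_equivariant[OF u])+
  have "F x \<ominus>\<^bsub>\<M> x\<^esub> holo_germ V x h \<in> J_at x" if x: "x \<in> orbit G \<alpha> w" for x
  proof -
    interpret M: cring "\<M> x" using in_V[OF x] by (rule cring_mero_stalk)
    have "(F \<otimes>\<^bsub>\<F>\<^esub> unit_family w) x \<ominus>\<^bsub>\<M> x\<^esub>
        (holo_function V h \<otimes>\<^bsub>\<F>\<^esub> unit_family w) x \<in> J_at x"
      using eq in_V[OF x] by (simp add: E_class_eq_iff e)
    then show ?thesis
      using x in_V[OF x] equivariant_mero[OF invariant_germs_equivariant[OF F] in_V[OF x]]
        holo_germ_in_mero[OF invariant_functions_at[OF h in_V[OF x]]]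
      by (simp add: family_ring_simps(5) unit_family_def holo_function_apply)
  qed
  then show ?thesis using h by blast
qed

lemma separating_function:
  assumes "finite Y" "Y \<subseteq> W - orbit G \<alpha> w" "w \<in> W" "W \<subseteq> carrier V"
    and separates: "\<forall>x\<in>W. \<forall>y\<in>W. orbit G \<alpha> x \<noteq> orbit G \<alpha> y \<longrightarrow>
      (\<exists>f\<in>\<H>. f x \<noteq> f y)"
  shows "\<exists>f\<in>\<H>. f w = 1 \<and> (\<forall>y\<in>Y. f y = 0)"
  using assms(1,2)
proof (induction Y rule: finite_induct)
  case empty
  then show ?case using invariant_functions_const[of 1] by (intro bexI[of _ "\<lambda>_. 1"]) simp_all
next
  case (insert y Y)
  obtain f where f: "f \<in> \<H>" "f w = 1" "\<forall>y\<in>Y. f y = 0"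
    using insert by auto
  have y: "y \<in> W" "y \<notin> orbit G \<alpha> w" using insert.prems by auto
  have "orbit G \<alpha> w \<noteq> orbit G \<alpha> y" using act.orbit_refl[of y] y assms(4) by auto
  then obtain h where h: "h \<in> \<H>" "h w \<noteq> h y"
    using separates assms(3) y(1) by blast
  let ?f = "\<lambda>z. f z * (1 / (h w - h y) * (h z - h y))"
  have "?f \<in> \<H>"
    by (intro invariant_functions_mult invariant_functions_diff invariant_functions_const f h)
  moreover have "?f w = 1" using f(2) h(2) by simp
  moreover have "\<forall>z\<in>insert y Y. ?f z = 0" using f(3) by simp
  ultimately show ?case by (intro bexI[of _ ?f]) simp_all
qed

lemma J_at_function_mult:
  assumes "x \<in> carrier V" "holo_on V r (carrier V)" "holo_on V k (carrier V)" "holo_germ V x k \<in> J_at x"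
  shows "holo_germ V x (\<lambda>z. r z * k z) \<in> J_at x"
proof -
  have at: "holo_at V x r" "holo_at V x k" using assms by (simp_all add: holo_at_global)
  then have "holo_germ V x r \<in> carrier (\<O> x)" by auto
  from J_at_mult[OF assms(1) this assms(4)] show ?thesis by (simp add: holo_germ_mult at)
qed

lemma J_at_function_add:
  assumes "x \<in> carrier V" "holo_on V r (carrier V)" "holo_on V k (carrier V)"
    "holo_germ V x r \<in> J_at x" "holo_germ V x k \<in> J_at x"
  shows "holo_germ V x (\<lambda>z. r z + k z) \<in> J_at x"
  using J_at_add[OF assms(1,4,5)] assms holo_germ_add[of x r k] by (simp add: holo_at_global)

text \<open>With \<open>n = |G|\<close> and \<open>s = 1 - e0\<close>, the function \<open>(1 - s\<^sup>n)\<^sup>n\<close> acts as the identity where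
  \<open>e0 = 1\<close> and as \<open>0\<close> where \<open>e0 = 0\<close>; with \<open>t = 1 - h / c\<close>, where \<open>c\<close> is the value of \<open>h\<close>, the
  function \<open>1 / c \<cdot> (1 + t + \<dots> + t\<^sup>n\<^sup>-\<^sup>1)\<close> acts as an inverse of \<open>h\<close>.\<close>

lemma unit_class_multiple:
  assumes W: "stable W" "w \<in> W" and F: "F \<in> \<I> W"
    and separates: "\<forall>x\<in>W. \<forall>y\<in>W. orbit G \<alpha> x \<noteq> orbit G \<alpha> y \<longrightarrow>
      (\<exists>f\<in>\<H>. f x \<noteq> f y)"
    and h: "h \<in> \<H>" "h w \<noteq> 0"
    and Fh: "\<And>x. x \<in> orbit G \<alpha> w \<Longrightarrow> F x \<ominus>\<^bsub>\<M> x\<^esub> holo_germ V x h \<in> J_at x"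
  shows "\<exists>f\<in>\<H>.
    function_skew V f \<odot>\<^bsub>M_module G V \<alpha> W\<^esub> \<E> F = unit_class G V \<alpha> w"
proof -
  have wV: "w \<in> carrier V" using W by (auto simp: stable_def)
  have orbit_V: "x \<in> carrier V" if "x \<in> orbit G \<alpha> w" for x
    using that stable_orbit[OF wV] by (auto simp: stable_def)
  have orbit_val: "k x = k w" if "k \<in> \<H>" "x \<in> orbit G \<alpha> w" for k x
    using that wV by (auto simp: orbit_def invariant_functions_act)
  let ?n = "card (carrier G)"
  define Y where "Y = {x\<in>carrier V. F x \<noteq> \<zero>\<^bsub>\<M> x\<^esub>} - orbit G \<alpha> w"
  have "finite Y" "Y \<subseteq> W - orbit G \<alpha> w" using F by (auto simp: Y_def invariant_germs_iff)
  then obtain e0 where e0: "e0 \<in> \<H>" "e0 w = 1" "\<forall>y\<in>Y. e0 y = 0"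
    using separating_function[of Y W w] W separates by (auto simp: stable_def)
  define s where "s z = 1 - e0 z" for z
  define t where "t z = 1 - 1 / h w * h z" for z
  define e where "e z = (1 - s z ^ ?n) ^ ?n" for z
  define f0 where "f0 z = 1 / h w * (\<Sum>i<?n. t z ^ i)" for z
  define f where "f z = e z * f0 z" for z
  have s: "s \<in> \<H>" and t: "t \<in> \<H>"
    unfolding s_def t_def
    by (intro invariant_functions_mult invariant_functions_diff invariant_functions_const e0 h)+
  have e: "e \<in> \<H>" and f0: "f0 \<in> \<H>"
    unfolding e_def f0_def
    by (intro invariant_functions_mult invariant_functions_diff invariant_functions_const
        invariant_functions_power invariant_functions_sum s t)+
  have f: "f \<in> \<H>"
    unfolding f_def by (intro invariant_functions_mult e f0)
  note hol = invariant_functions_holo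
  define q where "q z = (\<Sum>i<?n. (1 - s z ^ ?n) ^ i)" for z
  define r where "r z = (\<Sum>i<?n. s z ^ i) ^ ?n * f0 z" for z
  have q: "q \<in> \<H>" and r: "r \<in> \<H>"
    unfolding q_def r_def
    by (intro invariant_functions_mult invariant_functions_diff invariant_functions_const
        invariant_functions_power invariant_functions_sum s f0)+
  have e_eq: "e z = 1 - s z ^ ?n * q z" for z
    using one_diff_power_eq[of "1 - s z ^ ?n" ?n] by (simp add: e_def q_def algebra_simps)
  have f0_eq: "f0 z * h z = 1 - t z ^ ?n" for z
    using one_diff_power_eq[of "t z" ?n] h(2) by (simp add: f0_def t_def)
  \<comment> \<open>The germ of \<open>f h - 1\<close> is in the ideal on the orbit of \<open>w\<close>, where \<open>s\<close> and \<open>t\<close> vanish; that of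
    \<open>f\<close> is in the ideal on \<open>Y\<close>, where \<open>e0\<close> vanishes.\<close>
  have fh: "f z * h z - 1 = - 1 * t z ^ ?n + (- q z * (1 - t z ^ ?n)) * s z ^ ?n" for z
  proof -
    have "f z * h z = e z * (f0 z * h z)" by (simp add: f_def)
    then show ?thesis unfolding f0_eq e_eq by (simp add: algebra_simps)
  qed
  have f_eq: "f z = r z * e0 z ^ ?n" for z
  proof -
    have "1 - s z ^ ?n = e0 z * (\<Sum>i<?n. s z ^ i)"
      using one_diff_power_eq[of "s z" ?n] by (simp add: s_def)
    then show ?thesis by (simp add: f_def e_def r_def power_mult_distrib)
  qed
  have at_orbit: "holo_germ V x (\<lambda>z. f z * h z - 1) \<in> J_at x" if x: "x \<in> orbit G \<alpha> w" for x
  proof -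
    have "s x = 0" "t x = 0" using orbit_val[OF s x] orbit_val[OF t x] e0(2) h(2) by (simp_all add: s_def t_def)
    then have "holo_germ V x (\<lambda>z. s z ^ ?n) \<in> J_at x" "holo_germ V x (\<lambda>z. t z ^ ?n) \<in> J_at x"
      using power_in_J_at[OF hol[OF s] _ orbit_V[OF x]] power_in_J_at[OF hol[OF t] _ orbit_V[OF x]] by simp_all
    then show ?thesis
      unfolding fh
      by (intro J_at_function_add J_at_function_mult orbit_V[OF x] holo_on_mult holo_on_power hol[OF s] hol[OF t]
          holo_on_uminus holo_on_diff holo_on_carrier_const hol[OF q])
  qed
  have at_Y: "holo_germ V y f \<in> J_at y" if y: "y \<in> Y" for y
  proof -
    have yV: "y \<in> carrier V" using y by (simp add: Y_def)
    have "f = (\<lambda>z. r z * e0 z ^ ?n)" by (rule ext) (rule f_eq)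
    then show ?thesis
      using J_at_function_mult[OF yV hol[OF r] holo_on_power[OF hol[OF e0(1)]]
          power_in_J_at[OF hol[OF e0(1)] _ yV]] e0(3) y by simp
  qed
  note u = unit_family_invariant[OF wV]
  note eF = invariant_germs_equivariant[OF F]
  have "\<E> (holo_function V f \<otimes>\<^bsub>\<F>\<^esub> F) = \<E> (unit_family w)"
  proof (subst E_class_eq_iff)
    show "\<forall>x\<in>carrier V. (holo_function V f \<otimes>\<^bsub>\<F>\<^esub> F) x \<ominus>\<^bsub>\<M> x\<^esub> unit_family w x \<in> J_at x"
    proof
      fix x assume x: "x \<in> carrier V"
      interpret M: cring "\<M> x" using x by (rule cring_mero_stalk)
      note Fx = equivariant_mero[OF eF x] equivariant_holo[OF eF x]
      note fx = holo_germ_in_mero[OF invariant_functions_at[OF f x]]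
      note hx = holo_germ_in_mero[OF invariant_functions_at[OF h(1) x]]
      have fO: "holo_germ V x f \<in> carrier (\<O> x)" using invariant_functions_at[OF f x] by auto
      have eq: "(holo_function V f \<otimes>\<^bsub>\<F>\<^esub> F) x = holo_germ V x f \<otimes>\<^bsub>\<M> x\<^esub> F x"
        using x by (simp add: family_ring_simps(5) holo_function_apply)
      consider "x \<in> orbit G \<alpha> w" | "x \<in> Y" | "x \<notin> orbit G \<alpha> w" "F x = \<zero>\<^bsub>\<M> x\<^esub>"
        using x by (auto simp: Y_def)
      then show "(holo_function V f \<otimes>\<^bsub>\<F>\<^esub> F) x \<ominus>\<^bsub>\<M> x\<^esub> unit_family w x \<in> J_at x"
      proof cases
        case 1
        have "holo_germ V x (\<lambda>z. f z * h z) = holo_germ V x (\<lambda>z. f z * h z - 1) \<oplus>\<^bsub>\<M> x\<^esub> \<one>\<^bsub>\<M> x\<^esub>"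
          using holo_germ_add[of x "\<lambda>z. f z * h z - 1" "\<lambda>_. 1"] x
            invariant_functions_at[OF invariant_functions_diff[OF
                invariant_functions_mult[OF f h(1)] invariant_functions_const[of 1]] x]
          by (simp add: mero_stalk_simps(2) holo_at_const)
        then have fh_eq: "holo_germ V x f \<otimes>\<^bsub>\<M> x\<^esub> holo_germ V x h =
            holo_germ V x (\<lambda>z. f z * h z - 1) \<oplus>\<^bsub>\<M> x\<^esub> \<one>\<^bsub>\<M> x\<^esub>"
          using holo_germ_mult[OF invariant_functions_at[OF f x] invariant_functions_at[OF h(1) x]] by simp
        note kx = holo_mero[OF x J_at_holo[OF at_orbit[OF 1]]]
        have "F x = (F x \<ominus>\<^bsub>\<M> x\<^esub> holo_germ V x h) \<oplus>\<^bsub>\<M> x\<^esub> holo_germ V x h"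
          using Fx hx by (simp add: M.minus_eq M.a_assoc M.l_neg)
        then have "holo_germ V x f \<otimes>\<^bsub>\<M> x\<^esub> F x =
            holo_germ V x f \<otimes>\<^bsub>\<M> x\<^esub> (F x \<ominus>\<^bsub>\<M> x\<^esub> holo_germ V x h) \<oplus>\<^bsub>\<M> x\<^esub>
            (holo_germ V x (\<lambda>z. f z * h z - 1) \<oplus>\<^bsub>\<M> x\<^esub> \<one>\<^bsub>\<M> x\<^esub>)"
          unfolding fh_eq[symmetric] using Fx hx fx by (metis M.minus_closed M.r_distr)
        then have "holo_germ V x f \<otimes>\<^bsub>\<M> x\<^esub> F x \<ominus>\<^bsub>\<M> x\<^esub> \<one>\<^bsub>\<M> x\<^esub> =
            holo_germ V x f \<otimes>\<^bsub>\<M> x\<^esub> (F x \<ominus>\<^bsub>\<M> x\<^esub> holo_germ V x h) \<oplus>\<^bsub>\<M> x\<^esub>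
            holo_germ V x (\<lambda>z. f z * h z - 1)"
          using Fx hx fx kx by (simp add: M.minus_eq M.a_assoc M.r_neg)
        moreover have "holo_germ V x f \<otimes>\<^bsub>\<M> x\<^esub> (F x \<ominus>\<^bsub>\<M> x\<^esub> holo_germ V x h) \<oplus>\<^bsub>\<M> x\<^esub>
            holo_germ V x (\<lambda>z. f z * h z - 1) \<in> J_at x"
          by (intro J_at_add J_at_mult x fO Fh[OF 1] at_orbit[OF 1])
        ultimately show ?thesis using 1 x by (simp add: eq unit_family_def)
      next
        case 2
        have "F x \<otimes>\<^bsub>\<M> x\<^esub> holo_germ V x f \<in> J_at x"
          by (intro J_at_mult x Fx(2) at_Y[OF 2])
        then show ?thesis
          using 2 x M.m_comm[OF Fx(1) fx] M.m_closed[OF fx Fx(1)]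
          by (simp add: eq unit_family_def Y_def M.minus_eq)
      next
        case 3
        then show ?thesis
          using x fx J_at_zero[OF x] by (simp add: eq unit_family_def M.minus_eq)
      qed
    qed
  qed (intro equivariant_mult equivariant_holo_function f eF invariant_germs_equivariant[OF u])+
  then show ?thesis using smult_function[OF W(1) f F] f unit_class_eq by metis
qed

end

section \<open>Unique maximal submodules\<close>

text \<open>The sum of two submodules that avoid the generator \<open>u\<close> still avoids it, because their
  elements lie in the additively closed set \<open>Z\<close>. Hence the union of all proper submodules is a
  submodule.\<close>

lemma unique_maximal_submodule:
  fixes M :: "('b, 'c) module" and R :: "('b, 'd) ring_scheme"
  assumes M: "abelian_group M"
    and closed: "\<And>a m. a \<in> carrier R \<Longrightarrow> m \<in> carrier M \<Longrightarrow> a \<odot>\<^bsub>M\<^esub> m \<in> carrier M"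
    and distr: "\<And>a m m'. a \<in> carrier R \<Longrightarrow> m \<in> carrier M \<Longrightarrow> m' \<in> carrier M \<Longrightarrow>
      a \<odot>\<^bsub>M\<^esub> (m \<oplus>\<^bsub>M\<^esub> m') = a \<odot>\<^bsub>M\<^esub> m \<oplus>\<^bsub>M\<^esub> a \<odot>\<^bsub>M\<^esub> m'"
    and u: "u \<in> carrier M" "u \<notin> Z"
    and Z: "\<zero>\<^bsub>M\<^esub> \<in> Z" "\<And>m m'. m \<in> Z \<Longrightarrow> m' \<in> Z \<Longrightarrow> m \<oplus>\<^bsub>M\<^esub> m' \<in> Z"
    and avoid: "\<And>P. submodule P R M \<Longrightarrow> u \<notin> P \<Longrightarrow> P \<subseteq> Z"
  defines "N \<equiv> (\<lambda>P. submodule P R M) hull {u}"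
  shows "\<exists>!P. submodule P R M \<and> P \<subset> N \<and> (\<forall>Q. submodule Q R M \<longrightarrow> P \<subseteq> Q \<longrightarrow> Q \<subset> N \<longrightarrow> Q = P)"
proof -
  interpret M: abelian_group M by (rule M)
  have sub_iff: "submodule P R M \<longleftrightarrow> P \<subseteq> carrier M \<and> \<zero>\<^bsub>M\<^esub> \<in> P \<and>
      (\<forall>m\<in>P. \<forall>m'\<in>P. m \<oplus>\<^bsub>M\<^esub> m' \<in> P) \<and> (\<forall>m\<in>P. \<ominus>\<^bsub>M\<^esub> m \<in> P) \<and>
      (\<forall>a\<in>carrier R. \<forall>m\<in>P. a \<odot>\<^bsub>M\<^esub> m \<in> P)" for P
    by (auto simp: submodule_def submodule_axioms_def subgroup_def a_inv_def)
  have sub_carrier: "m \<in> carrier M" if "submodule P R M" "m \<in> P" for P m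
    using that unfolding sub_iff[of P] by auto
  have sub_closed: "\<zero>\<^bsub>M\<^esub> \<in> P" "m \<in> P \<Longrightarrow> m' \<in> P \<Longrightarrow> m \<oplus>\<^bsub>M\<^esub> m' \<in> P"
    "m \<in> P \<Longrightarrow> \<ominus>\<^bsub>M\<^esub> m \<in> P" "a \<in> carrier R \<Longrightarrow> m \<in> P \<Longrightarrow> a \<odot>\<^bsub>M\<^esub> m \<in> P"
    if "submodule P R M" for P m m' a
    using that unfolding sub_iff[of P] by auto
  have smult_zero: "a \<odot>\<^bsub>M\<^esub> \<zero>\<^bsub>M\<^esub> = \<zero>\<^bsub>M\<^esub>" if "a \<in> carrier R" for a
    using distr[OF that M.zero_closed M.zero_closed] closed[OF that M.zero_closed] by simp
  have carrier: "submodule (carrier M) R M" by (auto simp: sub_iff closed)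
  have N: "submodule N R M"
  proof -
    have "submodule (\<Inter>T) R M" if T: "T \<noteq> {}" "\<forall>P\<in>T. submodule P R M" for T
    proof -
      obtain P where "P \<in> T" using T(1) by blast
      then have "\<Inter>T \<subseteq> carrier M" using T(2) sub_carrier[of P] by blast
      then show ?thesis
        unfolding sub_iff[of "\<Inter>T"]
        using T(2) by (intro conjI ballI InterI) (auto intro: sub_closed)
    qed
    moreover have "carrier M \<in> {P. submodule P R M \<and> {u} \<subseteq> P}" using carrier u(1) by simp
    ultimately show ?thesis
      unfolding N_def hull_def by (smt (verit) empty_iff mem_Collect_eq)
  qed
  have uN: "u \<in> N" by (auto simp: N_def intro: hull_inc)
  have proper: "P \<subset> N \<longleftrightarrow> P \<subseteq> N \<and> u \<notin> P" if "submodule P R M" for P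
  proof -
    have "N \<subseteq> P" if "u \<in> P" using that \<open>submodule P R M\<close> by (simp add: N_def hull_minimal)
    then show ?thesis using uN by blast
  qed
  define U where "U = \<Union>{P. submodule P R M \<and> P \<subset> N}"
  have sum: "\<exists>P. submodule P R M \<and> P \<subset> N \<and> m \<oplus>\<^bsub>M\<^esub> m' \<in> P"
    if P: "submodule P R M" "P \<subset> N" "m \<in> P" and P': "submodule P' R M" "P' \<subset> N" "m' \<in> P'" for P P' m m'
  proof -
    define S where "S = {m \<oplus>\<^bsub>M\<^esub> m' | m m'. m \<in> P \<and> m' \<in> P'}"
    note p = sub_closed[OF P(1)] and p' = sub_closed[OF P'(1)] and n = sub_closed[OF N]
    have mem: "x \<in> carrier M" if "x \<in> P \<or> x \<in> P'" for x
      using that sub_carrier[OF P(1)] sub_carrier[OF P'(1)] by blast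
    have "submodule S R M"
      unfolding sub_iff[of S]
    proof (intro conjI ballI)
      show "S \<subseteq> carrier M" using mem by (auto simp: S_def)
      show "\<zero>\<^bsub>M\<^esub> \<in> S" using p(1) p'(1) M.l_zero[OF M.zero_closed, symmetric] unfolding S_def by blast
    next
      fix x y assume "x \<in> S" "y \<in> S"
      then obtain a a' b b' where ab: "a \<in> P" "a' \<in> P'" "x = a \<oplus>\<^bsub>M\<^esub> a'" "b \<in> P" "b' \<in> P'" "y = b \<oplus>\<^bsub>M\<^esub> b'"
        by (auto simp: S_def)
      then have "x \<oplus>\<^bsub>M\<^esub> y = (a \<oplus>\<^bsub>M\<^esub> b) \<oplus>\<^bsub>M\<^esub> (a' \<oplus>\<^bsub>M\<^esub> b')"
        using mem by (simp add: M.a_ac)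
      then show "x \<oplus>\<^bsub>M\<^esub> y \<in> S" using p(2)[OF ab(1,4)] p'(2)[OF ab(2,5)] unfolding S_def by blast
    next
      fix x assume "x \<in> S"
      then obtain a a' where ab: "a \<in> P" "a' \<in> P'" "x = a \<oplus>\<^bsub>M\<^esub> a'" by (auto simp: S_def)
      then have "\<ominus>\<^bsub>M\<^esub> x = \<ominus>\<^bsub>M\<^esub> a \<oplus>\<^bsub>M\<^esub> \<ominus>\<^bsub>M\<^esub> a'" using mem by (simp add: M.minus_add)
      then show "\<ominus>\<^bsub>M\<^esub> x \<in> S" using p(3)[OF ab(1)] p'(3)[OF ab(2)] unfolding S_def by blast
    next
      fix c x assume c: "c \<in> carrier R" and "x \<in> S"
      then obtain a a' where ab: "a \<in> P" "a' \<in> P'" "x = a \<oplus>\<^bsub>M\<^esub> a'" by (auto simp: S_def)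
      then have "c \<odot>\<^bsub>M\<^esub> x = c \<odot>\<^bsub>M\<^esub> a \<oplus>\<^bsub>M\<^esub> c \<odot>\<^bsub>M\<^esub> a'" using mem c by (simp add: distr)
      then show "c \<odot>\<^bsub>M\<^esub> x \<in> S" using p(4)[OF c ab(1)] p'(4)[OF c ab(2)] unfolding S_def by blast
    qed
    moreover have "S \<subseteq> Z"
      using avoid[OF P(1)] avoid[OF P'(1)] Z(2) P P' by (auto simp: S_def proper)
    moreover have "S \<subseteq> N" using P(2) P'(2) n(2) by (auto simp: S_def)
    ultimately have "submodule S R M" "S \<subset> N" using u(2) proper by auto
    moreover have "m \<oplus>\<^bsub>M\<^esub> m' \<in> S" using P(3) P'(3) by (auto simp: S_def)
    ultimately show ?thesis by blast
  qed
  have zero_sub: "submodule {\<zero>\<^bsub>M\<^esub>} R M" "{\<zero>\<^bsub>M\<^esub>} \<subset> N"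
  proof -
    show *: "submodule {\<zero>\<^bsub>M\<^esub>} R M" by (simp add: sub_iff smult_zero)
    have "\<zero>\<^bsub>M\<^esub> \<in> N" by (rule sub_closed(1)[OF N])
    then show "{\<zero>\<^bsub>M\<^esub>} \<subset> N" using u(2) Z(1) by (auto simp: proper[OF *])
  qed
  have U: "submodule U R M"
    unfolding sub_iff[of U]
  proof (intro conjI ballI)
    show "U \<subseteq> carrier M" using sub_carrier by (auto simp: U_def)
    show "\<zero>\<^bsub>M\<^esub> \<in> U" unfolding U_def using zero_sub by blast
    show "m \<oplus>\<^bsub>M\<^esub> m' \<in> U" if "m \<in> U" "m' \<in> U" for m m'
      using that sum unfolding U_def by blast
    show "\<ominus>\<^bsub>M\<^esub> m \<in> U" if "m \<in> U" for m
      using that sub_closed(3) unfolding U_def by blast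
    show "a \<odot>\<^bsub>M\<^esub> m \<in> U" if "a \<in> carrier R" "m \<in> U" for a m
      using that sub_closed(4) unfolding U_def by blast
  qed
  have U_proper: "U \<subset> N"
    unfolding proper[OF U] using proper by (auto simp: U_def)
  have below: "Q \<subseteq> U" if "submodule Q R M" "Q \<subset> N" for Q
    using that by (auto simp: U_def)
  show ?thesis
  proof (rule ex1I[of _ U])
    show "submodule U R M \<and> U \<subset> N \<and> (\<forall>Q. submodule Q R M \<longrightarrow> U \<subseteq> Q \<longrightarrow> Q \<subset> N \<longrightarrow> Q = U)"
      using U U_proper below by blast
    show "P = U" if "submodule P R M \<and> P \<subset> N \<and> (\<forall>Q. submodule Q R M \<longrightarrow> P \<subseteq> Q \<longrightarrow> Q \<subset> N \<longrightarrow> Q = P)" for P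
      using that U U_proper below by blast
  qed
qed

theorem proposition27:
  fixes V :: "('a, 'n::finite) lie_group"
    and G :: "('g, 'h) monoid_scheme"
    and \<alpha> :: "'g \<Rightarrow> 'a \<Rightarrow> 'a"
    and \<Gamma> W :: "'a set" and v w :: 'a
    and A :: "'a skew set"
  assumes "complex_Lie_group V"
    and "group G" and "finite (carrier G)"
    and "holomorphic_group_action G V \<alpha>"
    and "subgroup \<Gamma> V" and "\<forall>g\<in>carrier G. \<alpha> g ` \<Gamma> = \<Gamma>"
    and "v \<in> carrier V"
    and W: "W = semidirect_orbit G V \<alpha> \<Gamma> v"
    and "A \<subseteq> skew_invariants G V \<alpha>" and "skew_subalgebra V A"
    and "function_skew V ` invariant_functions G V \<alpha> \<subseteq> A"
    and preserves: "\<forall>a\<in>A. \<forall>F\<in>invariant_germs G V \<alpha> W. skew_act V a F \<in> invariant_germs G V \<alpha> W"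
    and "w \<in> W"
    and separates: "\<forall>x\<in>W. \<forall>y\<in>W. orbit G \<alpha> x \<noteq> orbit G \<alpha> y \<longrightarrow>
      (\<exists>f\<in>invariant_functions G V \<alpha>. f x \<noteq> f y)"
    and generated: "M_span G V \<alpha> (function_skew V ` invariant_functions G V \<alpha>) (orbit G \<alpha> w)
        {unit_class G V \<alpha> w} = carrier (M_module G V \<alpha> (orbit G \<alpha> w))"
  shows "\<exists>!P. is_maximal_submodule G V \<alpha> A W (M_span G V \<alpha> A W {unit_class G V \<alpha> w}) P"
proof -
  interpret lie_action V G \<alpha>
    by (intro lie_action.intro lie.intro lie_action_axioms.intro assms(1-4))
  have stable: "stable W"
    unfolding stable_def
  proof (intro conjI ballI subsetI)
    have \<Gamma>: "\<xi> \<otimes>\<^bsub>V\<^esub> v \<in> carrier V" if "\<xi> \<in> \<Gamma>" for \<xi>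
      using subgroup.mem_carrier[OF assms(5) that] assms(7) by simp
    show "x \<in> carrier V" if "x \<in> W" for x
      using that \<Gamma> by (auto simp: W semidirect_orbit_def act_closed)
    fix g x assume g: "g \<in> carrier G" and "x \<in> W"
    then obtain h \<xi> where h: "h \<in> carrier G" "\<xi> \<in> \<Gamma>" "x = \<alpha> h (\<xi> \<otimes>\<^bsub>V\<^esub> v)"
      by (auto simp: W semidirect_orbit_def)
    then have "\<alpha> g x = \<alpha> (g \<otimes>\<^bsub>G\<^esub> h) (\<xi> \<otimes>\<^bsub>V\<^esub> v)" using g \<Gamma> by (simp add: act_mult)
    then show "\<alpha> g x \<in> W" using g h G.m_closed[OF g h(1)] unfolding W semidirect_orbit_def by blast
  qed
  then have wV: "w \<in> carrier V" using \<open>w \<in> W\<close> by (auto simp: stable_def)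
  have "orbit G \<alpha> w \<subseteq> W" using stable \<open>w \<in> W\<close> by (auto simp: stable_def orbit_def)
  note uW = invariant_germs_mono[OF this unit_family_invariant[OF wV]]
  let ?M = "M_module G V \<alpha> W" and ?R = "(skew_ring V)\<lparr>carrier := A\<rparr>"
  \<comment> \<open>the classes that vanish at \<open>w\<close>\<close>
  define Z where "Z = {E_class G V \<alpha> F | F. F \<in> invariant_germs G V \<alpha> W \<and> F w \<in> max_ideal w}"
  have smult: "a \<odot>\<^bsub>?M\<^esub> E_class G V \<alpha> F = E_class G V \<alpha> (skew_act V a F)"
    "skew_act V a F \<in> invariant_germs G V \<alpha> W" "a \<in> carrier (skew_ring V)"
    if "a \<in> A" "F \<in> invariant_germs G V \<alpha> W" for a F
  proof -
    show a: "a \<in> carrier (skew_ring V)" using that(1) assms(9) by (auto simp: skew_invariants_def)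
    show "skew_act V a F \<in> invariant_germs G V \<alpha> W" using that preserves by blast
    show "a \<odot>\<^bsub>?M\<^esub> E_class G V \<alpha> F = E_class G V \<alpha> (skew_act V a F)"
      using that(1) preserves by (intro smult_E_class stable a that(2)) blast
  qed
  note eqv = invariant_germs_equivariant and lift = M_lift[OF _ stable]
  interpret m: ideal "max_ideal w" "holo_stalk V w" by (rule ideal_max_ideal[OF wV])
  have "\<exists>!P. submodule P ?R ?M \<and> P \<subset> (\<lambda>P. submodule P ?R ?M) hull {unit_class G V \<alpha> w} \<and>
      (\<forall>Q. submodule Q ?R ?M \<longrightarrow> P \<subseteq> Q \<longrightarrow> Q \<subset> (\<lambda>P. submodule P ?R ?M) hull {unit_class G V \<alpha> w} \<longrightarrow> Q = P)"
  proof (rule unique_maximal_submodule[where Z = Z])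
    show "abelian_group ?M" by (rule abelian_group_M[OF stable])
  next
    fix a m assume a: "a \<in> carrier ?R" and m: "m \<in> carrier ?M"
    obtain F where "F \<in> invariant_germs G V \<alpha> W" "m = E_class G V \<alpha> F" using lift[OF m] by blast
    then show "a \<odot>\<^bsub>?M\<^esub> m \<in> carrier ?M" using a smult E_class_in_M by simp
  next
    fix a m m' assume a: "a \<in> carrier ?R" and m: "m \<in> carrier ?M" "m' \<in> carrier ?M"
    obtain F F' where F: "F \<in> invariant_germs G V \<alpha> W" "m = E_class G V \<alpha> F"
      "F' \<in> invariant_germs G V \<alpha> W" "m' = E_class G V \<alpha> F'"
      using lift[OF m(1)] lift[OF m(2)] by blast
    have A: "a \<in> A" using a by simp
    have "a \<odot>\<^bsub>?M\<^esub> (m \<oplus>\<^bsub>?M\<^esub> m') = E_class G V \<alpha> (skew_act V a (F \<oplus>\<^bsub>family_ring V\<^esub> F'))"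
      using smult(1)[OF A invariant_germs_add[OF F(1,3)]]
      by (simp add: F E_class_add[OF eqv[OF F(1)] eqv[OF F(3)], of W])
    also have "skew_act V a (F \<oplus>\<^bsub>family_ring V\<^esub> F') = skew_act V a F \<oplus>\<^bsub>family_ring V\<^esub> skew_act V a F'"
      using eqv[OF F(1)] eqv[OF F(3)] smult(3)[OF A F(1)] by (simp add: skew_act_add equivariant_carrier)
    finally show "a \<odot>\<^bsub>?M\<^esub> (m \<oplus>\<^bsub>?M\<^esub> m') = a \<odot>\<^bsub>?M\<^esub> m \<oplus>\<^bsub>?M\<^esub> a \<odot>\<^bsub>?M\<^esub> m'"
      using E_class_add[OF eqv[OF smult(2)[OF A F(1)]] eqv[OF smult(2)[OF A F(3)]], of W]
      by (simp add: F smult(1)[OF A])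
  next
    show "unit_class G V \<alpha> w \<in> carrier ?M" using E_class_in_M[OF uW] by (simp add: unit_class_eq)
  next
    show "unit_class G V \<alpha> w \<notin> Z"
    proof
      assume "unit_class G V \<alpha> w \<in> Z"
      then obtain F where F: "F \<in> invariant_germs G V \<alpha> W" "F w \<in> max_ideal w"
        "E_class G V \<alpha> F = E_class G V \<alpha> (unit_family w)"
        by (auto simp: Z_def unit_class_eq)
      obtain f where f: "F w = holo_germ V w f" "holo_at V w f" "f w = 0"
        using F(2) by (auto simp: max_ideal_def)
      have "F w \<ominus>\<^bsub>mero_stalk V w\<^esub> unit_family w w \<in> J_at w"
        using F(3) E_class_eq_iff[OF eqv[OF F(1)] eqv[OF uW]] wV by blast
      moreover have "F w \<ominus>\<^bsub>mero_stalk V w\<^esub> unit_family w w = holo_germ V w (\<lambda>z. f z + - 1)"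
        using wV act.orbit_refl[OF wV] holo_germ_uminus[OF holo_at_const[OF wV, of 1]]
          holo_germ_add[OF f(2) holo_at_const[OF wV, of "- 1"]]
        by (simp add: unit_family_def f(1) mero_stalk_simps(2) a_minus_def)
      ultimately have "holo_germ V w (\<lambda>z. f z + - 1) \<in> max_ideal w" using J_at_max[OF wV] by auto
      then have "f w + - 1 = 0"
        using holo_at_add[OF f(2) holo_at_const[OF wV]] by (rule max_idealD)
      then show False using f(3) by simp
    qed
  next
    have "\<zero>\<^bsub>family_ring V\<^esub> w \<in> max_ideal w"
      using additive_subgroup.zero_closed[OF m.is_additive_subgroup] wV by (simp add: family_ring_simps(3))
    then show "\<zero>\<^bsub>?M\<^esub> \<in> Z" unfolding Z_def E_class_zero[symmetric] using invariant_germs_zero[of W] by blast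
  next
    fix m m' assume "m \<in> Z" "m' \<in> Z"
    then obtain F F' where F: "F \<in> invariant_germs G V \<alpha> W" "F w \<in> max_ideal w" "m = E_class G V \<alpha> F"
      "F' \<in> invariant_germs G V \<alpha> W" "F' w \<in> max_ideal w" "m' = E_class G V \<alpha> F'"
      by (auto simp: Z_def)
    have "(F \<oplus>\<^bsub>family_ring V\<^esub> F') w \<in> max_ideal w"
      using additive_subgroup.a_closed[OF m.is_additive_subgroup F(2,5)] wV by (simp add: family_ring_simps(4))
    then show "m \<oplus>\<^bsub>?M\<^esub> m' \<in> Z"
      unfolding Z_def using E_class_add[OF eqv[OF F(1)] eqv[OF F(4)], of W] invariant_germs_add[OF F(1,4)] F(3,6)
      by (intro CollectI exI[of _ "F \<oplus>\<^bsub>family_ring V\<^esub> F'"]) simp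
  next
    fix P assume P: "submodule P ?R ?M" "unit_class G V \<alpha> w \<notin> P"
    show "P \<subseteq> Z"
    proof
      fix m assume m: "m \<in> P"
      then have "m \<in> carrier ?M" using subgroup.subset[OF submodule.axioms(1)[OF P(1)]] by auto
      then obtain F where F: "F \<in> invariant_germs G V \<alpha> W" "m = E_class G V \<alpha> F" using lift by blast
      obtain h where h: "h \<in> invariant_functions G V \<alpha>"
        "\<And>x. x \<in> orbit G \<alpha> w \<Longrightarrow> F x \<ominus>\<^bsub>mero_stalk V x\<^esub> holo_germ V x h \<in> J_at x"
        using leading_function[OF wV \<open>w \<in> W\<close> F(1) generated] by blast
      have "h w = 0"
      proof (rule ccontr)
        assume "h w \<noteq> 0"
        then obtain f where f: "f \<in> invariant_functions G V \<alpha>" "function_skew V f \<odot>\<^bsub>?M\<^esub> m = unit_class G V \<alpha> w"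
          using unit_class_multiple[OF stable \<open>w \<in> W\<close> F(1) separates h(1) _ h(2)] F(2) by blast
        then have "function_skew V f \<in> carrier ?R" using assms(11) by auto
        then show False using submodule.smult_closed[OF P(1) _ m] f(2) P(2) by metis
      qed
      have "holo_germ V w h \<in> max_ideal w"
        using \<open>h w = 0\<close> invariant_functions_at[OF h(1) wV] by (auto simp: max_ideal_def)
      moreover have "F w \<ominus>\<^bsub>mero_stalk V w\<^esub> holo_germ V w h \<in> max_ideal w"
        using h(2)[OF act.orbit_refl[OF wV]] J_at_max[OF wV] by blast
      ultimately have "(F w \<ominus>\<^bsub>mero_stalk V w\<^esub> holo_germ V w h) \<oplus>\<^bsub>mero_stalk V w\<^esub> holo_germ V w h \<in> max_ideal w"
        using additive_subgroup.a_closed[OF m.is_additive_subgroup] by fastforce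
      moreover interpret Mw: cring "mero_stalk V w" using wV by (rule cring_mero_stalk)
      have "(F w \<ominus>\<^bsub>mero_stalk V w\<^esub> holo_germ V w h) \<oplus>\<^bsub>mero_stalk V w\<^esub> holo_germ V w h = F w"
        using equivariant_mero[OF eqv[OF F(1)] wV] holo_germ_in_mero[OF invariant_functions_at[OF h(1) wV]]
        by (simp add: Mw.minus_eq Mw.a_assoc Mw.l_neg)
      ultimately have "F w \<in> max_ideal w" by simp
      then show "m \<in> Z" using F by (auto simp: Z_def)
    qed
  qed
  then show ?thesis unfolding is_maximal_submodule_def M_span_def .
qed

end
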